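(* Let $2\le k\le n-2$, let $\omega_k=(1,\dots,1,0,\dots,0)\in\mathbb{R}^n$ ($k$ ones followed by $n-k$ zeros), and let $N\in\mathfrak{u}_n$. Then the gradient flow of the function $L\mapsto\mathrm{tr}(LN)$ on $\mathcal{O}_{\omega_k}$ (in the Kähler, normal, or induced metric, which coincide up to a positive constant factor on this orbit) strictly preserves positivity if and only if the following hold: $\mathrm{i}N$ is real; $N_{i,j}=0$ for all $i,j\in\{1,\dots,n\}$ with $i-j\not\equiv -1,0,1\pmod n$; $$\mathrm{i}N_{1,2},\ \mathrm{i}N_{2,3},\ \dots,\ \mathrm{i}N_{n-1,n},\ (-1)^{k-1}\mathrm{i}N_{n,1}\ \ge\ 0;$$ and at least $n-1$ of these $n$ inequalities are strict.
   Context: Here $\mathrm{i}=\sqrt{-1}$; $\mathrm{U}_n$ is the unitary group and $\mathfrak{u}_n$ the Lie algebra of skew-Hermitian $n\times n$ matrices. For weakly decreasing $\lambda\in\mathbb{R}^n$, $\mathcal{O}_\lambda=\{g(\mathrm{i}\,\mathrm{Diag}(\lambda))g^{-1}:g\in\mathrm{U}_n\}$. $\mathrm{U}_n^{>0}$ (resp. $\mathrm{U}_n^{\ge 0}$) is the set of $g\in\mathrm{U}_n$ all of whose left-justified minors (row set $I$, column set $\{1,\dots,|I|\}$) are positive (resp. nonnegative) real numbers; $\mathcal{O}_\lambda^{>0}=\{g(\mathrm{i}\,\mathrm{Diag}(\lambda))g^{-1}:g\in\mathrm{U}_n^{>0}\}$, and $\mathcal{O}_\lambda^{\ge 0}$ is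 its closure, equal to $\{g(\mathrm{i}\,\mathrm{Diag}(\lambda))g^{-1}:g\in\mathrm{U}_n^{\ge 0}\}$. Let $\kappa(L,M)=2n\,\mathrm{tr}(LM)-2\,\mathrm{tr}(L)\mathrm{tr}(M)$ and $\mathrm{ad}_L(X)=[L,X]=LX-XL$. The tangent space of $\mathcal{O}_\lambda$ at $L$ is $\{[L,X]:X\in\mathfrak{u}_n\}$. For $X\in\mathfrak{u}_n$ write $X=X^L+X_L$ with $X^L\in\mathrm{im}(\mathrm{ad}_L)$, $X_L\in\ker(\mathrm{ad}_L)$ (uniquely). The metrics on $\mathcal{O}_\lambda$ are: normal, $\langle[L,X],[L,Y]\rangle_{\mathrm{normal}}=-\kappa(X^L,Y^L)$; induced, $\langle[L,X],[L,Y]\rangle_{\mathrm{induced}}=-\kappa([L,X],[L,Y])$; Kähler, $\langle[L,X],[L,Y]\rangle_{\mathrm{K\ddot ahler}}=\langle\sqrt{-\mathrm{ad}_L^2}\,([L,X]),[L,Y]\rangle_{\mathrm{normal}}$, with $\sqrt{-\mathrm{ad}_L^2}$ the positive square root of the positive semidefinite operator $-\mathrm{ad}_L^2$. The gradient flow of a function $H$ is the solution of $\dot L(t)=\mathrm{grad}(H)(L(t))$ (steepest ascent), defined for all $t\in\mathbb{R}$. A flow on $\mathcal{O}_\lambda$ strictly preserves positivity if $L(t)\in\mathcal{O}_\lambda^{>0}$ for every initial point $L(0)\in\mathcal{O}_\lambda^{\ge 0}$ and all $t>0$. *)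

theory Defs
  imports
    Complex_Main
    "HOL-Number_Theory.Cong"
    "Jordan_Normal_Form.Schur_Decomposition"
    "Jordan_Normal_Form.DL_Submatrix"
begin

(* Matrices have 0-based indices, so the entry (i, j) of the mathematics is the entry
   (i - 1, j - 1) here. *)

definition mat_trace :: "complex mat \<Rightarrow> complex" where
  "mat_trace A = (\<Sum>i<dim_row A. A $$ (i, i))"

definition unitary_group :: "nat \<Rightarrow> complex mat set" where
  "unitary_group n = {g \<in> carrier_mat n n. g * mat_adjoint g = 1\<^sub>m n \<and> mat_adjoint g * g = 1\<^sub>m n}"

definition lie_u :: "nat \<Rightarrow> complex mat set" where
  "lie_u n = {X \<in> carrier_mat n n. mat_adjoint X = - X}"

(* The positive part of the unitary group, by left-justified minors; the empty minor is 1. *)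
definition unitary_pos :: "nat \<Rightarrow> complex mat set" where
  "unitary_pos n = {g \<in> unitary_group n. \<forall>I \<subseteq> {..<n}.
     det (submatrix g I {..<card I}) \<in> \<real> \<and> 0 < Re (det (submatrix g I {..<card I}))}"

(* For unitary g the inverse of g is its adjoint. *)
definition conj_diag :: "nat \<Rightarrow> (nat \<Rightarrow> real) \<Rightarrow> complex mat \<Rightarrow> complex mat" where
  "conj_diag n l g = g * mat_diag n (\<lambda>i. \<i> * complex_of_real (l i)) * mat_adjoint g"

definition adj_orbit :: "nat \<Rightarrow> (nat \<Rightarrow> real) \<Rightarrow> complex mat set" where
  "adj_orbit n l = conj_diag n l ` unitary_group n"

definition orbit_pos :: "nat \<Rightarrow> (nat \<Rightarrow> real) \<Rightarrow> complex mat set" where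
  "orbit_pos n l = conj_diag n l ` unitary_pos n"

(* The type of matrices of variable dimension carries no topology, so closure and derivative
   are spelled out entrywise. *)
definition mat_closure :: "nat \<Rightarrow> complex mat set \<Rightarrow> complex mat set" where
  "mat_closure n S = {A \<in> carrier_mat n n. \<exists>s. (\<forall>m::nat. s m \<in> S) \<and>
     (\<forall>i<n. \<forall>j<n. (\<lambda>m. s m $$ (i, j)) \<longlonglongrightarrow> A $$ (i, j))}"

definition orbit_nonneg :: "nat \<Rightarrow> (nat \<Rightarrow> real) \<Rightarrow> complex mat set" where
  "orbit_nonneg n l = mat_closure n (orbit_pos n l)"

definition has_mat_derivative ::
    "nat \<Rightarrow> (real \<Rightarrow> complex mat) \<Rightarrow> complex mat \<Rightarrow> real \<Rightarrow> bool" where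
  "has_mat_derivative n c V t \<longleftrightarrow>
     (\<forall>i<n. \<forall>j<n. ((\<lambda>s. c s $$ (i, j)) has_vector_derivative V $$ (i, j)) (at t))"

definition ad :: "complex mat \<Rightarrow> complex mat \<Rightarrow> complex mat" where
  "ad L X = L * X - X * L"

definition kappa :: "nat \<Rightarrow> complex mat \<Rightarrow> complex mat \<Rightarrow> complex" where
  "kappa n L M = 2 * of_nat n * mat_trace (L * M) - 2 * mat_trace L * mat_trace M"

definition tangent_space :: "nat \<Rightarrow> complex mat \<Rightarrow> complex mat set" where
  "tangent_space n L = ad L ` lie_u n"

(* The component of X in im (ad L), in the decomposition of u(n) as im (ad L) + ker (ad L). *)
definition im_part :: "nat \<Rightarrow> complex mat \<Rightarrow> complex mat \<Rightarrow> complex mat" where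
  "im_part n L X = (THE Z. Z \<in> ad L ` lie_u n \<and> X - Z \<in> lie_u n \<and> ad L (X - Z) = 0\<^sub>m n n)"

(* Any X in u(n) with V = [L, X]; the normal metric depends only on its im (ad L) component,
   which does not depend on the choice. *)
definition lift :: "nat \<Rightarrow> complex mat \<Rightarrow> complex mat \<Rightarrow> complex mat" where
  "lift n L V = (SOME X. X \<in> lie_u n \<and> V = ad L X)"

(* kappa takes real values on u(n), so Re discards nothing in the metrics. *)
definition normal_metric :: "nat \<Rightarrow> complex mat \<Rightarrow> complex mat \<Rightarrow> complex mat \<Rightarrow> real" where
  "normal_metric n L V W =
     Re (- kappa n (im_part n L (lift n L V)) (im_part n L (lift n L W)))"

definition induced_metric :: "nat \<Rightarrow> complex mat \<Rightarrow> complex mat \<Rightarrow> complex mat \<Rightarrow> real" where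
  "induced_metric n L V W = Re (- kappa n V W)"

(* S is the positive semidefinite square root of T on u(n), with respect to the invariant inner
   product - tr (X Y). (The form - kappa is only semidefinite on u(n): it vanishes on the
   scalar matrices.) *)
definition is_pos_sqrt ::
    "nat \<Rightarrow> (complex mat \<Rightarrow> complex mat) \<Rightarrow> (complex mat \<Rightarrow> complex mat) \<Rightarrow> bool" where
  "is_pos_sqrt n T S \<longleftrightarrow>
     (\<forall>X \<in> lie_u n. S X \<in> lie_u n) \<and>
     (\<forall>X \<in> lie_u n. \<forall>Y \<in> lie_u n. S (X + Y) = S X + S Y) \<and>
     (\<forall>X \<in> lie_u n. \<forall>a::real. S (complex_of_real a \<cdot>\<^sub>m X) = complex_of_real a \<cdot>\<^sub>m S X) \<and>
     (\<forall>X \<in> lie_u n. \<forall>Y \<in> lie_u n. Re (- mat_trace (S X * Y)) = Re (- mat_trace (X * S Y))) \<and>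
     (\<forall>X \<in> lie_u n. 0 \<le> Re (- mat_trace (S X * X))) \<and>
     (\<forall>X \<in> lie_u n. S (S X) = T X)"

(* Only the restriction of pos_sqrt to u(n) is meaningful, and there it is unique. *)
definition pos_sqrt ::
    "nat \<Rightarrow> (complex mat \<Rightarrow> complex mat) \<Rightarrow> complex mat \<Rightarrow> complex mat" where
  "pos_sqrt n T = (SOME S. is_pos_sqrt n T S)"

definition kaehler_metric :: "nat \<Rightarrow> complex mat \<Rightarrow> complex mat \<Rightarrow> complex mat \<Rightarrow> real" where
  "kaehler_metric n L V W = normal_metric n L (pos_sqrt n (\<lambda>X. - ad L (ad L X)) V) W"

(* V is the gradient at L of the function H on the orbit: V is tangent, and for every curve c in
   the orbit through L with velocity W the derivative of H along c is the metric product of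
   V and W. *)
definition is_gradient ::
    "nat \<Rightarrow> (nat \<Rightarrow> real) \<Rightarrow> (complex mat \<Rightarrow> complex mat \<Rightarrow> complex mat \<Rightarrow> real) \<Rightarrow>
     (complex mat \<Rightarrow> real) \<Rightarrow> complex mat \<Rightarrow> complex mat \<Rightarrow> bool" where
  "is_gradient n l metric H L V \<longleftrightarrow> V \<in> tangent_space n L \<and>
     (\<forall>W \<in> tangent_space n L. \<forall>c. c 0 = L \<and> (\<forall>s. c s \<in> adj_orbit n l) \<and> has_mat_derivative n c W 0
        \<longrightarrow> ((\<lambda>s. H (c s)) has_real_derivative metric L V W) (at 0))"

definition is_gradient_flow ::
    "nat \<Rightarrow> (nat \<Rightarrow> real) \<Rightarrow> (complex mat \<Rightarrow> complex mat \<Rightarrow> complex mat \<Rightarrow> real) \<Rightarrow>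
     (complex mat \<Rightarrow> real) \<Rightarrow> (real \<Rightarrow> complex mat) \<Rightarrow> bool" where
  "is_gradient_flow n l metric H L \<longleftrightarrow>
     (\<forall>t. L t \<in> adj_orbit n l \<and>
        (\<exists>V. is_gradient n l metric H (L t) V \<and> has_mat_derivative n L V t))"

(* The orbit is compact, so a solution exists for all times from every initial point; hence
   quantifying over the solutions is the same as quantifying over the initial points. *)
definition gradient_flow_strictly_preserves_positivity ::
    "nat \<Rightarrow> (nat \<Rightarrow> real) \<Rightarrow> (complex mat \<Rightarrow> complex mat \<Rightarrow> complex mat \<Rightarrow> real) \<Rightarrow>
     (complex mat \<Rightarrow> real) \<Rightarrow> bool" where
  "gradient_flow_strictly_preserves_positivity n l metric H \<longleftrightarrow>
     (\<forall>L. is_gradient_flow n l metric H L \<and> L 0 \<in> orbit_nonneg n l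
        \<longrightarrow> (\<forall>t>0. L t \<in> orbit_pos n l))"

definition omega :: "nat \<Rightarrow> nat \<Rightarrow> real" where
  "omega k i = (if i < k then 1 else 0)"

(* The n entries iN(1,2), ..., iN(n-1,n), (-1)^(k-1) iN(n,1), as real numbers; they are used only
   when iN is real. *)
definition cyclic_entry :: "nat \<Rightarrow> nat \<Rightarrow> complex mat \<Rightarrow> nat \<Rightarrow> real" where
  "cyclic_entry n k N j =
     (if j < n - 1 then Re (\<i> * N $$ (j, j + 1)) else (-1) ^ (k - 1) * Re (\<i> * N $$ (n - 1, 0)))"

end

theory Submission
  imports Defs
begin

text \<open>On the orbit of \<open>\<omega>\<^sub>k\<close> write \<open>L = \<i>P\<close> with \<open>P\<close> a projection of rank \<open>k\<close>. There \<open>ad\<^sub>L\<^sup>2 = -1\<close> on tangent vectors, so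
  all three metrics are equal to \<open>-2n tr(VW)\<close>, and the gradient flow moves the range of \<open>P\<close> by \<open>exp(tB)\<close>
  with \<open>B = \<i>N/2n\<close>. Under \<open>Y' = BY\<close> the Pluecker coordinates satisfy a linear system whose off-diagonal
  coefficients are the entries of \<open>B\<close> up to sign. If these coefficients are nonnegative, the system
  preserves nonnegativity, and positivity spreads along nonzero coefficients: \<open>n - 1\<close> positive cyclic
  entries connect all \<open>k\<close>-subsets. Conversely, the derivative at a coordinate subspace shows that every
  coefficient is nonnegative; for rows that are not cyclically adjacent both signs occur, so the entry
  is zero, and two vanishing cyclic entries would cut the cycle into two arcs with conserved dimensions.

  Positivity in the orbit asks for a complete positive flag, so a subspace with positive Pluecker coordinates
  has to be extended to one; this is done with the totally positive semigroup of a path.\<close>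

section \<open>Linear differential systems with nonnegative off-diagonal coefficients\<close>

text \<open>A subspace determines its Pluecker coordinates only up to a common nonzero complex
  factor. This obstacle shapes most statements: they carry a multiplier \<open>c\<close>, speak of
  the products of p_I with the conjugate of p_J, or say that all coordinates are positive multiples
  of one number. Those products are minors of the projection itself, so unlike frames they survive
  limits in the orbit.

  Replacing row x of I by row y costs the sign (-1)^m, where m counts the elements of I strictly
  between x and y. For neighbours m = 0; for the pair {1, n} all other k - 1 elements lie between,
  which produces the sign in front of iN(n,1).

  Strict preservation of positivity quantifies over solutions, so it would be vacuous without any.
  Necessity therefore has to exhibit solutions that start at coordinate subspaces; they are written
  down in closed form. Sufficiency has to identify every solution, which rests on uniqueness for a
  linear equation with bounded coefficients. The factor 1/2n in B is the inverse of the scale of the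
  metric.\<close>

lemma gronwall_zero:
  fixes f :: "real \<Rightarrow> real"
  assumes d: "\<And>t. 0 \<le> t \<Longrightarrow> (f has_real_derivative f' t) (at t)"
    and le: "\<And>t. 0 \<le> t \<Longrightarrow> f' t \<le> C * f t"
    and nonneg: "\<And>t. 0 \<le> f t" and "f 0 = 0" and "0 \<le> t"
  shows "f t = 0"
proof -
  let ?g = "\<lambda>s. exp (- C * s) * f s"
  have "?g t \<le> ?g 0"
  proof (rule DERIV_nonpos_imp_nonincreasing[OF \<open>0 \<le> t\<close>])
    fix s assume s: "0 \<le> s" "s \<le> t"
    have "(?g has_real_derivative exp (- C * s) * (f' s - C * f s)) (at s)"
      by (auto intro!: derivative_eq_intros d[OF s(1)] simp: algebra_simps)
    moreover have "exp (- C * s) * (f' s - C * f s) \<le> 0"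
      using le[OF s(1)] by (intro mult_nonneg_nonpos) auto
    ultimately show "\<exists>y. (?g has_real_derivative y) (at s) \<and> y \<le> 0" by blast
  qed
  then have "exp (- C * t) * f t \<le> 0" using \<open>f 0 = 0\<close> by simp
  then show ?thesis using nonneg[of t] by (simp add: mult_le_0_iff)
qed

text \<open>The square smooths the kink of the negative part at zero, so that the defect of
  nonnegativity can be fed into \<open>gronwall_zero\<close>.\<close>

lemma has_derivative_min_zero_square:
  fixes f :: "real \<Rightarrow> real"
  assumes "(f has_real_derivative d) (at t)"
  shows "((\<lambda>s. (min (f s) 0)\<^sup>2) has_real_derivative 2 * min (f t) 0 * d) (at t)"
proof -
  have "((\<lambda>y::real. (min y 0)\<^sup>2) has_real_derivative 2 * min x 0) (at x)" for x
  proof -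
    consider "x < 0" | "x > 0" | "x = 0" by linarith
    then show ?thesis
    proof cases
      case 1
      have "((\<lambda>y::real. y\<^sup>2) has_real_derivative 2 * min x 0) (at x)"
        using 1 by (auto intro!: derivative_eq_intros)
      moreover have "\<forall>\<^sub>F y in nhds x. y \<in> {..<0}"
        using 1 by (intro eventually_nhds_in_open) auto
      then have "\<forall>\<^sub>F y in nhds x. y\<^sup>2 = (min y 0)\<^sup>2"
        by (rule eventually_mono) (simp add: min_def)
      ultimately show ?thesis by (rule iffD1[OF DERIV_cong_ev[OF refl _ refl], rotated])
    next
      case 2
      have "((\<lambda>y::real. 0::real) has_real_derivative 2 * min x 0) (at x)"
        using 2 by simp
      moreover have "\<forall>\<^sub>F y in nhds x. y \<in> {0<..}"
        using 2 by (intro eventually_nhds_in_open) auto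
      then have "\<forall>\<^sub>F y in nhds x. 0 = (min y 0)\<^sup>2"
        by (rule eventually_mono) (simp add: min_def)
      ultimately show ?thesis by (rule iffD1[OF DERIV_cong_ev[OF refl _ refl], rotated])
    next
      case 3
      \<comment> \<open>At the kink the difference quotient is \<open>min h 0\<close> itself.
        Division by zero gives 0, so the equation also covers h = 0.\<close>
      have "(min h 0)\<^sup>2 / h = min h 0" for h :: real
        by (simp add: min_def power2_eq_square)
      moreover have "((\<lambda>h::real. min h 0) \<longlongrightarrow> 0) (at 0)"
        by (rule tendsto_eq_intros | simp)+
      ultimately show ?thesis using 3 by (simp add: DERIV_def)
    qed
  qed
  from DERIV_chain2[OF this assms] show ?thesis by simp
qed

text \<open>The squared negative part \<open>\<Sum>x\<in>S. (min (q x) 0)\<^sup>2\<close> satisfies a Gronwall inequality,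
  because the off-diagonal coefficients \<open>w\<close> are nonnegative.\<close>
lemma metzler_nonneg:
  fixes q :: "'a \<Rightarrow> real \<Rightarrow> real" and T :: "'a \<Rightarrow> 'e set"
  assumes "finite S"
    and d: "\<And>x t. x \<in> S \<Longrightarrow> 0 \<le> t \<Longrightarrow>
      (q x has_real_derivative c x * q x t + (\<Sum>e\<in>T x. w x e * q (nb x e) t)) (at t)"
    and w: "\<And>x e. x \<in> S \<Longrightarrow> e \<in> T x \<Longrightarrow> 0 \<le> w x e"
    and nb: "\<And>x e. x \<in> S \<Longrightarrow> e \<in> T x \<Longrightarrow> w x e \<noteq> 0 \<Longrightarrow> nb x e \<in> S"
    and q0: "\<And>x. x \<in> S \<Longrightarrow> 0 \<le> q x 0"
    and "x \<in> S" and "0 \<le> t"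
  shows "0 \<le> q x t"
proof -
  define m where "m x t = min (q x t) 0" for x t
  define \<phi> where "\<phi> t = (\<Sum>x\<in>S. (m x t)\<^sup>2)" for t
  define D where "D x t = c x * q x t + (\<Sum>e\<in>T x. w x e * q (nb x e) t)" for x t
  define C where "C = (\<Sum>x\<in>S. 2 * (\<bar>c x\<bar> + (\<Sum>e\<in>T x. w x e)))"
  have m2: "(m x t)\<^sup>2 \<le> \<phi> t" if "x \<in> S" for x t
    unfolding \<phi>_def by (rule member_le_sum[OF that]) (auto simp: \<open>finite S\<close>)
  have mm: "m x t * m y t \<le> \<phi> t" if "x \<in> S" "y \<in> S" for x y t
    using m2[OF that(1), of t] m2[OF that(2), of t] sum_squares_bound[of "m x t" "m y t"] by linarith
  have "\<phi> t = 0"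
  proof (rule gronwall_zero[OF _ _ _ _ \<open>0 \<le> t\<close>])
    fix t :: real assume t: "0 \<le> t"
    show "(\<phi> has_real_derivative (\<Sum>x\<in>S. 2 * m x t * D x t)) (at t)"
      unfolding \<phi>_def m_def D_def
      by (intro DERIV_sum has_derivative_min_zero_square d t)
    have "2 * m x t * D x t \<le> 2 * (\<bar>c x\<bar> + (\<Sum>e\<in>T x. w x e)) * \<phi> t" if x: "x \<in> S" for x
    proof -
      have "m x t * (c x * q x t) = c x * (m x t)\<^sup>2"
        by (auto simp: m_def min_def power2_eq_square)
      also have "\<dots> \<le> \<bar>c x\<bar> * \<phi> t"
        using m2[OF x] by (intro mult_mono) auto
      finally have 1: "m x t * (c x * q x t) \<le> \<bar>c x\<bar> * \<phi> t" .
      have "m x t * (w x e * q (nb x e) t) \<le> w x e * \<phi> t" if e: "e \<in> T x" for e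
      proof (cases "w x e = 0")
        case False
        \<comment> \<open>Since \<open>m x t\<close> is nonpositive, replacing the neighbour's value
          by its negative part can only increase the product. A neighbour of weight 0 may lie
          outside \<open>S\<close>, hence the case split.\<close>
        have "m x t * q (nb x e) t \<le> m x t * m (nb x e) t"
          by (rule mult_left_mono_neg) (auto simp: m_def)
        also have "\<dots> \<le> \<phi> t" by (rule mm[OF x nb[OF x e False]])
        finally have "w x e * (m x t * q (nb x e) t) \<le> w x e * \<phi> t"
          by (rule mult_left_mono) (rule w[OF x e])
        then show ?thesis by (simp add: mult.left_commute)
      qed simp
      then have "m x t * (\<Sum>e\<in>T x. w x e * q (nb x e) t) \<le> (\<Sum>e\<in>T x. w x e) * \<phi> t"
        unfolding sum_distrib_left sum_distrib_right by (rule sum_mono)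
      with 1 have "m x t * D x t \<le> \<bar>c x\<bar> * \<phi> t + (\<Sum>e\<in>T x. w x e) * \<phi> t"
        unfolding D_def by (simp add: distrib_left)
      then show ?thesis by (simp add: algebra_simps)
    qed
    then show "(\<Sum>x\<in>S. 2 * m x t * D x t) \<le> C * \<phi> t"
      unfolding C_def sum_distrib_right by (rule sum_mono)
  next
    show "0 \<le> \<phi> t" for t unfolding \<phi>_def by (simp add: sum_nonneg)
    have "m x 0 = 0" if "x \<in> S" for x using q0[OF that] by (simp add: m_def)
    then show "\<phi> 0 = 0" by (simp add: \<phi>_def)
  qed
  then have "(m x t)\<^sup>2 \<le> 0" using m2[OF \<open>x \<in> S\<close>, of t] by simp
  then show ?thesis by (simp add: m_def min_def split: if_splits)
qed

text \<open>The integrating factor \<open>exp (- c * t)\<close> removes the diagonal term, and what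
  remains of the derivative is a sum of nonnegative terms. A coordinate that is once positive
  therefore stays positive.\<close>

lemma metzler_persists:
  fixes f :: "real \<Rightarrow> real" and q :: "'e \<Rightarrow> real \<Rightarrow> real"
  assumes d: "\<And>t. 0 \<le> t \<Longrightarrow>
      (f has_real_derivative c * f t + (\<Sum>e\<in>T. w e * q e t)) (at t)"
    and w: "\<And>e. e \<in> T \<Longrightarrow> 0 \<le> w e"
    and q: "\<And>e t. e \<in> T \<Longrightarrow> 0 \<le> t \<Longrightarrow> w e \<noteq> 0 \<Longrightarrow> 0 \<le> q e t"
    and "0 \<le> s" "s \<le> t"
  shows "exp (- c * s) * f s \<le> exp (- c * t) * f t"
proof (rule DERIV_nonneg_imp_nondecreasing[OF \<open>s \<le> t\<close>, where f = "\<lambda>u. exp (- c * u) * f u"])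
  fix u assume "s \<le> u" "u \<le> t"
  then have u: "0 \<le> u" using \<open>0 \<le> s\<close> by simp
  let ?D = "exp (- c * u) * (\<Sum>e\<in>T. w e * q e u)"
  have "((\<lambda>u. exp (- c * u) * f u) has_real_derivative ?D) (at u)"
    by (auto intro!: derivative_eq_intros d u simp: algebra_simps)
  moreover have "0 \<le> w e * q e u" if "e \<in> T" for e
    using w[OF that] q[OF that u] by (cases "w e = 0") auto
  then have "0 \<le> ?D" by (simp add: sum_nonneg)
  ultimately show "\<exists>y. ((\<lambda>u. exp (- c * u) * f u) has_real_derivative y) (at u) \<and> 0 \<le> y" by blast
qed

text \<open>One positive neighbour makes the rescaled function strictly increasing. That neighbour
  is only known to be positive at positive times, so weak monotonicity carries the estimate up to
  t/2 and strict monotonicity from there to t.\<close>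

lemma metzler_spreads:
  fixes f :: "real \<Rightarrow> real" and q :: "'e \<Rightarrow> real \<Rightarrow> real"
  assumes d: "\<And>t. 0 \<le> t \<Longrightarrow>
      (f has_real_derivative c * f t + (\<Sum>e\<in>T. w e * q e t)) (at t)"
    and "finite (T)"
    and w: "\<And>e. e \<in> T \<Longrightarrow> 0 \<le> w e"
    and q: "\<And>e t. e \<in> T \<Longrightarrow> 0 \<le> t \<Longrightarrow> w e \<noteq> 0 \<Longrightarrow> 0 \<le> q e t"
    and q0: "0 \<le> f 0"
    and e: "e \<in> T" "w e > 0" "\<And>t. 0 < t \<Longrightarrow> 0 < q e t"
    and "0 < t"
  shows "0 < f t"
proof -
  let ?g = "\<lambda>u. exp (- c * u) * f u"
  have "?g 0 \<le> ?g (t/2)"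
  proof (rule metzler_persists[where f = f and c = c and T = T and w = w and q = q])
    show "(f has_real_derivative c * f u + (\<Sum>e\<in>T. w e * q e u)) (at u)" if "0 \<le> u" for u
      by (rule d[OF that])
  qed (use w q \<open>0 < t\<close> in auto)
  then have "0 \<le> ?g (t/2)" using q0 by simp
  also have "?g (t/2) < ?g t"
  proof (rule DERIV_pos_imp_increasing[where f = ?g])
    show "t/2 < t" using \<open>0 < t\<close> by simp
    fix u assume "t/2 \<le> u" "u \<le> t"
    then have u: "0 < u" using \<open>0 < t\<close> by simp
    let ?D = "exp (- c * u) * (\<Sum>e\<in>T. w e * q e u)"
    have "(?g has_real_derivative ?D) (at u)"
      using u by (auto intro!: derivative_eq_intros d simp: algebra_simps)
    moreover have "0 \<le> w e * q e u" if "e \<in> T" for e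
      using w[OF that] q[OF that, of u] u by (cases "w e = 0") auto
    then have "0 < (\<Sum>e\<in>T. w e * q e u)"
      using e u by (intro sum_pos2[OF \<open>finite (T)\<close> e(1)]) auto
    then have "0 < ?D" by simp
    ultimately show "\<exists>y. (?g has_real_derivative y) (at u) \<and> 0 < y" by blast
  qed
  finally show ?thesis by (simp add: zero_less_mult_iff)
qed

section \<open>Exchanges of elements between k-subsets\<close>

definition ksets :: "nat \<Rightarrow> nat \<Rightarrow> nat set set" where
  "ksets n k = {I. I \<subseteq> {..<n} \<and> card I = k}"

lemma finite_ksets [simp]: "finite (ksets n k)"
  unfolding ksets_def by (rule finite_subset[of _ "Pow {..<n}"]) auto

lemma ksets_exchange:
  assumes "I \<in> ksets n k" "x \<in> I" "y < n" "y \<notin> I"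
  shows "insert y (I - {x}) \<in> ksets n k"
proof -
  have "finite I" using assms finite_subset unfolding ksets_def by blast
  then have "card (insert y (I - {x})) = card I"
    using assms card_Suc_Diff1[of I x] by simp
  then show ?thesis using assms unfolding ksets_def by auto
qed

lemma down_closed_eq_lessThan:
  assumes "finite J" and down: "\<And>x. Suc x \<in> J \<Longrightarrow> x \<in> J"
  shows "J = {..<card J}"
proof -
  have le: "y \<in> J" if "x \<in> J" "y \<le> x" for x y
    using that(2,1) by (induction rule: inc_induct) (auto intro: down)
  have "J \<subseteq> {..<card J}"
  proof
    fix x assume "x \<in> J"
    then have "{..x} \<subseteq> J" using le by auto
    then have "card {..x} \<le> card J" by (rule card_mono[OF \<open>finite J\<close>])
    then show "x \<in> {..<card J}" by simp
  qed
  then show ?thesis by (rule card_subset_eq[rotated]) auto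
qed

lemma ksets_shift_down:
  assumes J: "J \<in> ksets n k" and "J \<noteq> {..<k}"
  obtains x where "Suc x \<in> J" "x \<notin> J" "Suc x < n" "insert x (J - {Suc x}) \<in> ksets n k"
    "\<Sum>(insert x (J - {Suc x})) < \<Sum>J"
proof -
  have fin: "finite J" using J finite_subset unfolding ksets_def by blast
  obtain x where x: "Suc x \<in> J" "x \<notin> J"
    using down_closed_eq_lessThan[OF fin] assms unfolding ksets_def by auto
  have "Suc x < n" using J x unfolding ksets_def by auto
  moreover have "\<Sum>J = Suc x + \<Sum>(J - {Suc x})" using fin x by (simp add: sum.remove)
  then have "\<Sum>(insert x (J - {Suc x})) < \<Sum>J" using fin x by simp
  ultimately show thesis using x ksets_exchange[OF J x(1) _ x(2)] by (intro that[of x]) auto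
qed

text \<open>Sliding one element down at a time lowers the sum of the elements and can only stop at
  \<open>{..<k}\<close>. Downward slides thus put \<open>{..<k}\<close> into \<open>F\<close>, and
  upward slides, retracing a descent, give every other set.\<close>

lemma ksets_path_connected_standard:
  assumes F: "F \<subseteq> ksets n k" "F \<noteq> {}"
    and up: "\<And>J x. J \<in> F \<Longrightarrow> x \<in> J \<Longrightarrow> Suc x \<notin> J \<Longrightarrow> Suc x < n \<Longrightarrow> insert (Suc x) (J - {x}) \<in> F"
    and down: "\<And>J x. J \<in> F \<Longrightarrow> Suc x \<in> J \<Longrightarrow> x \<notin> J \<Longrightarrow> Suc x < n \<Longrightarrow> insert x (J - {Suc x}) \<in> F"
  shows "F = ksets n k"
proof -
  have "{..<k} \<in> F" if "J \<in> F" for J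
    using that
  proof (induction "\<Sum>J" arbitrary: J rule: less_induct)
    case less
    show ?case
    proof (cases "J = {..<k}")
      case False
      moreover have "J \<in> ksets n k" using less F by auto
      ultimately obtain x where "Suc x \<in> J" "x \<notin> J" "Suc x < n" "\<Sum>(insert x (J - {Suc x})) < \<Sum>J"
        using ksets_shift_down by metis
      then show ?thesis using less down by blast
    qed (use less in auto)
  qed
  with F have base: "{..<k} \<in> F" by auto
  have "J \<in> F" if "J \<in> ksets n k" for J
    using that
  proof (induction "\<Sum>J" arbitrary: J rule: less_induct)
    case less
    show ?case
    proof (cases "J = {..<k}")
      case False
      with less.prems obtain x where x: "Suc x \<in> J" "x \<notin> J" "Suc x < n"
          "insert x (J - {Suc x}) \<in> ksets n k" "\<Sum>(insert x (J - {Suc x})) < \<Sum>J"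
        using ksets_shift_down by metis
      then have "insert (Suc x) (insert x (J - {Suc x}) - {x}) \<in> F"
        using less.hyps by (intro up) auto
      moreover have "insert (Suc x) (insert x (J - {Suc x}) - {x}) = J" using x by auto
      ultimately show ?thesis by simp
    qed (use base in auto)
  qed
  with F show ?thesis by blast
qed

text \<open>Transports the previous lemma along a numbering \<sigma> of the vertices. For a cycle
  with one edge removed, \<sigma> is a rotation. The unordered pair in \<open>move\<close> covers
  both directions of an edge.\<close>

lemma ksets_path_connected:
  assumes \<sigma>: "bij_betw \<sigma> {..<n} {..<n}"
    and F: "F \<subseteq> ksets n k" "F \<noteq> {}"
    and move: "\<And>J p a b. J \<in> F \<Longrightarrow> Suc p < n \<Longrightarrow> {a, b} = {\<sigma> p, \<sigma> (Suc p)} \<Longrightarrow>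
        a \<in> J \<Longrightarrow> b \<notin> J \<Longrightarrow> insert b (J - {a}) \<in> F"
  shows "F = ksets n k"
proof -
  have inj: "inj_on \<sigma> {..<n}" and im: "\<sigma> ` {..<n} = {..<n}" using \<sigma> by (auto simp: bij_betw_def)
  define F' where "F' = {J. J \<subseteq> {..<n} \<and> \<sigma> ` J \<in> F}"
  have card: "card (\<sigma> ` J) = card J" if "J \<subseteq> {..<n}" for J
    by (rule card_image) (rule inj_on_subset[OF inj that])
  have pre: "\<exists>J'. J' \<subseteq> {..<n} \<and> J = \<sigma> ` J'" if "J \<in> ksets n k" for J
    using that im unfolding ksets_def by (metis mem_Collect_eq subset_image_iff)
  have mem: "\<sigma> x \<in> \<sigma> ` J \<longleftrightarrow> x \<in> J" if "J \<subseteq> {..<n}" "x < n" for J x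
    using inj_on_image_mem_iff[OF inj _ that(1)] that(2) by simp
  have exch: "\<sigma> ` insert b (J - {a}) = insert (\<sigma> b) (\<sigma> ` J - {\<sigma> a})"
    if "J \<subseteq> {..<n}" "a < n" for J a b
    using inj_on_image_set_diff[OF inj, of J "{a}"] that by auto
  have "F' = ksets n k"
  proof (rule ksets_path_connected_standard)
    show "F' \<subseteq> ksets n k" proof
      fix J assume "J \<in> F'"
      then have "J \<subseteq> {..<n}" "\<sigma> ` J \<in> ksets n k" using F by (auto simp: F'_def)
      then show "J \<in> ksets n k" using card unfolding ksets_def by simp
    qed
    obtain J where "J \<in> F" using F by auto
    moreover have "J \<in> ksets n k" using F \<open>J \<in> F\<close> by auto
    ultimately obtain J' where "J' \<subseteq> {..<n}" "J = \<sigma> ` J'" using pre by blast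
    with \<open>J \<in> F\<close> show "F' \<noteq> {}" unfolding F'_def by auto
    fix J x assume J: "J \<in> F'"
    then have sub: "J \<subseteq> {..<n}" and JF: "\<sigma> ` J \<in> F" by (auto simp: F'_def)
    { assume x: "x \<in> J" "Suc x \<notin> J" "Suc x < n"
      have "insert (\<sigma> (Suc x)) (\<sigma> ` J - {\<sigma> x}) \<in> F"
        using x mem[OF sub] by (intro move[OF JF x(3)]) auto
      then show "insert (Suc x) (J - {x}) \<in> F'"
        using sub x unfolding F'_def by (simp add: exch[symmetric] subset_iff) }
    { assume x: "Suc x \<in> J" "x \<notin> J" "Suc x < n"
      have "insert (\<sigma> x) (\<sigma> ` J - {\<sigma> (Suc x)}) \<in> F"
        using x mem[OF sub] by (intro move[OF JF x(3)]) auto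
      then show "insert x (J - {Suc x}) \<in> F'"
        using sub x unfolding F'_def by (auto simp: exch[symmetric]) }
  qed
  moreover have "J \<in> F" if J: "J \<in> ksets n k" "F' = ksets n k" for J
  proof -
    obtain J' where J': "J' \<subseteq> {..<n}" "J = \<sigma> ` J'" using pre[OF J(1)] by blast
    then have "J' \<in> F'" using J card unfolding ksets_def by auto
    with J' show ?thesis by (simp add: F'_def)
  qed
  ultimately show ?thesis using F by blast
qed

section \<open>Minors and their derivative under a linear flow\<close>

text \<open>Rows form a list because differentiation replaces one row in place, which may leave the
  list unsorted or with a repetition. Only columns 0, ..., k - 1 of \<open>Y\<close> enter, so one
  \<open>Y\<close> can serve as the frame of a whole flag.\<close>

definition minor :: "nat \<Rightarrow> (nat \<Rightarrow> nat \<Rightarrow> complex) \<Rightarrow> nat list \<Rightarrow> complex" where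
  "minor k Y xs = det (mat k k (\<lambda>(a, b). Y (xs ! a) b))"

definition pluecker :: "nat \<Rightarrow> (nat \<Rightarrow> nat \<Rightarrow> complex) \<Rightarrow> nat set \<Rightarrow> complex" where
  "pluecker k Y I = minor k Y (sorted_list_of_set I)"

text \<open>Up to parity, the number of transpositions that sort the rows \<open>I\<close> after \<open>x\<close> has been replaced by \<open>y\<close>.\<close>
definition exchange_inv :: "nat set \<Rightarrow> nat \<Rightarrow> nat \<Rightarrow> nat" where
  "exchange_inv I x y = card {s \<in> I - {x}. s < x} + card {s \<in> I - {x}. s < y}"

lemma minor_leibniz:
  "minor k Y xs = (\<Sum>p | p permutes {0..<k}. signof p * (\<Prod>a\<in>{0..<k}. Y (xs ! a) (p a)))"
proof -
  have "minor k Y xs = (\<Sum>p | p permutes {0..<k}. signof p *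
      (\<Prod>a\<in>{0..<k}. mat k k (\<lambda>(a, b). Y (xs ! a) b) $$ (a, p a)))"
    unfolding minor_def by (rule det_def') simp
  also have "\<dots> = (\<Sum>p | p permutes {0..<k}. signof p * (\<Prod>a\<in>{0..<k}. Y (xs ! a) (p a)))"
    using permutes_in_image
    by (intro sum.cong refl arg_cong2[where f = times] prod.cong) fastforce+
  finally show ?thesis .
qed

lemma minor_cong:
  assumes "\<And>a b. a < k \<Longrightarrow> b < k \<Longrightarrow> Y (xs ! a) b = Z (ys ! a) b"
  shows "minor k Y xs = minor k Z ys"
  unfolding minor_def using assms by (intro arg_cong[of _ _ det] cong_mat) auto

lemma pluecker_cong:
  assumes "I \<in> ksets n k" "\<And>i b. i < n \<Longrightarrow> b < k \<Longrightarrow> Y i b = Z i b"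
  shows "pluecker k Y I = pluecker k Z I"
proof -
  have "finite I" "card I = k" "I \<subseteq> {..<n}"
    using assms(1) finite_subset unfolding ksets_def by auto
  then have "sorted_list_of_set I ! a < n" if "a < k" for a
    using that nth_mem[of a "sorted_list_of_set I"] by auto
  then show ?thesis unfolding pluecker_def using assms by (intro minor_cong) auto
qed

lemma minor_swap:
  assumes "k = length us + length vs + 2"
  shows "minor k Y (us @ x # y # vs) = - minor k Y (us @ y # x # vs)"
proof -
  let ?A = "mat k k (\<lambda>(a, b). Y ((us @ y # x # vs) ! a) b)"
  have "swaprows (length us) (Suc (length us)) ?A = mat k k (\<lambda>(a, b). Y ((us @ x # y # vs) ! a) b)"
    using assms by (intro eq_matI) (auto simp: nth_append nth_Cons' split: if_splits)
  moreover have "det (swaprows (length us) (Suc (length us)) ?A) = - det ?A"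
    using assms by (intro det_swaprows[of _ k]) auto
  ultimately show ?thesis unfolding minor_def by simp
qed

lemma minor_move:
  assumes "k = length us + length vs + length ws + 1"
  shows "minor k Y (us @ vs @ x # ws) = (-1) ^ length vs * minor k Y (us @ x # vs @ ws)"
  using assms
proof (induction vs arbitrary: us)
  case (Cons v vs)
  have "minor k Y (us @ (v # vs) @ x # ws) = (-1) ^ length vs * minor k Y (us @ v # x # vs @ ws)"
    using Cons.IH[of "us @ [v]"] Cons.prems by simp
  then show ?case using minor_swap[of k us "vs @ ws" Y v x] Cons.prems by simp
qed simp

lemma minor_identical:
  assumes "i < k" "j < k" "i \<noteq> j" "xs ! i = xs ! j"
  shows "minor k Y xs = 0"
  unfolding minor_def
  by (rule det_identical_rows[of _ k i j]) (use assms in \<open>auto simp: row_def\<close>)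

text \<open>Turns a position in the sorted row list into the count of smaller elements that occurs
  in \<open>exchange_inv\<close>.\<close>

lemma sorted_list_of_set_split:
  assumes "finite (I :: nat set)" "sorted_list_of_set I = us @ x # vs"
  shows "sorted_list_of_set (I - {x}) = us @ vs" "length us = card {s \<in> I - {x}. s < x}"
    "x \<in> I"
proof -
  have I: "set (us @ x # vs) = I" using assms by (metis set_sorted_list_of_set)
  have "sorted_wrt (<) (us @ x # vs)"
    using strict_sorted_list_of_set[of I] assms(2) by simp
  then have s: "sorted_wrt (<) (us @ vs)" and lt: "\<forall>u\<in>set us. u < x" and gt: "\<forall>v\<in>set vs. x < v"
    by (auto simp: sorted_wrt_append)
  have set: "set (us @ vs) = I - {x}" using I lt gt by auto
  with s show "sorted_list_of_set (I - {x}) = us @ vs"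
    by (metis sorted_list_of_set.idem_if_sorted_distinct strict_sorted_iff)
  have "set us = {s \<in> I - {x}. s < x}" using set lt gt by fastforce
  moreover have "distinct us" using s by (auto simp: strict_sorted_iff)
  ultimately show "length us = card {s \<in> I - {x}. s < x}" by (metis distinct_card)
  show "x \<in> I" using I by auto
qed

lemma minor_insert:
  assumes "finite S" "x \<notin> S" "k = Suc (card S)"
  shows "minor k Y (x # sorted_list_of_set S) =
    (-1) ^ card {s \<in> S. s < x} * pluecker k Y (insert x S)"
proof -
  have "x \<in> set (sorted_list_of_set (insert x S))" using assms
    by (simp del: sorted_list_of_set_insert_remove sorted_list_of_set.sorted_key_list_of_set_insert)
  then obtain us vs where e: "sorted_list_of_set (insert x S) = us @ x # vs"
    by (meson split_list)
  note sp = sorted_list_of_set_split[OF _ e]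
  have S: "insert x S - {x} = S" using assms by auto
  have 1: "sorted_list_of_set S = us @ vs" and 2: "length us = card {s \<in> S. s < x}"
    using sp assms(1) by (auto simp: S)
  have "length us + length vs = card S" using arg_cong[OF 1, of length] by simp
  then have "pluecker k Y (insert x S) = (-1) ^ length us * minor k Y (x # us @ vs)"
    using minor_move[of k "[]" us vs Y x] assms e by (simp add: pluecker_def)
  then show ?thesis by (simp add: 1 2 mult.assoc[symmetric] power_mult_distrib[symmetric])
qed

lemma has_vector_derivative_prod:
  fixes f :: "'i \<Rightarrow> real \<Rightarrow> 'b :: real_normed_field"
  assumes "\<And>i. i \<in> A \<Longrightarrow> (f i has_vector_derivative f' i) (at t)"
  shows "((\<lambda>s. \<Prod>i\<in>A. f i s) has_vector_derivative (\<Sum>i\<in>A. f' i * (\<Prod>j\<in>A - {i}. f j t))) (at t)"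
proof -
  have "((\<lambda>s. \<Prod>i\<in>A. f i s) has_derivative
      (\<lambda>h. \<Sum>i\<in>A. (h *\<^sub>R f' i) * (\<Prod>j\<in>A - {i}. f j t))) (at t)"
    using assms by (intro has_derivative_prod) (simp add: has_vector_derivative_def)
  then show ?thesis by (simp add: has_vector_derivative_def scaleR_sum_right)
qed

text \<open>Product rule in the Leibniz formula: each row is differentiated in turn and becomes a
  combination of rows of \<open>Y t\<close>, which multilinearity splits.\<close>

lemma minor_has_vector_derivative:
  assumes d: "\<And>i b. i < n \<Longrightarrow> b < k \<Longrightarrow>
      ((\<lambda>s. Y s i b) has_vector_derivative (\<Sum>j<n. B i j * Y t j b)) (at t)"
    and len: "length xs = k" and "set xs \<subseteq> {..<n}"
  shows "((\<lambda>s. minor k (Y s) xs) has_vector_derivative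
    (\<Sum>a<k. \<Sum>j<n. B (xs ! a) j * minor k (Y t) (xs[a := j]))) (at t)"
proof -
  let ?P = "{p. p permutes {0..<k}}"
  have xs: "xs ! a < n" if "a < k" for a using that nth_mem[of a xs] len \<open>set xs \<subseteq> {..<n}\<close> by blast
  have "((\<lambda>s. minor k (Y s) xs) has_vector_derivative
    (\<Sum>p\<in>?P. signof p * (\<Sum>a\<in>{0..<k}. (\<Sum>j<n. B (xs ! a) j * Y t j (p a)) *
       (\<Prod>c\<in>{0..<k} - {a}. Y t (xs ! c) (p c))))) (at t)"
    unfolding minor_leibniz
  proof (intro has_vector_derivative_sum has_vector_derivative_mult_right has_vector_derivative_prod d)
    fix p a assume "p \<in> ?P" "a \<in> {0..<k}"
    then show "p a < k" "xs ! a < n" using permutes_in_image xs by fastforce+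
  qed
  moreover have "(\<Sum>p\<in>?P. signof p * (\<Sum>a\<in>{0..<k}. (\<Sum>j<n. B (xs ! a) j * Y t j (p a)) *
       (\<Prod>c\<in>{0..<k} - {a}. Y t (xs ! c) (p c)))) =
     (\<Sum>a<k. \<Sum>j<n. B (xs ! a) j * minor k (Y t) (xs[a := j]))"
  proof -
    have e: "(\<Prod>c\<in>{0..<k}. Y t (xs[a := j] ! c) (p c)) =
       Y t j (p a) * (\<Prod>c\<in>{0..<k} - {a}. Y t (xs ! c) (p c))" if "a < k" for a j and p :: "nat \<Rightarrow> nat"
      using that len by (subst prod.remove[of _ a]) (auto intro!: prod.cong)
    have "B (xs ! a) j * minor k (Y t) (xs[a := j]) = (\<Sum>p\<in>?P. signof p *
       (B (xs ! a) j * Y t j (p a) * (\<Prod>c\<in>{0..<k} - {a}. Y t (xs ! c) (p c))))" if "a < k" for a j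
      unfolding minor_leibniz sum_distrib_left
      by (intro sum.cong refl) (subst e[OF that], simp add: mult_ac)
    then have "(\<Sum>a<k. \<Sum>j<n. B (xs ! a) j * minor k (Y t) (xs[a := j])) =
      (\<Sum>a<k. \<Sum>j<n. \<Sum>p\<in>?P. signof p *
       (B (xs ! a) j * Y t j (p a) * (\<Prod>c\<in>{0..<k} - {a}. Y t (xs ! c) (p c))))"
      by (intro sum.cong) auto
    also have "\<dots> = (\<Sum>a<k. \<Sum>p\<in>?P. \<Sum>j<n. signof p *
       (B (xs ! a) j * Y t j (p a) * (\<Prod>c\<in>{0..<k} - {a}. Y t (xs ! c) (p c))))"
      by (intro sum.cong refl sum.swap)
    also have "\<dots> = (\<Sum>p\<in>?P. \<Sum>a<k. \<Sum>j<n. signof p *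
       (B (xs ! a) j * Y t j (p a) * (\<Prod>c\<in>{0..<k} - {a}. Y t (xs ! c) (p c))))"
      by (rule sum.swap)
    finally show ?thesis
      by (simp add: sum_distrib_left sum_distrib_right atLeast0LessThan)
  qed
  ultimately show ?thesis by simp
qed

text \<open>The new row is moved to the front past the elements below the old row, then to its own
  place past the elements below itself. The two distances add up to
  \<open>exchange_inv\<close>.\<close>

lemma minor_exchange:
  assumes I: "I \<in> ksets n k" and a: "a < k" and j: "j \<notin> I"
  defines "xs \<equiv> sorted_list_of_set I"
  shows "minor k Y (xs[a := j]) =
    (-1) ^ exchange_inv I (xs ! a) j * pluecker k Y (insert j (I - {xs ! a}))"
proof -
  have fin: "finite I" and card: "card I = k"
    using I finite_subset unfolding ksets_def by auto
  have xs: "length xs = k" unfolding xs_def using fin card by auto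
  define us vs x where "us = take a xs" and "vs = drop (Suc a) xs" and "x = xs ! a"
  have e: "xs = us @ x # vs" unfolding us_def vs_def x_def using a xs by (simp add: id_take_nth_drop)
  have lvs: "k = length us + length vs + 1" using arg_cong[OF e, of length] xs by simp
  note sp = sorted_list_of_set_split[OF fin e[unfolded xs_def]]
  have "xs[a := j] = us @ j # vs" using a xs by (simp add: us_def vs_def upd_conv_take_nth_drop)
  then have "minor k Y (xs[a := j]) = (-1) ^ length us * minor k Y (j # us @ vs)"
    using minor_move[of k "[]" us vs Y j] lvs by simp
  also have "minor k Y (j # us @ vs) =
      (-1) ^ card {s \<in> I - {x}. s < j} * pluecker k Y (insert j (I - {x}))"
    using j sp fin card minor_insert[of "I - {x}" j k Y] card_Suc_Diff1[OF fin sp(3)] by simp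
  finally show ?thesis using sp by (simp add: x_def[symmetric] exchange_inv_def power_add)
qed

text \<open>The action of \<open>B\<close> on the k-th exterior power, in coordinates. The diagonal
  entries over \<open>I\<close> multiply the coordinate itself; every other term exchanges one
  element.\<close>

lemma pluecker_has_vector_derivative:
  assumes d: "\<And>i b. i < n \<Longrightarrow> b < k \<Longrightarrow>
      ((\<lambda>s. Y s i b) has_vector_derivative (\<Sum>j<n. B i j * Y t j b)) (at t)"
    and I: "I \<in> ksets n k"
  shows "((\<lambda>s. pluecker k (Y s) I) has_vector_derivative
    (\<Sum>x\<in>I. B x x) * pluecker k (Y t) I +
    (\<Sum>(x, y)\<in>I \<times> ({..<n} - I).
       (-1) ^ exchange_inv I x y * B x y * pluecker k (Y t) (insert y (I - {x})))) (at t)"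
proof -
  have fin: "finite I" and sub: "I \<subseteq> {..<n}" and card: "card I = k"
    using I finite_subset unfolding ksets_def by auto
  define xs where "xs = sorted_list_of_set I"
  have xs: "length xs = k" "set xs = I" "distinct xs" unfolding xs_def using fin card by auto
  \<comment> \<open>The three outcomes of replacing row x by row j: nothing changes, a row is
    repeated and the minor vanishes, or a genuine exchange takes place.\<close>
  define h where "h x j = (if j = x then pluecker k (Y t) I else if j \<in> I then 0 else
     (-1) ^ exchange_inv I x j * pluecker k (Y t) (insert j (I - {x})))" for x j
  have h: "minor k (Y t) (xs[a := j]) = h (xs ! a) j" if a: "a < k" for a j
  proof -
    define x where "x = xs ! a"
    consider "j = x" | "j \<noteq> x" "j \<in> I" | "j \<notin> I" by blast
    then show ?thesis
    proof cases
      case 1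
      then show ?thesis by (simp add: h_def x_def[symmetric] pluecker_def xs_def[symmetric])
         (simp add: x_def)
    next
      case 2
      then obtain c where c: "c < k" "xs ! c = j" using xs by (metis in_set_conv_nth)
      then have "c \<noteq> a" using 2 by (auto simp: x_def)
      then have "minor k (Y t) (xs[a := j]) = 0"
        using a c xs by (intro minor_identical[of a k c]) auto
      then show ?thesis using 2 by (simp add: h_def x_def)
    next
      case 3
      then show ?thesis
        using minor_exchange[OF I a 3] a xs \<open>j \<notin> I\<close> nth_mem[of a xs] by (auto simp: h_def xs_def[symmetric])
    qed
  qed
  have "((\<lambda>s. pluecker k (Y s) I) has_vector_derivative
      (\<Sum>a<k. \<Sum>j<n. B (xs ! a) j * minor k (Y t) (xs[a := j]))) (at t)"
    unfolding pluecker_def xs_def[symmetric]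
    by (rule minor_has_vector_derivative[OF d]) (use xs sub in auto)
  also have "(\<Sum>a<k. \<Sum>j<n. B (xs ! a) j * minor k (Y t) (xs[a := j])) =
      (\<Sum>a<k. \<Sum>j<n. B (xs ! a) j * h (xs ! a) j)"
    by (intro sum.cong) (auto simp: h)
  also have "\<dots> = (\<Sum>x\<in>I. \<Sum>j<n. B x j * h x j)"
    by (rule sum.reindex_bij_betw[where g = "\<lambda>x. \<Sum>j<n. B x j * h x j"])
      (use bij_betw_nth xs in blast)
  also have "\<dots> = (\<Sum>x\<in>I. B x x * pluecker k (Y t) I + (\<Sum>y\<in>{..<n} - I. B x y * h x y))"
  proof (intro sum.cong refl)
    fix x assume x: "x \<in> I"
    have "(\<Sum>j<n. B x j * h x j) = (\<Sum>j\<in>I. B x j * h x j) + (\<Sum>y\<in>{..<n} - I. B x y * h x y)"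
      using sub by (simp add: sum.subset_diff add.commute)
    also have "(\<Sum>j\<in>I. B x j * h x j) = B x x * h x x"
      using fin x by (subst sum.remove[of _ x]) (auto simp: h_def intro!: sum.neutral)
    finally show "(\<Sum>j<n. B x j * h x j) =
      B x x * pluecker k (Y t) I + (\<Sum>y\<in>{..<n} - I. B x y * h x y)" by (simp add: h_def)
  qed
  also have "\<dots> = (\<Sum>x\<in>I. B x x) * pluecker k (Y t) I + (\<Sum>(x, y)\<in>I \<times> ({..<n} - I). B x y * h x y)"
    by (simp add: sum.distrib sum_distrib_right sum.cartesian_product)
  also have "(\<Sum>(x, y)\<in>I \<times> ({..<n} - I). B x y * h x y) = (\<Sum>(x, y)\<in>I \<times> ({..<n} - I).
       (-1) ^ exchange_inv I x y * B x y * pluecker k (Y t) (insert y (I - {x})))"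
    by (intro sum.cong) (auto simp: h_def)
  finally show ?thesis .
qed

lemma minor_mult:
  assumes "\<And>a b. a < k \<Longrightarrow> b < k \<Longrightarrow> Y (xs ! a) b = (\<Sum>c<k. Z (xs ! a) c * C c b)"
  shows "minor k Y xs = minor k Z xs * det (mat k k (\<lambda>(c, b). C c b))"
proof -
  have "mat k k (\<lambda>(a, b). Y (xs ! a) b) = mat k k (\<lambda>(a, c). Z (xs ! a) c) * mat k k (\<lambda>(c, b). C c b)"
    using assms by (intro eq_matI) (auto simp: scalar_prod_def atLeast0LessThan)
  then show ?thesis unfolding minor_def by (simp add: det_mult[of _ k])
qed

text \<open>Passing to other combinations of the same k columns multiplies all coordinates by one
  determinant: they are homogeneous coordinates of the column space.\<close>

lemma pluecker_mult:
  assumes "I \<in> ksets n k" "\<And>i b. i < n \<Longrightarrow> b < k \<Longrightarrow> Y i b = (\<Sum>c<k. Z i c * C c b)"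
  shows "pluecker k Y I = pluecker k Z I * det (mat k k (\<lambda>(c, b). C c b))"
proof -
  have "finite I" "card I = k" "I \<subseteq> {..<n}"
    using assms(1) finite_subset unfolding ksets_def by auto
  then have "sorted_list_of_set I ! a < n" if "a < k" for a
    using that nth_mem[of a "sorted_list_of_set I"] by auto
  then show ?thesis unfolding pluecker_def using assms by (intro minor_mult) auto
qed

lemma pick_eq_sorted_list:
  assumes "finite I" "a < card I"
  shows "pick I a = sorted_list_of_set I ! a"
proof -
  have "sorted_wrt (<) (map (pick I) [0..<card I])"
    using pick_mono by (auto simp: sorted_wrt_iff_nth_less)
  moreover have "set (map (pick I) [0..<card I]) = I"
  proof (rule card_subset_eq[OF \<open>finite I\<close>])
    show "set (map (pick I) [0..<card I]) \<subseteq> I" using pick_in_set by auto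
    show "card (set (map (pick I) [0..<card I])) = card I"
      using calculation by (metis distinct_card length_map length_upt diff_zero strict_sorted_iff)
  qed
  ultimately have "sorted_list_of_set I = map (pick I) [0..<card I]"
    by (metis sorted_list_of_set.idem_if_sorted_distinct strict_sorted_iff)
  then show ?thesis using assms by simp
qed

lemma det_submatrix_eq_pluecker:
  assumes "g \<in> carrier_mat n n" "I \<in> ksets n k"
  shows "det (submatrix g I {..<k}) = pluecker k (\<lambda>i b. g $$ (i, b)) I"
proof -
  have I: "finite I" "card I = k" "I \<subseteq> {..<n}"
    using assms(2) finite_subset unfolding ksets_def by auto
  have "k \<le> n" using I card_mono[of "{..<n}" I] by auto
  have r: "{i. i < dim_row g \<and> i \<in> I} = I" and c: "{j. j < dim_col g \<and> j \<in> {..<k}} = {..<k}"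
    using assms I \<open>k \<le> n\<close> by auto
  have "sorted_list_of_set {..<k} = [0..<k]"
    by (metis atLeast0LessThan sorted_list_of_set_range)
  then have "pick {..<k} b = b" if "b < k" for b using that by (subst pick_eq_sorted_list) auto
  then have "submatrix g I {..<k} = mat k k (\<lambda>(a, b). g $$ (sorted_list_of_set I ! a, b))"
    unfolding submatrix_def r c using I by (intro eq_matI) (auto simp: pick_eq_sorted_list)
  then show ?thesis by (simp add: pluecker_def minor_def)
qed

section \<open>Total positivity and the matrix exponential\<close>

text \<open>The coefficients \<open>b\<close> are real, so for every multiplier \<open>c\<close> the
  real parts solve the same real system. Letting \<open>c\<close> run through 1, -1, \<i>, -\<i>
  controls complex coordinates by real ones.\<close>

lemma Re_pluecker_has_real_derivative:
  assumes d: "\<And>i j. i < n \<Longrightarrow> j < k \<Longrightarrow>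
      ((\<lambda>s. Y s i j) has_vector_derivative (\<Sum>l<n. complex_of_real (b i l) * Y t l j)) (at t)"
    and I: "I \<in> ksets n k"
  shows "((\<lambda>s. Re (c * pluecker k (Y s) I)) has_real_derivative
     (\<Sum>x\<in>I. b x x) * Re (c * pluecker k (Y t) I) +
     (\<Sum>e\<in>I \<times> ({..<n} - I). ((-1) ^ exchange_inv I (fst e) (snd e) * b (fst e) (snd e)) *
        Re (c * pluecker k (Y t) (insert (snd e) (I - {fst e}))))) (at t)"
proof -
  have "((\<lambda>s. c * pluecker k (Y s) I) has_vector_derivative
     c * ((\<Sum>x\<in>I. complex_of_real (b x x)) * pluecker k (Y t) I +
      (\<Sum>(x, y)\<in>I \<times> ({..<n} - I). (-1) ^ exchange_inv I x y * complex_of_real (b x y) *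
        pluecker k (Y t) (insert y (I - {x}))))) (at t)"
    by (intro has_vector_derivative_mult_right pluecker_has_vector_derivative d I)
  then have "((\<lambda>s. Re (c * pluecker k (Y s) I)) has_vector_derivative
     Re (c * ((\<Sum>x\<in>I. complex_of_real (b x x)) * pluecker k (Y t) I +
      (\<Sum>(x, y)\<in>I \<times> ({..<n} - I). (-1) ^ exchange_inv I x y * complex_of_real (b x y) *
        pluecker k (Y t) (insert y (I - {x})))))) (at t)"
    by (rule bounded_linear.has_vector_derivative[OF bounded_linear_Re])
  moreover have "Re (c * ((-1) ^ m * complex_of_real r * p)) = (-1) ^ m * r * Re (c * p)" for m r p
  proof -
    have "c * ((-1) ^ m * complex_of_real r * p) = complex_of_real ((-1) ^ m * r) * (c * p)" by simp
    then show ?thesis by (simp only: Re_complex_of_real times_complex.sel Im_complex_of_real)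
  qed
  moreover have "Re (c * (complex_of_real r * p)) = r * Re (c * p)" for r p
    by (simp add: algebra_simps)
  ultimately show ?thesis
    by (simp add: has_real_derivative_iff_has_vector_derivative distrib_left sum_distrib_left
        Re_sum case_prod_beta of_real_sum[symmetric] del: of_real_sum)
qed

text \<open>\<open>S\<close> may be any family closed under exchanges with nonzero coefficient: all
  of \<open>ksets n k\<close> for positivity, a proper subfamily for the conservation law of a cut
  cycle.\<close>

lemma pluecker_Re_nonneg_on:
  assumes d: "\<And>i j t. i < n \<Longrightarrow> j < k \<Longrightarrow> 0 \<le> t \<Longrightarrow>
      ((\<lambda>s. Y s i j) has_vector_derivative (\<Sum>l<n. complex_of_real (b i l) * Y t l j)) (at t)"
    and sign: "\<And>I x y. I \<in> S \<Longrightarrow> x \<in> I \<Longrightarrow> y < n \<Longrightarrow> y \<notin> I \<Longrightarrow> 0 \<le> (-1) ^ exchange_inv I x y * b x y"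
    and S: "S \<subseteq> ksets n k"
      "\<And>I x y. I \<in> S \<Longrightarrow> x \<in> I \<Longrightarrow> y < n \<Longrightarrow> y \<notin> I \<Longrightarrow> b x y \<noteq> 0 \<Longrightarrow> insert y (I - {x}) \<in> S"
    and init: "\<And>I. I \<in> S \<Longrightarrow> 0 \<le> Re (c * pluecker k (Y 0) I)"
    and "I \<in> S" "0 \<le> t"
  shows "0 \<le> Re (c * pluecker k (Y t) I)"
proof (rule metzler_nonneg[where q = "\<lambda>I t. Re (c * pluecker k (Y t) I)" and S = S
      and c = "\<lambda>I. \<Sum>x\<in>I. b x x" and T = "\<lambda>I. I \<times> ({..<n} - I)"
      and w = "\<lambda>I e. (-1) ^ exchange_inv I (fst e) (snd e) * b (fst e) (snd e)"
      and nb = "\<lambda>I e. insert (snd e) (I - {fst e})"])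
  show "finite S" using S(1) finite_subset finite_ksets by blast
  show "((\<lambda>s. Re (c * pluecker k (Y s) I)) has_real_derivative
     (\<Sum>x\<in>I. b x x) * Re (c * pluecker k (Y t) I) +
     (\<Sum>e\<in>I \<times> ({..<n} - I). ((-1) ^ exchange_inv I (fst e) (snd e) * b (fst e) (snd e)) *
        Re (c * pluecker k (Y t) (insert (snd e) (I - {fst e}))))) (at t)"
    if "I \<in> S" "0 \<le> t" for I t
    by (rule Re_pluecker_has_real_derivative) (use d S that in auto)
qed (use assms in auto)

text \<open>Zero initial values are nonnegative for every multiplier, so at later times the numbers
  p, -p, \<i> p and -\<i> p all have nonnegative real part.\<close>

lemma pluecker_vanishes_on:
  assumes d: "\<And>i j t. i < n \<Longrightarrow> j < k \<Longrightarrow> 0 \<le> t \<Longrightarrow>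
      ((\<lambda>s. Y s i j) has_vector_derivative (\<Sum>l<n. complex_of_real (b i l) * Y t l j)) (at t)"
    and sign: "\<And>I x y. I \<in> S \<Longrightarrow> x \<in> I \<Longrightarrow> y < n \<Longrightarrow> y \<notin> I \<Longrightarrow> 0 \<le> (-1) ^ exchange_inv I x y * b x y"
    and S: "S \<subseteq> ksets n k"
      "\<And>I x y. I \<in> S \<Longrightarrow> x \<in> I \<Longrightarrow> y < n \<Longrightarrow> y \<notin> I \<Longrightarrow> b x y \<noteq> 0 \<Longrightarrow> insert y (I - {x}) \<in> S"
    and init: "\<And>I. I \<in> S \<Longrightarrow> pluecker k (Y 0) I = 0"
    and I: "I \<in> S" "0 \<le> t"
  shows "pluecker k (Y t) I = 0"
proof -
  have *: "0 \<le> Re (c * pluecker k (Y t) I)" for c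
    by (rule pluecker_Re_nonneg_on[of n k Y b S c I t, OF d sign S _ I]) (simp_all add: init)
  show ?thesis using *[of 1] *[of "-1"] *[of \<i>] *[of "-\<i>"] by (simp add: complex_eq_iff)
qed

theorem pluecker_positive:
  assumes d: "\<And>i j t. i < n \<Longrightarrow> j < k \<Longrightarrow> 0 \<le> t \<Longrightarrow>
      ((\<lambda>s. Y s i j) has_vector_derivative (\<Sum>l<n. complex_of_real (b i l) * Y t l j)) (at t)"
    and sign: "\<And>I x y. I \<in> ksets n k \<Longrightarrow> x \<in> I \<Longrightarrow> y < n \<Longrightarrow> y \<notin> I \<Longrightarrow>
      0 \<le> (-1) ^ exchange_inv I x y * b x y"
    and \<sigma>: "bij_betw \<sigma> {..<n} {..<n}"
    and path: "\<And>p. Suc p < n \<Longrightarrow> b (\<sigma> p) (\<sigma> (Suc p)) \<noteq> 0 \<and> b (\<sigma> (Suc p)) (\<sigma> p) \<noteq> 0"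
    and init: "\<And>I. I \<in> ksets n k \<Longrightarrow> 0 \<le> c * pluecker k (Y 0) I"
    and ex: "\<exists>I\<in>ksets n k. c * pluecker k (Y 0) I \<noteq> 0"
    and "I \<in> ksets n k" "0 < t"
  shows "0 < c * pluecker k (Y t) I"
proof -
  let ?nb = "\<lambda>I e. insert (snd e) (I - {fst e})"
  let ?w = "\<lambda>I e. (-1) ^ exchange_inv I (fst e) (snd e) * b (fst e) (snd e)"
  define q where "q I t = Re (c * pluecker k (Y t) I)" for I t
  have exch: "insert y (I - {x}) \<in> ksets n k"
    if "I \<in> ksets n k" "x \<in> I" "y < n" "y \<notin> I" for I x y
    using that by (rule ksets_exchange)
  have nonneg: "0 \<le> q I t" if "I \<in> ksets n k" "0 \<le> t" for I t
    unfolding q_def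
    by (rule pluecker_Re_nonneg_on[of n k Y b "ksets n k" c I t, OF d sign])
      (use that exch init in \<open>auto simp: less_eq_complex_def\<close>)
  have Im0: "Im (c * pluecker k (Y t) I) = 0" if I: "I \<in> ksets n k" "0 \<le> t" for I t
  proof -
    \<comment> \<open>The initial values are nonnegative reals, so their multiples by \<i> and by
      -\<i> have real part 0. Nonnegativity for both multipliers then pins the imaginary part to
      0.\<close>
    have "0 \<le> Re (a * c * pluecker k (Y t) I)" if a: "a = \<i> \<or> a = - \<i>" for a
      by (rule pluecker_Re_nonneg_on[of n k Y b "ksets n k" "a * c" I t, OF d sign])
        (use I exch init a in \<open>auto simp: less_eq_complex_def mult.assoc\<close>)
    from this[of \<i>] this[of "- \<i>"] show ?thesis by (simp add: mult.assoc)
  qed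
  have deriv: "(q I has_real_derivative (\<Sum>x\<in>I. b x x) * q I t +
      (\<Sum>e\<in>I \<times> ({..<n} - I). ?w I e * q (?nb I e) t)) (at t)" if "I \<in> ksets n k" "0 \<le> t" for I t
    unfolding q_def by (rule Re_pluecker_has_real_derivative) (use d that in auto)
  have fin: "finite (I \<times> ({..<n} - I))" if "I \<in> ksets n k" for I
    using that finite_subset unfolding ksets_def by auto
  \<comment> \<open>The sets whose coordinate is positive at all positive times. A coordinate that
    is nonzero at time 0 puts its set into \<open>F\<close>, and exchanges along the path enlarge
    \<open>F\<close> to everything.\<close>
  define F where "F = {I \<in> ksets n k. \<forall>t>0. 0 < q I t}"
  have "F = ksets n k"
  proof (rule ksets_path_connected[OF \<sigma>])
    show "F \<subseteq> ksets n k" by (auto simp: F_def)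
    from ex obtain J where J: "J \<in> ksets n k" "c * pluecker k (Y 0) J \<noteq> 0" by blast
    with Im0[of J 0] have "q J 0 \<noteq> 0" by (auto simp: q_def complex_eq_iff)
    with nonneg[of J 0] J have J0: "0 < q J 0" by simp
    have "0 < q J t" if "0 < t" for t
    proof -
      have "exp (- (\<Sum>x\<in>J. b x x) * 0) * q J 0 \<le> exp (- (\<Sum>x\<in>J. b x x) * t) * q J t"
      proof (rule metzler_persists[where f = "q J" and T = "J \<times> ({..<n} - J)" and w = "?w J"
            and q = "\<lambda>e. q (?nb J e)"])
        show "(q J has_real_derivative (\<Sum>x\<in>J. b x x) * q J t +
            (\<Sum>e\<in>J \<times> ({..<n} - J). ?w J e * q (?nb J e) t)) (at t)" if "0 \<le> t" for t
          by (rule deriv[OF J(1) that])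
      qed (use sign J exch nonneg that in auto)
      with J0 have "0 < exp (- (\<Sum>x\<in>J. b x x) * t) * q J t" by simp
      then show ?thesis by (simp add: zero_less_mult_iff)
    qed
    with J show "F \<noteq> {}" by (auto simp: F_def)
  next
    fix J p x y assume J: "J \<in> F" and p: "Suc p < n" and xy: "{x, y} = {\<sigma> p, \<sigma> (Suc p)}"
      and x: "x \<in> J" and y: "y \<notin> J"
    have JK: "J \<in> ksets n k" and Jpos: "\<And>t. 0 < t \<Longrightarrow> 0 < q J t" using J by (auto simp: F_def)
    have "\<sigma> p < n" "\<sigma> (Suc p) < n" using \<sigma> p unfolding bij_betw_def by auto
    then have "y < n" "x < n" using xy by (auto simp: doubleton_eq_iff)
    let ?I = "insert y (J - {x})"
    have I: "?I \<in> ksets n k" by (rule exch[OF JK x \<open>y < n\<close> y])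
    have "x \<noteq> y" using x y by auto
    \<comment> \<open>In the equation of the new set, the coordinate of \<open>J\<close> enters
      through the exchange of y for x, so the coefficient is \<open>b y x\<close> and not
      \<open>b x y\<close>.\<close>
    have byx: "b y x \<noteq> 0" using path[OF p] xy by (auto simp: doubleton_eq_iff)
    have swap_back: "insert x (?I - {y}) = J" using x y by auto
    have "0 < q ?I t" if "0 < t" for t
    proof (rule metzler_spreads[where f = "q ?I" and T = "?I \<times> ({..<n} - ?I)" and w = "?w ?I"
            and q = "\<lambda>e. q (?nb ?I e)" and e = "(y, x)"])
      show "(q ?I has_real_derivative (\<Sum>x\<in>?I. b x x) * q ?I t +
            (\<Sum>e\<in>?I \<times> ({..<n} - ?I). ?w ?I e * q (?nb ?I e) t)) (at t)" if "0 \<le> t" for t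
        by (rule deriv[OF I that])
      show "finite (?I \<times> ({..<n} - ?I))" by (rule fin[OF I])
      have "0 \<le> (-1) ^ exchange_inv ?I y x * b y x"
        by (rule sign[OF I]) (use \<open>x < n\<close> \<open>x \<noteq> y\<close> in auto)
      moreover have "(-1) ^ exchange_inv ?I y x * b y x \<noteq> 0" using byx by simp
      ultimately show "0 < ?w ?I (y, x)" unfolding fst_conv snd_conv by linarith
      show "0 < q (?nb ?I (y, x)) u" if "0 < u" for u
        using Jpos[OF that] unfolding fst_conv snd_conv swap_back .
      show "0 \<le> ?w ?I e" if "e \<in> ?I \<times> ({..<n} - ?I)" for e
        by (rule sign[OF I]) (use that in auto)
      show "0 \<le> q (?nb ?I e) t" if "e \<in> ?I \<times> ({..<n} - ?I)" "0 \<le> t" for e t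
        by (rule nonneg[OF exch[OF I]]) (use that in auto)
    qed (use nonneg[OF I] \<open>x < n\<close> \<open>x \<noteq> y\<close> that in auto)
    then show "?I \<in> F" using I by (auto simp: F_def)
  qed
  then have "0 < q I t" using assms by (auto simp: F_def)
  then show ?thesis using Im0[OF \<open>I \<in> ksets n k\<close>, of t] \<open>0 < t\<close> by (simp add: q_def less_complex_def)
qed

lemma has_mat_derivative_mult:
  assumes X: "\<And>s. X s \<in> carrier_mat n n" "X' \<in> carrier_mat n n" "has_mat_derivative n X X' t"
    and Y: "\<And>s. Y s \<in> carrier_mat n n" "Y' \<in> carrier_mat n n" "has_mat_derivative n Y Y' t"
  shows "has_mat_derivative n (\<lambda>s. X s * Y s) (X' * Y t + X t * Y') t"
  unfolding has_mat_derivative_def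
proof (intro allI impI)
  fix i j assume ij: "i < n" "j < n"
  have entry: "(X s * Y s) $$ (i, j) = (\<Sum>l<n. X s $$ (i, l) * Y s $$ (l, j))" for s
    using ij X(1)[of s] Y(1)[of s] by (simp add: scalar_prod_def atLeast0LessThan)
  have "((\<lambda>s. \<Sum>l<n. X s $$ (i, l) * Y s $$ (l, j)) has_vector_derivative
     (\<Sum>l<n. X t $$ (i, l) * Y' $$ (l, j) + X' $$ (i, l) * Y t $$ (l, j))) (at t)"
    by (intro has_vector_derivative_sum has_vector_derivative_mult)
      (use X Y ij in \<open>auto simp: has_mat_derivative_def\<close>)
  also have "(\<Sum>l<n. X t $$ (i, l) * Y' $$ (l, j) + X' $$ (i, l) * Y t $$ (l, j)) =
      (X' * Y t + X t * Y') $$ (i, j)"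
    using ij X(1)[of t] Y(1)[of t] X(2) Y(2)
    by (simp add: scalar_prod_def atLeast0LessThan sum.distrib)
  finally show "((\<lambda>s. (X s * Y s) $$ (i, j)) has_vector_derivative
      (X' * Y t + X t * Y') $$ (i, j)) (at t)"
    by (simp add: entry)
qed

lemma has_mat_derivative_const: "has_mat_derivative n (\<lambda>s. A) (0\<^sub>m n n) t"
  by (simp add: has_mat_derivative_def)

lemma has_mat_derivative_add:
  assumes "\<And>s. Y s \<in> carrier_mat n n" "Y' \<in> carrier_mat n n"
    "has_mat_derivative n X X' t" "has_mat_derivative n Y Y' t"
  shows "has_mat_derivative n (\<lambda>s. X s + Y s) (X' + Y') t"
proof -
  have "dim_row (Y s) = n" "dim_col (Y s) = n" for s using assms(1)[of s] by auto
  with assms show ?thesis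
    unfolding has_mat_derivative_def by (auto intro!: derivative_intros)
qed

lemma has_mat_derivative_smult:
  assumes "\<And>s. X s \<in> carrier_mat n n" "X' \<in> carrier_mat n n" "has_mat_derivative n X X' t"
  shows "has_mat_derivative n (\<lambda>s. c \<cdot>\<^sub>m X s) (c \<cdot>\<^sub>m X') t"
proof -
  have "dim_row (X s) = n" "dim_col (X s) = n" for s using assms(1)[of s] by auto
  with assms show ?thesis
    unfolding has_mat_derivative_def by (auto intro!: derivative_intros)
qed

lemma has_mat_derivative_zero_unique:
  assumes X: "\<And>s. X s \<in> carrier_mat n n" and d: "\<And>s. has_mat_derivative n X (0\<^sub>m n n) s"
  shows "X s = X t"
proof (rule eq_matI)
  fix i j assume "i < dim_row (X t)" "j < dim_col (X t)"
  then have ij: "i < n" "j < n" using X[of t] by auto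
  have D: "((\<lambda>s. X s $$ (i, j)) has_vector_derivative 0) (at u)" for u
    using d[of u] ij by (simp add: has_mat_derivative_def)
  have "((\<lambda>s. Re (X s $$ (i, j))) has_real_derivative 0) (at u)"
    "((\<lambda>s. Im (X s $$ (i, j))) has_real_derivative 0) (at u)" for u
    using bounded_linear.has_vector_derivative[OF bounded_linear_Re D[of u]]
      bounded_linear.has_vector_derivative[OF bounded_linear_Im D[of u]]
    by (simp_all add: has_real_derivative_iff_has_vector_derivative)
  then have "Re (X s $$ (i, j)) = Re (X t $$ (i, j))" "Im (X s $$ (i, j)) = Im (X t $$ (i, j))"
    using DERIV_const_ratio_const2 DERIV_isconst_all by blast+
  then show "X s $$ (i, j) = X t $$ (i, j)" by (simp add: complex_eq_iff)
qed (use X[of s] X[of t] in auto)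

section \<open>The matrix exponential as an entrywise power series\<close>

definition mat_exp :: "nat \<Rightarrow> complex mat \<Rightarrow> real \<Rightarrow> complex mat" where
  "mat_exp n B t = mat n n (\<lambda>(i, j). \<Sum>m. (B ^\<^sub>m m) $$ (i, j) / fact m * complex_of_real t ^ m)"

lemma mat_exp_carrier [simp]: "mat_exp n B t \<in> carrier_mat n n"
  "dim_row (mat_exp n B t) = n" "dim_col (mat_exp n B t) = n"
  by (simp_all add: mat_exp_def)

lemma pow_mat_entry_bound:
  assumes B: "B \<in> carrier_mat n n" and a: "\<And>i j. i < n \<Longrightarrow> j < n \<Longrightarrow> cmod (B $$ (i, j)) \<le> a"
    and "0 \<le> a" and ij: "i < n" "j < n"
  shows "cmod ((B ^\<^sub>m m) $$ (i, j)) \<le> (real n * a) ^ m"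
  using ij
proof (induction m arbitrary: i j)
  case (Suc m)
  have "(B ^\<^sub>m Suc m) $$ (i, j) = (\<Sum>l<n. (B ^\<^sub>m m) $$ (i, l) * B $$ (l, j))"
    using Suc.prems B by (simp add: scalar_prod_def atLeast0LessThan)
  also have "cmod \<dots> \<le> (\<Sum>l<n. (real n * a) ^ m * a)"
    using \<open>0 \<le> a\<close>
    by (intro sum_norm_le) (auto simp: norm_mult intro!: mult_mono Suc a)
  also have "\<dots> = (real n * a) ^ Suc m" by simp
  finally show ?case .
qed (use B in auto)

lemma mat_exp_series_summable:
  assumes B: "B \<in> carrier_mat n n" and ij: "i < n" "j < n"
  shows "summable (\<lambda>m. (B ^\<^sub>m m) $$ (i, j) / fact m * (z::complex) ^ m)"
proof -
  define a where "a = (\<Sum>i<n. \<Sum>j<n. cmod (B $$ (i, j)))"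
  have a: "cmod (B $$ (i, j)) \<le> a" if "i < n" "j < n" for i j
  proof -
    have "cmod (B $$ (i, j)) \<le> (\<Sum>j<n. cmod (B $$ (i, j)))"
      using that by (intro member_le_sum) auto
    also have "\<dots> \<le> a" unfolding a_def
      using that by (intro member_le_sum[of i _ "\<lambda>i. \<Sum>j<n. cmod (B $$ (i, j))"]) (auto intro: sum_nonneg)
    finally show ?thesis .
  qed
  have "0 \<le> a" unfolding a_def by (intro sum_nonneg) auto
  show ?thesis
  proof (rule summable_comparison_test'[OF summable_exp[of "real n * a * cmod z"]])
    fix m
    have "cmod ((B ^\<^sub>m m) $$ (i, j)) \<le> (real n * a) ^ m"
      by (rule pow_mat_entry_bound[OF B a \<open>0 \<le> a\<close> ij])
    then have "cmod ((B ^\<^sub>m m) $$ (i, j)) * cmod z ^ m \<le> (real n * a) ^ m * cmod z ^ m"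
      by (rule mult_right_mono) simp
    then show "norm ((B ^\<^sub>m m) $$ (i, j) / fact m * z ^ m) \<le> inverse (fact m) * (real n * a * cmod z) ^ m"
      by (simp add: norm_mult norm_divide norm_power power_mult_distrib field_simps)
  qed
qed

lemma mat_exp_zero: "B \<in> carrier_mat n n \<Longrightarrow> mat_exp n B 0 = 1\<^sub>m n"
proof (rule eq_matI)
  fix i j assume B: "B \<in> carrier_mat n n" and "i < dim_row (1\<^sub>m n)" "j < dim_col (1\<^sub>m n)"
  then show "mat_exp n B 0 $$ (i, j) = 1\<^sub>m n $$ (i, j)"
    using powser_zero[of "\<lambda>m. (B ^\<^sub>m m) $$ (i, j) / fact m"] by (simp add: mat_exp_def)
qed (auto simp: mat_exp_def)

lemma pow_mat_Suc_left:
  assumes "B \<in> carrier_mat n n"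
  shows "B ^\<^sub>m Suc m = B * B ^\<^sub>m m"
  using assms
proof (induction m)
  case (Suc m)
  have "B ^\<^sub>m Suc (Suc m) = (B * B ^\<^sub>m m) * B" using Suc by simp
  then show ?case using Suc.prems by (simp add: assoc_mult_mat[of _ n n _ n _ n])
qed simp

text \<open>Both orders are kept: in the derivative of exp(-tB) exp(tB) the generator can then stand
  in the middle of both terms, which cancel.\<close>

lemma mat_exp_has_derivative:
  assumes B: "B \<in> carrier_mat n n"
  shows "has_mat_derivative n (mat_exp n B) (B * mat_exp n B t) t" (is ?L)
    and "has_mat_derivative n (mat_exp n B) (mat_exp n B t * B) t" (is ?R)
proof -
  have D: "((\<lambda>s. mat_exp n B s $$ (i, j)) has_vector_derivative
     (\<Sum>m. (B ^\<^sub>m Suc m) $$ (i, j) / fact m * complex_of_real t ^ m)) (at t)"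
    if ij: "i < n" "j < n" for i j
  proof -
    have "diffs (\<lambda>m. (B ^\<^sub>m m) $$ (i, j) / fact m) = (\<lambda>m. (B ^\<^sub>m Suc m) $$ (i, j) / fact m)"
      by (rule ext) (simp add: diffs_def field_simps del: of_nat_Suc pow_mat.simps)
    then show ?thesis
      using has_vector_derivative_real_field[OF termdiffs_strong_converges_everywhere[OF
          mat_exp_series_summable[OF B ij]], of t UNIV] ij
      by (simp add: mat_exp_def)
  qed
  define c where "c i j m = (B ^\<^sub>m m) $$ (i, j) / fact m * complex_of_real t ^ m" for i j m
  have sm: "summable (c i j)" if "i < n" "j < n" for i j
    unfolding c_def by (rule mat_exp_series_summable[OF B that])
  show ?L unfolding has_mat_derivative_def
  proof (intro allI impI)
    fix i j assume ij: "i < n" "j < n"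
    have eq: "(B ^\<^sub>m Suc m) $$ (i, j) / fact m * complex_of_real t ^ m =
        (\<Sum>l<n. B $$ (i, l) * c l j m)" for m
      unfolding c_def pow_mat_Suc_left[OF B] using ij B
      by (simp add: scalar_prod_def atLeast0LessThan sum_distrib_right sum_divide_distrib mult.assoc
          del: pow_mat.simps)
    have "(\<Sum>m. (B ^\<^sub>m Suc m) $$ (i, j) / fact m * complex_of_real t ^ m) =
        (\<Sum>l<n. B $$ (i, l) * (\<Sum>m. c l j m))"
      unfolding eq using sm ij by (subst suminf_sum) (simp_all add: summable_mult suminf_mult del: pow_mat.simps)
    also have "\<dots> = (B * mat_exp n B t) $$ (i, j)"
      using ij B by (simp add: mat_exp_def c_def scalar_prod_def atLeast0LessThan)
    finally show "((\<lambda>s. mat_exp n B s $$ (i, j)) has_vector_derivative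
        (B * mat_exp n B t) $$ (i, j)) (at t)" using D[OF ij] by simp
  qed
  show ?R unfolding has_mat_derivative_def
  proof (intro allI impI)
    fix i j assume ij: "i < n" "j < n"
    have eq: "(B ^\<^sub>m Suc m) $$ (i, j) / fact m * complex_of_real t ^ m =
        (\<Sum>l<n. c i l m * B $$ (l, j))" for m
      unfolding c_def using ij B
      by (simp add: scalar_prod_def atLeast0LessThan sum_distrib_right sum_distrib_left sum_divide_distrib mult_ac)
    have "(\<Sum>m. (B ^\<^sub>m Suc m) $$ (i, j) / fact m * complex_of_real t ^ m) =
        (\<Sum>l<n. (\<Sum>m. c i l m) * B $$ (l, j))"
      unfolding eq using sm ij by (subst suminf_sum) (simp_all add: summable_mult2 suminf_mult2 del: pow_mat.simps)
    also have "\<dots> = (mat_exp n B t * B) $$ (i, j)"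
      using ij B by (simp add: mat_exp_def c_def scalar_prod_def atLeast0LessThan)
    finally show "((\<lambda>s. mat_exp n B s $$ (i, j)) has_vector_derivative
        (mat_exp n B t * B) $$ (i, j)) (at t)" using D[OF ij] by simp
  qed
qed

lemma mat_exp_uminus_mult:
  assumes B: "B \<in> carrier_mat n n"
  shows "mat_exp n (- B) t * mat_exp n B t = 1\<^sub>m n" "mat_exp n B t * mat_exp n (- B) t = 1\<^sub>m n"
proof -
  have B': "- B \<in> carrier_mat n n" using B by simp
  let ?X = "\<lambda>s. mat_exp n (- B) s * mat_exp n B s"
  have "has_mat_derivative n ?X (mat_exp n (- B) s * - B * mat_exp n B s +
      mat_exp n (- B) s * (B * mat_exp n B s)) s" for s
    using B B' mult_carrier_mat[of "mat_exp n (- B) s" n n "- B" n]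
      mult_carrier_mat[of B n n "mat_exp n B s" n]
    by (intro has_mat_derivative_mult mat_exp_has_derivative) simp_all
  moreover have "mat_exp n (- B) s * - B * mat_exp n B s +
      mat_exp n (- B) s * (B * mat_exp n B s) = 0\<^sub>m n n" for s
  proof -
    have "mat_exp n (- B) s * - B * mat_exp n B s = - (mat_exp n (- B) s * (B * mat_exp n B s))"
      using B by (simp add: assoc_mult_mat[of _ n n _ n _ n] carrier_matD[OF B])
    then show ?thesis using B by (simp add: uminus_l_inv_mat[of _ n n] mult_carrier_mat[of _ n n _ n])
  qed
  ultimately have "?X t = ?X 0"
    using mult_carrier_mat[of _ n n _ n] by (intro has_mat_derivative_zero_unique) auto
  then show 1: "mat_exp n (- B) t * mat_exp n B t = 1\<^sub>m n" using B B' by (simp add: mat_exp_zero)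
  show "mat_exp n B t * mat_exp n (- B) t = 1\<^sub>m n"
    by (rule mat_mult_left_right_inverse[OF _ _ 1]) auto
qed

lemma mat_exp_column_derivative:
  assumes B: "B \<in> carrier_mat n n" and G: "G \<in> carrier_mat n n" and ij: "i < n" "j < n"
  shows "((\<lambda>s. (mat_exp n B s * G) $$ (i, j)) has_vector_derivative
    (\<Sum>l<n. B $$ (i, l) * (mat_exp n B t * G) $$ (l, j))) (at t)"
proof -
  have "has_mat_derivative n (\<lambda>s. mat_exp n B s * G)
      (B * mat_exp n B t * G + mat_exp n B t * 0\<^sub>m n n) t"
    using B G mult_carrier_mat[of _ n n _ n]
    by (intro has_mat_derivative_mult mat_exp_has_derivative has_mat_derivative_const) auto
  also have "B * mat_exp n B t * G + mat_exp n B t * 0\<^sub>m n n = B * (mat_exp n B t * G)"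
    using B G by (simp add: assoc_mult_mat[of _ n n _ n _ n] mult_carrier_mat[of _ n n _ n])
  finally have D: "has_mat_derivative n (\<lambda>s. mat_exp n B s * G) (B * (mat_exp n B t * G)) t" .
  have "(B * (mat_exp n B t * G)) $$ (i, j) = (\<Sum>l<n. B $$ (i, l) * (mat_exp n B t * G) $$ (l, j))"
    using ij B G
    by (simp add: scalar_prod_def atLeast0LessThan)
  then show ?thesis using D ij by (metis has_mat_derivative_def)
qed

section \<open>Extending positive subspaces to positive flags\<close>

lemma mat_adjoint_carrier [simp]: "A \<in> carrier_mat n m \<Longrightarrow> mat_adjoint A \<in> carrier_mat m n"
  unfolding mat_adjoint_def by auto

lemma mat_adjoint_dim [simp]:
  "dim_row (mat_adjoint A) = dim_col A" "dim_col (mat_adjoint A) = dim_row A"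
  unfolding mat_adjoint_def by auto

lemma mat_adjoint_index [simp]:
  fixes A :: "complex mat"
  assumes "i < dim_col A" "j < dim_row A"
  shows "mat_adjoint A $$ (i, j) = cnj (A $$ (j, i))"
  using assms unfolding mat_adjoint_def by (simp add: mat_of_rows_index)

text \<open>Gram-Schmidt with its change of basis \<open>U\<close> recorded. Because
  \<open>U\<close> is upper triangular with positive diagonal, initial column spans are kept and
  left-justified minors change by positive factors only.\<close>

lemma gram_schmidt_columns:
  assumes G: "G \<in> carrier_mat n n" and det: "det G \<noteq> 0" and "m \<le> n"
  shows "\<exists>u U r. (\<forall>b<m. \<forall>i<n. u b i = (\<Sum>l<n. G $$ (i, l) * U l b)) \<and>
    (\<forall>b<m. \<forall>l>b. U l b = 0) \<and> (\<forall>b<m. U b b = complex_of_real (r b) \<and> 0 < r b) \<and>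
    (\<forall>a<m. \<forall>b<m. (\<Sum>i<n. cnj (u a i) * u b i) = (if a = b then 1 else 0))"
  using \<open>m \<le> n\<close>
proof (induction m)
  case (Suc m)
  then have "m \<le> n" by simp
  with Suc.IH obtain u U r where *: "(\<forall>b<m. \<forall>i<n. u b i = (\<Sum>l<n. G $$ (i, l) * U l b)) \<and>
    (\<forall>b<m. \<forall>l>b. U l b = 0) \<and> (\<forall>b<m. U b b = complex_of_real (r b) \<and> 0 < r b) \<and>
    (\<forall>a<m. \<forall>b<m. (\<Sum>i<n. cnj (u a i) * u b i) = (if a = b then 1 else 0))"
    by blast
  have u: "\<And>b i. b < m \<Longrightarrow> i < n \<Longrightarrow> u b i = (\<Sum>l<n. G $$ (i, l) * U l b)"
    and U: "\<And>b l. b < m \<Longrightarrow> b < l \<Longrightarrow> U l b = 0"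
    and r: "\<And>b. b < m \<Longrightarrow> U b b = complex_of_real (r b) \<and> 0 < r b"
    and orth: "\<And>a b. a < m \<Longrightarrow> b < m \<Longrightarrow> (\<Sum>i<n. cnj (u a i) * u b i) = (if a = b then 1 else 0)"
    using * by auto
  define c where "c a = (\<Sum>i<n. cnj (u a i) * G $$ (i, m))" for a
  define v where "v i = G $$ (i, m) - (\<Sum>a<m. c a * u a i)" for i
  define W where "W l = (if l = m then 1 else 0) - (\<Sum>a<m. c a * U l a)" for l
  have W: "W m = 1" "\<And>l. m < l \<Longrightarrow> W l = 0" using U by (auto simp: W_def)
  have v: "v i = (\<Sum>l<n. G $$ (i, l) * W l)" if i: "i < n" for i
  proof -
    have "(\<Sum>a<m. c a * u a i) = (\<Sum>a<m. \<Sum>l<n. G $$ (i, l) * (c a * U l a))"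
      using u i by (simp add: sum_distrib_left mult_ac)
    also have "\<dots> = (\<Sum>l<n. \<Sum>a<m. G $$ (i, l) * (c a * U l a))" by (rule sum.swap)
    finally have 1: "(\<Sum>a<m. c a * u a i) = (\<Sum>l<n. G $$ (i, l) * (\<Sum>a<m. c a * U l a))"
      by (simp add: sum_distrib_left)
    have "G $$ (i, l) * W l = (if l = m then G $$ (i, l) else 0) - G $$ (i, l) * (\<Sum>a<m. c a * U l a)" for l
      by (simp add: W_def algebra_simps)
    then have "(\<Sum>l<n. G $$ (i, l) * W l) = G $$ (i, m) - (\<Sum>l<n. G $$ (i, l) * (\<Sum>a<m. c a * U l a))"
      using Suc.prems by (simp add: sum_subtractf)
    then show ?thesis by (simp add: v_def 1)
  qed
  define s where "s = sqrt (\<Sum>i<n. (cmod (v i))\<^sup>2)"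
  \<comment> \<open>\<open>W\<close> has entry 1 at position m, so \<open>v = 0\<close> would give a
    nonzero kernel vector of the invertible matrix \<open>G\<close>.\<close>
  have "\<exists>i<n. v i \<noteq> 0"
  proof (rule ccontr)
    assume "\<not> ?thesis"
    then have "G *\<^sub>v vec n W = 0\<^sub>v n"
      using G v by (intro eq_vecI) (auto simp: scalar_prod_def atLeast0LessThan)
    moreover have "vec n W \<noteq> 0\<^sub>v n"
    proof
      assume "vec n W = 0\<^sub>v n"
      then have "vec n W $ m = 0\<^sub>v n $ m" by simp
      then show False using W Suc.prems by simp
    qed
    ultimately show False
      using det det_0_iff_vec_prod_zero_field[OF G] by (auto intro: vec_carrier)
  qed
  then obtain i where "i < n" "v i \<noteq> 0" by blast
  then have "0 < (\<Sum>i<n. (cmod (v i))\<^sup>2)" by (intro sum_pos2[of _ i]) auto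
  then have s: "0 < s" and s2: "s\<^sup>2 = (\<Sum>i<n. (cmod (v i))\<^sup>2)" by (auto simp: s_def)
  have uv: "(\<Sum>i<n. cnj (u a i) * v i) = 0" if a: "a < m" for a
  proof -
    have "(\<Sum>i<n. cnj (u a i) * v i) = c a - (\<Sum>i<n. \<Sum>b<m. c b * (cnj (u a i) * u b i))"
      by (simp add: v_def c_def right_diff_distrib sum_subtractf sum_distrib_left mult_ac)
    also have "(\<Sum>i<n. \<Sum>b<m. c b * (cnj (u a i) * u b i)) = (\<Sum>b<m. \<Sum>i<n. c b * (cnj (u a i) * u b i))"
      by (rule sum.swap)
    also have "\<dots> = (\<Sum>b<m. c b * (if a = b then 1 else 0))"
      using orth a by (simp add: sum_distrib_left[symmetric])
    also have "\<dots> = c a" using a by (simp add: if_distrib cong: if_cong)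
    finally show ?thesis by simp
  qed
  have vu: "(\<Sum>i<n. cnj (v i) * u a i) = 0" if a: "a < m" for a
  proof -
    have "(\<Sum>i<n. cnj (v i) * u a i) = cnj (\<Sum>i<n. cnj (u a i) * v i)"
      by (simp add: mult.commute)
    then show ?thesis using uv[OF a] by simp
  qed
  have vv: "(\<Sum>i<n. cnj (v i) * v i) = complex_of_real (s\<^sup>2)"
    unfolding s2 of_real_sum by (intro sum.cong refl) (simp only: complex_norm_square mult.commute)
  define u' where "u' = u(m := \<lambda>i. v i / s)"
  define U' where "U' = (\<lambda>l b. if b = m then W l / s else U l b)"
  have "\<forall>b<Suc m. \<forall>i<n. u' b i = (\<Sum>l<n. G $$ (i, l) * U' l b)"
    using u v by (auto simp: u'_def U'_def less_Suc_eq sum_divide_distrib)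
  moreover have "\<forall>b<Suc m. \<forall>l>b. U' l b = 0"
    using U W by (auto simp: U'_def less_Suc_eq)
  moreover have "\<forall>b<Suc m. U' b b = complex_of_real ((r(m := 1 / s)) b) \<and> 0 < (r(m := 1 / s)) b"
    using r W s by (auto simp: U'_def less_Suc_eq)
  moreover have "\<forall>a<Suc m. \<forall>b<Suc m. (\<Sum>i<n. cnj (u' a i) * u' b i) = (if a = b then 1 else 0)"
  proof (intro allI impI)
    fix a b assume "a < Suc m" "b < Suc m"
    then consider "a < m" "b < m" | "a < m" "b = m" | "a = m" "b < m" | "a = m" "b = m" by linarith
    then show "(\<Sum>i<n. cnj (u' a i) * u' b i) = (if a = b then 1 else 0)"
    proof cases
      case 1
      then show ?thesis using orth by (simp add: u'_def)
    next
      case 2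
      then show ?thesis using uv[of a] by (simp add: u'_def sum_divide_distrib[symmetric])
    next
      case 3
      then show ?thesis using vu[of b] by (simp add: u'_def sum_divide_distrib[symmetric])
    next
      case 4
      have "(\<Sum>i<n. cnj (u' a i) * u' b i) = (\<Sum>i<n. cnj (v i) * v i) / (complex_of_real s)\<^sup>2"
        using 4 by (simp add: u'_def sum_divide_distrib power2_eq_square)
      then show ?thesis using 4 s vv by simp
    qed
  qed
  ultimately show ?case by blast
qed simp

lemma unitary_factorization:
  assumes G: "G \<in> carrier_mat n n" and det: "det G \<noteq> 0"
  obtains g U r where "g \<in> unitary_group n"
    "\<And>i b. i < n \<Longrightarrow> b < n \<Longrightarrow> g $$ (i, b) = (\<Sum>l<n. G $$ (i, l) * U l b)"
    "\<And>b l. b < n \<Longrightarrow> b < l \<Longrightarrow> U l b = 0"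
    "\<And>b. b < n \<Longrightarrow> U b b = complex_of_real (r b) \<and> 0 < r b"
proof -
  from gram_schmidt_columns[OF G det order_refl] obtain u U r where *: "(\<forall>b<n. \<forall>i<n. u b i = (\<Sum>l<n. G $$ (i, l) * U l b)) \<and>
    (\<forall>b<n. \<forall>l>b. U l b = 0) \<and> (\<forall>b<n. U b b = complex_of_real (r b) \<and> 0 < r b) \<and>
    (\<forall>a<n. \<forall>b<n. (\<Sum>i<n. cnj (u a i) * u b i) = (if a = b then 1 else 0))"
    by blast
  have u: "\<And>b i. b < n \<Longrightarrow> i < n \<Longrightarrow> u b i = (\<Sum>l<n. G $$ (i, l) * U l b)"
    and U: "\<And>b l. b < n \<Longrightarrow> b < l \<Longrightarrow> U l b = 0"
    and r: "\<And>b. b < n \<Longrightarrow> U b b = complex_of_real (r b) \<and> 0 < r b"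
    and orth: "\<And>a b. a < n \<Longrightarrow> b < n \<Longrightarrow> (\<Sum>i<n. cnj (u a i) * u b i) = (if a = b then 1 else 0)"
    using * by auto
  define g where "g = mat n n (\<lambda>(i, b). u b i)"
  have g: "g \<in> carrier_mat n n" by (simp add: g_def)
  have "mat_adjoint g * g = 1\<^sub>m n"
    using orth mat_adjoint_carrier[OF g]
    by (intro eq_matI) (auto simp: g_def scalar_prod_def atLeast0LessThan)
  moreover from this have "g * mat_adjoint g = 1\<^sub>m n"
    by (rule mat_mult_left_right_inverse[OF mat_adjoint_carrier[OF g] g])
  ultimately have "g \<in> unitary_group n" using g by (simp add: unitary_group_def)
  then show thesis by (rule that[of g U r]) (use u U r in \<open>auto simp: g_def\<close>)
qed

lemma det_of_real_upper_triangular: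
  assumes "\<And>b l. b < k \<Longrightarrow> b < l \<Longrightarrow> U l b = 0"
    and "\<And>b. b < k \<Longrightarrow> U b b = complex_of_real (r b) \<and> 0 < r b"
  shows "0 < det (mat k k (\<lambda>(l, b). U l b))"
proof -
  have "det (mat k k (\<lambda>(l, b). U l b)) = prod_list (diag_mat (mat k k (\<lambda>(l, b). U l b)))"
    using assms(1) by (intro det_upper_triangular[of _ k]) (auto intro!: upper_triangularI)
  also have "\<dots> = (\<Prod>i = 0..<k. complex_of_real (r i))"
    using assms(2) by (simp add: prod_list_diag_prod)
  also have "\<dots> = complex_of_real (\<Prod>i = 0..<k. r i)" by simp
  finally have "det (mat k k (\<lambda>(l, b). U l b)) = complex_of_real (\<Prod>i = 0..<k. r i)" .
  moreover have "0 < (\<Prod>i = 0..<k. r i)" using assms(2) by (intro prod_pos) auto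
  ultimately show ?thesis by (simp add: less_complex_def del: of_real_prod)
qed

lemma minor_zero_row:
  assumes "a < k" "\<And>b. b < k \<Longrightarrow> Y (xs ! a) b = 0"
  shows "minor k Y xs = 0"
proof -
  have "(\<Prod>c\<in>{0..<k}. Y (xs ! c) (p c)) = 0" if "p permutes {0..<k}" for p
  proof (rule prod_zero)
    have "p a < k" using permutes_in_image[OF that, of a] assms(1) by simp
    then show "\<exists>c\<in>{0..<k}. Y (xs ! c) (p c) = 0" using assms by (intro bexI[of _ a]) auto
  qed simp
  then show ?thesis unfolding minor_leibniz by (intro sum.neutral) auto
qed

lemma minor_expand_row:
  assumes "length xs = k" "\<And>b. b < k \<Longrightarrow> Y m b = 0"
  shows "minor (Suc k) Y (xs @ [m]) = Y m k * minor k Y xs"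
proof -
  let ?A = "mat (Suc k) (Suc k) (\<lambda>(a, b). Y ((xs @ [m]) ! a) b)"
  have del: "mat_delete ?A k k = mat k k (\<lambda>(a, b). Y (xs ! a) b)"
    unfolding mat_delete_def using assms(1) by (intro eq_matI) (auto simp: nth_append)
  have "det ?A = (\<Sum>b<Suc k. ?A $$ (k, b) * cofactor ?A k b)"
    by (rule laplace_expansion_row) auto
  also have "\<dots> = (\<Sum>b<Suc k. if b = k then Y m k * cofactor ?A k k else 0)"
    using assms by (intro sum.cong) (auto simp: less_Suc_eq)
  finally show ?thesis by (simp add: minor_def cofactor_def del)
qed

lemma minor_expand_column:
  assumes "length us + length vs = k" "\<And>i. i \<in> set us \<union> set vs \<Longrightarrow> Y i k = 0"
  shows "minor (Suc k) Y (us @ m # vs) = (-1) ^ (length us + k) * Y m k * minor k Y (us @ vs)"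
proof -
  let ?A = "mat (Suc k) (Suc k) (\<lambda>(a, b). Y ((us @ m # vs) ! a) b)"
  let ?u = "length us"
  have del: "mat_delete ?A ?u k = mat k k (\<lambda>(a, b). Y ((us @ vs) ! a) b)"
    unfolding mat_delete_def using assms(1)
    by (intro eq_matI) (auto simp: nth_append nth_Cons' Suc_diff_le)
  have nz: "Y ((us @ m # vs) ! a) k = 0" if "a < Suc k" "a \<noteq> ?u" for a
    using that assms by (auto simp: nth_append nth_Cons')
  have "det ?A = (\<Sum>a<Suc k. ?A $$ (a, k) * cofactor ?A a k)"
    by (rule laplace_expansion_column) auto
  also have "\<dots> = (\<Sum>a<Suc k. if a = ?u then Y m k * cofactor ?A ?u k else 0)"
    using nz by (intro sum.cong refl) auto
  also have "\<dots> = Y m k * cofactor ?A ?u k" using assms(1) by simp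
  finally show ?thesis by (simp add: minor_def cofactor_def del)
qed

text \<open>No element of \<open>I\<close> lies strictly between neighbours, so the two counts
  agree.\<close>

lemma exchange_inv_adjacent:
  assumes "x \<in> I" "y \<notin> I" "y = Suc x \<or> x = Suc y"
  shows "even (exchange_inv I x y)"
proof -
  have "{s \<in> I - {x}. s < x} = {s \<in> I - {x}. s < y}" using assms by (auto simp: less_Suc_eq)
  then show ?thesis by (simp add: exchange_inv_def)
qed

text \<open>The k - 1 remaining elements all lie strictly between 0 and n - 1, so one count is k - 1
  and the other is 0. This is the source of the sign in \<open>cyclic_entry\<close>.\<close>

lemma exchange_inv_wrap:
  assumes "I \<in> ksets n k" "x \<in> I" "y \<notin> I" "{x, y} = {0, n - 1}"
  shows "exchange_inv I x y = k - 1"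
proof -
  have I: "finite I" "I \<subseteq> {..<n}" "card I = k" using assms finite_subset unfolding ksets_def by auto
  consider "x = 0" "y = n - 1" | "x = n - 1" "y = 0" using assms(4) by (auto simp: doubleton_eq_iff)
  then show ?thesis
  proof cases
    case 1
    have "s < n - 1" if "s \<in> I" for s
    proof -
      have "s < n" "s \<noteq> n - 1" using that I assms(3) 1 by auto
      then show ?thesis by simp
    qed
    then have "{s \<in> I - {x}. s < y} = I - {x}" using 1 by auto
    then show ?thesis using 1 I assms by (simp add: exchange_inv_def)
  next
    case 2
    have "s < n - 1" if "s \<in> I - {x}" for s
    proof -
      have "s < n" "s \<noteq> n - 1" using that I 2 by auto
      then show ?thesis by simp
    qed
    then have "{s \<in> I - {x}. s < x} = I - {x}" using 2 by auto
    then show ?thesis using 2 I assms by (simp add: exchange_inv_def)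
  qed
qed

text \<open>Adjacency matrix of a path. It couples only neighbouring rows, whose exchanges carry no
  sign, so its exponential acts positively on the minors of every size at once.\<close>

definition path_adj :: "nat \<Rightarrow> nat \<Rightarrow> real" where
  "path_adj i j = (if j = Suc i \<or> i = Suc j then 1 else 0)"

definition path_mat :: "nat \<Rightarrow> complex mat" where
  "path_mat n = mat n n (\<lambda>(i, j). complex_of_real (path_adj i j))"

lemma path_mat_carrier [simp]: "path_mat n \<in> carrier_mat n n"
  by (simp add: path_mat_def)

lemma path_exp_positive:
  assumes G: "G \<in> carrier_mat n n"
    and init: "\<And>I. I \<in> ksets n k \<Longrightarrow> 0 \<le> c * pluecker k (\<lambda>i j. G $$ (i, j)) I"
    and ex: "\<exists>I\<in>ksets n k. c * pluecker k (\<lambda>i j. G $$ (i, j)) I \<noteq> 0"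
    and "k \<le> n" and I: "I \<in> ksets n k" and "0 < t"
  shows "0 < c * pluecker k (\<lambda>i j. (mat_exp n (path_mat n) t * G) $$ (i, j)) I"
proof (rule pluecker_positive[where Y = "\<lambda>t i j. (mat_exp n (path_mat n) t * G) $$ (i, j)"
      and b = path_adj and \<sigma> = id and n = n])
  show "((\<lambda>s. (mat_exp n (path_mat n) s * G) $$ (i, j)) has_vector_derivative
    (\<Sum>l<n. complex_of_real (path_adj i l) * (mat_exp n (path_mat n) t * G) $$ (l, j))) (at t)"
    if "i < n" "j < k" for i j t
    using mat_exp_column_derivative[OF path_mat_carrier G, of i j t] that \<open>k \<le> n\<close>
    by (simp add: path_mat_def)
  show "0 \<le> (-1) ^ exchange_inv I x y * path_adj x y" if "x \<in> I" "y \<notin> I" for I x y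
    using exchange_inv_adjacent[OF that] by (auto simp: path_adj_def)
qed (use assms in \<open>auto simp: path_adj_def mat_exp_zero\<close>)

section \<open>Column spans and normal forms of positive subspaces\<close>

lemma complex_pos_iff: "0 < z \<longleftrightarrow> (\<exists>r>0. z = complex_of_real r)"
  by (auto simp: less_complex_def complex_eq_iff)

lemma obtain_inverse:
  assumes A: "A \<in> carrier_mat n n" and "det A \<noteq> (0 :: complex)"
  obtains V where "V \<in> carrier_mat n n" "A * V = 1\<^sub>m n" "V * A = 1\<^sub>m n"
  using det_non_zero_imp_unit[OF assms, of "()"] unfolding Units_def ring_mat_def by auto

text \<open>A one-sided containment; equality of spans, where it matters, comes from comparing
  traces in \<open>projection_eq_flag_proj\<close>.\<close>

definition col_span :: "nat \<Rightarrow> nat \<Rightarrow> (nat \<Rightarrow> nat \<Rightarrow> complex) \<Rightarrow> (nat \<Rightarrow> nat \<Rightarrow> complex) \<Rightarrow> bool" where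
  "col_span n k Y Z \<longleftrightarrow> (\<exists>C. \<forall>i<n. \<forall>b<k. Z i b = (\<Sum>a<k. Y i a * C a b))"

lemma col_span_trans:
  assumes "col_span n k X Y" "col_span n k Y Z"
  shows "col_span n k X Z"
proof -
  obtain C D where C: "\<And>i b. i < n \<Longrightarrow> b < k \<Longrightarrow> Y i b = (\<Sum>a<k. X i a * C a b)"
    and D: "\<And>i b. i < n \<Longrightarrow> b < k \<Longrightarrow> Z i b = (\<Sum>a<k. Y i a * D a b)"
    using assms unfolding col_span_def by blast
  have "Z i b = (\<Sum>a<k. X i a * (\<Sum>c<k. C a c * D c b))" if "i < n" "b < k" for i b
  proof -
    have "Z i b = (\<Sum>c<k. \<Sum>a<k. X i a * C a c * D c b)"
      using that by (simp add: D C sum_distrib_right)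
    also have "\<dots> = (\<Sum>a<k. \<Sum>c<k. X i a * C a c * D c b)" by (rule sum.swap)
    finally show ?thesis by (simp add: sum_distrib_left mult.assoc)
  qed
  then show ?thesis unfolding col_span_def
    by (intro exI[of _ "\<lambda>a b. \<Sum>c<k. C a c * D c b"]) auto
qed

lemma col_span_mult_left:
  assumes "col_span n k Y Z"
  shows "col_span n k (\<lambda>i b. \<Sum>l<n. E i l * Y l b) (\<lambda>i b. \<Sum>l<n. E i l * Z l b)"
proof -
  obtain C where C: "\<And>i b. i < n \<Longrightarrow> b < k \<Longrightarrow> Z i b = (\<Sum>a<k. Y i a * C a b)"
    using assms unfolding col_span_def by blast
  have "(\<Sum>l<n. E i l * Z l b) = (\<Sum>a<k. (\<Sum>l<n. E i l * Y l a) * C a b)" if "b < k" for i b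
  proof -
    have "(\<Sum>l<n. E i l * Z l b) = (\<Sum>l<n. \<Sum>a<k. E i l * Y l a * C a b)"
      using that by (simp add: C sum_distrib_left mult.assoc)
    also have "\<dots> = (\<Sum>a<k. \<Sum>l<n. E i l * Y l a * C a b)" by (rule sum.swap)
    finally show ?thesis by (simp add: sum_distrib_right)
  qed
  then show ?thesis unfolding col_span_def by (intro exI[of _ C]) auto
qed

lemma bottom_in_ksets: "k \<le> n \<Longrightarrow> {n - k..<n} \<in> ksets n k"
  by (auto simp: ksets_def)

text \<open>Multiplying by the inverse of the bottom block makes the last k rows the identity. The
  bottom coordinate becomes 1, so the unknown factor \<open>c\<close> cancels and the coordinates
  become positive themselves.\<close>

lemma normalize_bottom:
  assumes "k \<le> n" and pos: "\<And>I. I \<in> ksets n k \<Longrightarrow> 0 < c * pluecker k Y I"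
  obtains Z where "col_span n k Y Z" "\<And>I. I \<in> ksets n k \<Longrightarrow> 0 < pluecker k Z I"
    "\<And>a b. a < k \<Longrightarrow> b < k \<Longrightarrow> Z (n - k + a) b = (if a = b then 1 else 0)"
    "\<And>i b. i < n \<Longrightarrow> b < k \<Longrightarrow> Z i b \<in> \<real>"
proof -
  let ?J = "{n - k..<n}"
  have J: "?J \<in> ksets n k" by (rule bottom_in_ksets[OF \<open>k \<le> n\<close>])
  define W where "W = mat k k (\<lambda>(a, b). Y (n - k + a) b)"
  have W: "W \<in> carrier_mat k k" by (simp add: W_def)
  have detW: "det W = pluecker k Y ?J"
    unfolding W_def pluecker_def minor_def using \<open>k \<le> n\<close>
    by (intro arg_cong[of _ _ det] cong_mat) auto
  have "det W \<noteq> 0" using pos[OF J] detW by auto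
  then obtain V where V: "V \<in> carrier_mat k k" "W * V = 1\<^sub>m k" using obtain_inverse[OF W] by blast
  define Z where "Z i b = (\<Sum>a<k. Y i a * V $$ (a, b))" for i b
  have dV: "det W * det V = 1" using det_mult[OF W V(1)] V(2) by simp
  have V_eq: "mat k k (\<lambda>(c, b). V $$ (c, b)) = V" using V(1) by (intro eq_matI) auto
  have posZ: "0 < pluecker k Z I" if I: "I \<in> ksets n k" for I
  proof -
    have "pluecker k Z I = pluecker k Y I * det V"
      using pluecker_mult[OF I, of Z Y "\<lambda>c b. V $$ (c, b)"] V_eq by (simp add: Z_def)
    moreover have c: "c \<noteq> 0" using pos[OF J] by auto
    have dV': "det V = 1 / det W" using dV \<open>det W \<noteq> 0\<close> by (simp add: field_simps)
    have "pluecker k Y I * det V = (c * pluecker k Y I) / (c * det W)"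
      unfolding dV' using c \<open>det W \<noteq> 0\<close> by simp
    moreover obtain x y where "c * pluecker k Y I = complex_of_real x" "0 < x"
        "c * det W = complex_of_real y" "0 < y"
      using pos[OF I] pos[OF J] unfolding detW complex_pos_iff by blast
    ultimately show ?thesis unfolding complex_pos_iff by (intro exI[of _ "x / y"]) simp
  qed
  have bottom: "Z (n - k + a) b = (if a = b then 1 else 0)" if ab: "a < k" "b < k" for a b
  proof -
    have "(W * V) $$ (a, b) = (if a = b then 1 else 0)" using V ab by simp
    then show ?thesis using ab W V by (simp add: Z_def W_def scalar_prod_def atLeast0LessThan)
  qed
  \<comment> \<open>Entries in the identity block are 0 or 1. Any other entry is, up to sign, a
    Pluecker coordinate: replace row b of the identity block by row i.\<close>
  have "Z i b \<in> \<real>" if i: "i < n" and b: "b < k" for i b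
  proof (cases "i \<in> ?J")
    case True
    then obtain a where "a < k" "i = n - k + a" by (intro that[of "i - (n - k)"]) auto
    then show ?thesis using bottom b by auto
  next
    case False
    let ?xs = "[n - k..<n]"
    let ?A = "mat k k (\<lambda>(a, c). Z (?xs[b := i] ! a) c)"
    have nth: "?xs ! a = n - k + a" if "a < k" for a using that \<open>k \<le> n\<close> by simp
    have xsb: "?xs[b := i] ! a = (if a = b then i else n - k + a)" if "a < k" for a
      using that b nth \<open>k \<le> n\<close> by (simp add: nth_list_update)
    have del: "mat_delete ?A b b = 1\<^sub>m (k - 1)"
      unfolding mat_delete_def using b
      by (intro eq_matI) (auto simp: xsb nth bottom Suc_leI less_diff_conv simp del: nth_list_update)
    have "det ?A = (\<Sum>a<k. ?A $$ (a, b) * cofactor ?A a b)"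
      by (rule laplace_expansion_column) (use b in auto)
    also have "\<dots> = (\<Sum>a<k. if a = b then Z i b * cofactor ?A b b else 0)"
      using b by (intro sum.cong refl) (auto simp: xsb bottom)
    also have "\<dots> = Z i b" using b by (simp add: cofactor_def del)
    finally have "minor k Z (?xs[b := i]) = Z i b" by (simp add: minor_def)
    moreover have "minor k Z (?xs[b := i]) =
        (-1) ^ exchange_inv ?J (?xs ! b) i * pluecker k Z (insert i (?J - {?xs ! b}))"
      using minor_exchange[OF J b False, of Z] by simp
    moreover have "insert i (?J - {?xs ! b}) \<in> ksets n k"
      by (rule ksets_exchange[OF J _ i False]) (use b \<open>k \<le> n\<close> nth in auto)
    note posZ[OF this]
    then have "pluecker k Z (insert i (?J - {?xs ! b})) \<in> \<real>"
      by (simp add: less_complex_def complex_is_Real_iff)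
    ultimately show ?thesis by (metis Reals_mult Reals_power Reals_minus Reals_1)
  qed
  moreover have "col_span n k Y Z"
    unfolding col_span_def Z_def by (intro exI[of _ "\<lambda>a b. V $$ (a, b)"]) auto
  ultimately show thesis using posZ bottom that by blast
qed

lemma pow_mat_real:
  assumes "B \<in> carrier_mat n n" "\<And>i j. i < n \<Longrightarrow> j < n \<Longrightarrow> B $$ (i, j) \<in> \<real>" "i < n" "j < n"
  shows "(B ^\<^sub>m m) $$ (i, j) \<in> (\<real> :: complex set)"
  using assms(3,4)
proof (induction m arbitrary: i j)
  case (Suc m)
  have "(B ^\<^sub>m Suc m) $$ (i, j) = (\<Sum>l<n. (B ^\<^sub>m m) $$ (i, l) * B $$ (l, j))"
    using Suc.prems assms(1) by (simp add: scalar_prod_def atLeast0LessThan)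
  then show ?case using Suc assms(2) by (auto intro!: sum_in_Reals Reals_mult)
qed (use assms in auto)

lemma mat_exp_real:
  assumes "B \<in> carrier_mat n n" "\<And>i j. i < n \<Longrightarrow> j < n \<Longrightarrow> B $$ (i, j) \<in> \<real>" "i < n" "j < n"
  shows "mat_exp n B t $$ (i, j) \<in> \<real>"
proof -
  let ?f = "\<lambda>m. (B ^\<^sub>m m) $$ (i, j) / fact m * complex_of_real t ^ m"
  have Im0: "Im (?f m) = 0" for m
  proof -
    have "complex_of_real (fact m) = fact m" by simp
    then have "?f m \<in> \<real>"
      using pow_mat_real[OF assms, of m] by (metis Reals_mult Reals_divide Reals_of_real Reals_power)
    then show ?thesis by (simp add: complex_is_Real_iff)
  qed
  have "Im (\<Sum>m. ?f m) = (\<Sum>m. Im (?f m))"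
    by (rule bounded_linear.suminf[OF bounded_linear_Im mat_exp_series_summable[OF assms(1,3,4)]])
  also have "\<dots> = 0" unfolding Im0 by simp
  finally show ?thesis using assms(3,4) by (simp add: mat_exp_def complex_is_Real_iff)
qed

lemma minor_real:
  assumes "\<And>a b. a < k \<Longrightarrow> b < k \<Longrightarrow> Y (xs ! a) b \<in> \<real>"
  shows "minor k Y xs \<in> \<real>"
  unfolding minor_leibniz
proof (intro sum_in_Reals Reals_mult prod_in_Reals)
  fix p a assume "p \<in> {p. p permutes {0..<k}}" "a \<in> {0..<k}"
  then have "p a < k" using permutes_in_image by fastforce
  then show "Y (xs ! a) (p a) \<in> \<real>" using assms \<open>a \<in> {0..<k}\<close> by simp
qed (auto simp: sign_def)

lemma pluecker_real:
  assumes "I \<in> ksets n k" "\<And>i b. i < n \<Longrightarrow> b < k \<Longrightarrow> Y i b \<in> \<real>"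
  shows "pluecker k Y I \<in> \<real>"
proof -
  have "finite I" "card I = k" "I \<subseteq> {..<n}"
    using assms(1) finite_subset unfolding ksets_def by auto
  then have "sorted_list_of_set I ! a < n" if "a < k" for a
    using that nth_mem[of a "sorted_list_of_set I"] by auto
  then show ?thesis unfolding pluecker_def using assms(2) by (intro minor_real) auto
qed

lemma mult_columns_index:
  assumes "E \<in> carrier_mat n n" "k \<le> n" "i < n" "b < k"
  shows "(E * mat n n (\<lambda>(i, b). Y i b)) $$ (i, b) = (\<Sum>l<n. E $$ (i, l) * Y l b)"
  using assms by (simp add: scalar_prod_def atLeast0LessThan)

text \<open>Positivity of finitely many coordinates is an open condition and survives a short time
  backwards. Continuity controls only real parts; reality of \<open>Y\<close> and of the exponential
  excludes imaginary parts.\<close>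

lemma positive_backwards:
  assumes "k \<le> n" and pos: "\<And>I. I \<in> ksets n k \<Longrightarrow> 0 < pluecker k Y I"
    and real: "\<And>i b. i < n \<Longrightarrow> b < k \<Longrightarrow> Y i b \<in> \<real>"
  obtains s where "0 < s" "\<And>I. I \<in> ksets n k \<Longrightarrow>
    0 < pluecker k (\<lambda>i b. \<Sum>l<n. mat_exp n (- path_mat n) s $$ (i, l) * Y l b) I"
proof -
  let ?B = "- path_mat n" and ?G = "mat n n (\<lambda>(i, b). Y i b)"
  define P where "P s i b = (\<Sum>l<n. mat_exp n ?B s $$ (i, l) * Y l b)" for s i b
  have B: "?B \<in> carrier_mat n n" by simp
  have P: "(mat_exp n ?B s * ?G) $$ (i, b) = P s i b" if "i < n" "b < k" for s i b
    unfolding P_def using that \<open>k \<le> n\<close> by (intro mult_columns_index) auto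
  have P0: "P 0 i b = Y i b" if "i < n" "b < k" for i b
    using P[OF that, of 0] that \<open>k \<le> n\<close> by (simp add: mat_exp_zero[OF B])
  have "\<forall>\<^sub>F s in at 0. 0 < Re (pluecker k (P s) I)" if I: "I \<in> ksets n k" for I
  proof -
    have "((\<lambda>s. P s i b) has_vector_derivative (\<Sum>l<n. ?B $$ (i, l) * P 0 l b)) (at 0)"
      if "i < n" "b < k" for i b
      using mat_exp_column_derivative[OF B, of ?G i b 0] that \<open>k \<le> n\<close> by (simp add: P del: index_mult_mat(1))
    then have "((\<lambda>s. pluecker k (P s) I) has_vector_derivative
        (\<Sum>x\<in>I. ?B $$ (x, x)) * pluecker k (P 0) I + (\<Sum>(x, y)\<in>I \<times> ({..<n} - I).
         (-1) ^ exchange_inv I x y * ?B $$ (x, y) * pluecker k (P 0) (insert y (I - {x})))) (at 0)"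
      using pluecker_has_vector_derivative[OF _ I, of P "\<lambda>i j. ?B $$ (i, j)" 0] by blast
    then have "isCont (\<lambda>s. pluecker k (P s) I) 0" by (rule has_vector_derivative_continuous)
    then have "((\<lambda>s. Re (pluecker k (P s) I)) \<longlongrightarrow> Re (pluecker k (P 0) I)) (at 0)"
      by (intro tendsto_Re) (simp add: isCont_def)
    moreover have "pluecker k (P 0) I = pluecker k Y I" by (rule pluecker_cong[OF I P0])
    ultimately show ?thesis
      using pos[OF I] by (intro order_tendstoD(1)[of _ "Re (pluecker k (P 0) I)"]) (auto simp: less_complex_def)
  qed
  then have "\<forall>\<^sub>F s in at 0. \<forall>I\<in>ksets n k. 0 < Re (pluecker k (P s) I)"
    by (intro eventually_ball_finite) auto
  then obtain d where d: "0 < d" "\<And>s. s \<noteq> 0 \<Longrightarrow> dist s 0 < d \<Longrightarrow> \<forall>I\<in>ksets n k. 0 < Re (pluecker k (P s) I)"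
    unfolding eventually_at by auto
  have real': "P (d/2) i b \<in> \<real>" if "i < n" "b < k" for i b
    unfolding P_def using that real
    by (intro sum_in_Reals Reals_mult mat_exp_real) (auto simp: path_mat_def)
  show thesis
  proof (rule that[of "d/2"])
    fix I assume I: "I \<in> ksets n k"
    have "0 < Re (pluecker k (P (d/2)) I)" using d(2)[of "d/2"] d(1) I by auto
    moreover have "pluecker k (P (d/2)) I \<in> \<real>" by (rule pluecker_real[OF I real'])
    moreover have "P (d/2) = (\<lambda>i b. \<Sum>l<n. mat_exp n (- path_mat n) (d/2) $$ (i, l) * Y l b)"
      by (intro ext) (rule P_def)
    ultimately show "0 < pluecker k (\<lambda>i b. \<Sum>l<n. mat_exp n (- path_mat n) (d/2) $$ (i, l) * Y l b) I"
      by (simp add: less_complex_def complex_is_Real_iff)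
  qed (use d in simp)
qed

text \<open>Intersecting a totally positive subspace, whose last rows form the identity matrix, with the
  coordinate subspaces where the last coordinates vanish gives a partial flag below it.\<close>
lemma lower_flag_minors:
  assumes "k \<le> n" and pos: "\<And>I. I \<in> ksets n k \<Longrightarrow> 0 < pluecker k Z I"
    and bottom: "\<And>a b. a < k \<Longrightarrow> b < k \<Longrightarrow> Z (n - k + a) b = (if a = b then 1 else 0)"
    and "j \<le> k" and "I \<in> ksets n j"
  shows "(if I \<subseteq> {..<n - k + j} then 0 < pluecker j Z I else pluecker j Z I = 0)"
  using \<open>j \<le> k\<close> \<open>I \<in> ksets n j\<close>
proof (induction arbitrary: I rule: inc_induct)
  case base
  then show ?case using pos \<open>k \<le> n\<close> by (auto simp: ksets_def)
next
  case (step j)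
  have I: "finite I" "card I = j" "I \<subseteq> {..<n}"
    using step.prems finite_subset unfolding ksets_def by auto
  let ?m = "n - k + j"
  show ?case
  proof (cases "I \<subseteq> {..<?m}")
    case True
    have "?m < n" using step.hyps \<open>k \<le> n\<close> by simp
    \<comment> \<open>Row \<open>?m\<close> of \<open>Z\<close> is the unit vector with its 1 in
      column j. Appended to \<open>I\<close>, it turns the j-minor into a (j + 1)-minor of the same
      value.\<close>
    have "sorted_list_of_set (insert ?m I) = sorted_list_of_set I @ [?m]"
    proof -
      have "sorted_wrt (<) (sorted_list_of_set I @ [?m])"
        using True I strict_sorted_list_of_set[of I] by (auto simp: sorted_wrt_append)
      moreover have "set (sorted_list_of_set I @ [?m]) = insert ?m I" using I by auto
      ultimately show ?thesis by (metis sorted_list_of_set.idem_if_sorted_distinct strict_sorted_iff)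
    qed
    moreover have "minor (Suc j) Z (sorted_list_of_set I @ [?m]) = Z ?m j * minor j Z (sorted_list_of_set I)"
      using bottom[of j] step.hyps I by (intro minor_expand_row) auto
    ultimately have "pluecker (Suc j) Z (insert ?m I) = pluecker j Z I"
      using bottom[of j j] step.hyps by (simp add: pluecker_def)
    moreover have "insert ?m I \<in> ksets n (Suc j)"
      using I True \<open>?m < n\<close> by (subst ksets_def) (auto simp: card_insert_if)
    note step.IH[OF this]
    moreover have "insert ?m I \<subseteq> {..<n - k + Suc j}" using True by auto
    ultimately show ?thesis using True by simp
  next
    case False
    \<comment> \<open>A row at or beyond \<open>?m\<close> is a unit vector whose 1 lies in column j
      or later, so its first j entries vanish.\<close>
    then obtain i where i: "i \<in> I" "?m \<le> i" by (meson lessThan_iff not_less subsetI)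
    then obtain a where a: "a < j" "sorted_list_of_set I ! a = i"
      using I by (metis in_set_conv_nth length_sorted_list_of_set set_sorted_list_of_set)
    have "i = n - k + (i - (n - k))" "i - (n - k) < k" using i I by auto
    then have "Z i b = (if i - (n - k) = b then 1 else 0)" if "b < k" for b
      using bottom[of "i - (n - k)" b] that by simp
    then have "Z i b = 0" if "b < j" for b using that i step.hyps by auto
    then have "pluecker j Z I = 0" unfolding pluecker_def using a by (intro minor_zero_row[of a]) auto
    then show ?thesis using False by simp
  qed
qed

text \<open>Above \<open>k\<close>, the flag is continued by the last basis vectors \<open>e\<^sub>n, e\<^sub>n\<^sub>-\<^sub>1, \<dots>\<close>; the signs make the
  left-justified minors nonnegative.\<close>
definition upper_flag :: "nat \<Rightarrow> nat \<Rightarrow> (nat \<Rightarrow> nat \<Rightarrow> complex) \<Rightarrow> nat \<Rightarrow> nat \<Rightarrow> complex" where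
  "upper_flag n k Z i l =
    (if l < k then Z i l else if i + l = n + k - 1 then (-1) ^ (k + l) else 0)"

lemma upper_flag_minors:
  assumes "k \<le> n" and pos: "\<And>I. I \<in> ksets n k \<Longrightarrow> 0 < pluecker k Z I"
    and "k + r \<le> n" and "I \<in> ksets n (k + r)"
  shows "(if {n - r..<n} \<subseteq> I then 0 < pluecker (k + r) (upper_flag n k Z) I
    else pluecker (k + r) (upper_flag n k Z) I = 0)"
  using \<open>k + r \<le> n\<close> \<open>I \<in> ksets n (k + r)\<close>
proof (induction r arbitrary: I)
  case 0
  have "pluecker k (upper_flag n k Z) I = pluecker k Z I"
    by (rule pluecker_cong[of I n]) (use 0 in \<open>auto simp: upper_flag_def\<close>)
  then show ?case using pos 0 by simp
next
  case (Suc r)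
  let ?c = "k + r" and ?m = "n - Suc r" and ?G = "upper_flag n k Z"
  have I: "finite I" "card I = Suc ?c" "I \<subseteq> {..<n}"
    using Suc.prems finite_subset unfolding ksets_def by auto
  have last: "?G i ?c = (if i = ?m then (-1) ^ (k + ?c) else 0)" if "i < n" for i
    using that Suc.prems by (auto simp: upper_flag_def)
  have "{n - Suc r..<n} = insert ?m {n - r..<n}" using Suc.prems by auto
  show ?case
  proof (cases "?m \<in> I")
    case True
    then have "?m \<in> set (sorted_list_of_set I)" using I by simp
    then obtain us vs where e: "sorted_list_of_set I = us @ ?m # vs" by (meson split_list)
    note sp = sorted_list_of_set_split[OF I(1) e]
    have len: "length us + length vs = ?c" using arg_cong[OF e, of length] I by simp
    have "set (us @ vs) = I - {?m}" using arg_cong[OF sp(1), of set] I by simp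
    then have "?G i ?c = 0" if "i \<in> set us \<union> set vs" for i using that last I by auto
    then have "minor (Suc ?c) ?G (us @ ?m # vs) =
        (-1) ^ (length us + ?c) * ?G ?m ?c * minor ?c ?G (us @ vs)"
      by (intro minor_expand_column len)
    then have "pluecker (Suc ?c) ?G I =
        (-1) ^ (length us + ?c) * ?G ?m ?c * pluecker ?c ?G (I - {?m})"
      by (simp add: pluecker_def e sp(1))
    also have "?G ?m ?c = (-1) ^ (k + ?c)" using last[of ?m] Suc.prems by simp
    finally have p: "pluecker (Suc ?c) ?G I =
        (-1) ^ (length us + ?c) * (-1) ^ (k + ?c) * pluecker ?c ?G (I - {?m})" .
    have "I - {?m} \<in> ksets n ?c" using I True by (auto simp: ksets_def)
    note IH = Suc.IH[OF _ this]
    show ?thesis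
    proof (cases "{n - Suc r..<n} \<subseteq> I")
      case sub: True
      \<comment> \<open>All rows from \<open>?m\<close> on belong to \<open>I\<close>, so exactly k
        rows precede \<open>?m\<close>. The cofactor sign is then (-1)^(k + ?c), the sign put into
        \<open>upper_flag\<close>, and the two cancel.\<close>
      have "{s \<in> I - {?m}. s < ?m} = I - {n - Suc r..<n}" using I by auto
      then have "length us = k" using sp(2) I sub Suc.prems by (simp add: card_Diff_subset)
      moreover have "{n - r..<n} \<subseteq> I - {?m}"
        using sub Suc.prems \<open>{n - Suc r..<n} = insert ?m {n - r..<n}\<close> by auto
      ultimately show ?thesis using IH p sub Suc.prems
        by (simp add: power_add[symmetric] mult.assoc[symmetric])
    next
      case sub: False
      then have "\<not> {n - r..<n} \<subseteq> I - {?m}"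
        using True \<open>{n - Suc r..<n} = insert ?m {n - r..<n}\<close> by auto
      then show ?thesis using IH p sub Suc.prems by simp
    qed
  next
    case False
    then have sub: "\<not> {n - Suc r..<n} \<subseteq> I"
      using \<open>{n - Suc r..<n} = insert ?m {n - r..<n}\<close> by blast
    have "pluecker (Suc ?c) ?G I = 0"
    proof (cases "sorted_list_of_set I")
      case Nil
      then show ?thesis using I by (metis Suc_not_Zero length_0_conv length_sorted_list_of_set)
    next
      case (Cons x vs)
      have set: "set (x # vs) = I" using Cons I by (metis set_sorted_list_of_set)
      have "length vs = ?c" using arg_cong[OF Cons, of length] I by simp
      have zero: "?G i ?c = 0" if "i \<in> I" for i using that last I False by auto
      have "minor (Suc ?c) ?G ([] @ x # vs) = (-1) ^ (length ([] :: nat list) + ?c) * ?G x ?c * minor ?c ?G ([] @ vs)"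
        by (rule minor_expand_column) (use \<open>length vs = ?c\<close> set zero in auto)
      then show ?thesis using zero[of x] set by (auto simp: pluecker_def Cons)
    qed
    then show ?thesis using sub by simp
  qed
qed

text \<open>Nonnegative and not all zero is the input that \<open>path_exp_positive\<close> turns
  into strict positivity. A nonzero minor sits in the first j rows if j \<le> k and in the last j
  rows otherwise.\<close>

lemma flag_minors_nonneg:
  assumes "k \<le> n" and pos: "\<And>I. I \<in> ksets n k \<Longrightarrow> 0 < pluecker k Z I"
    and bottom: "\<And>a b. a < k \<Longrightarrow> b < k \<Longrightarrow> Z (n - k + a) b = (if a = b then 1 else 0)"
    and "j \<le> n"
  shows "\<And>I. I \<in> ksets n j \<Longrightarrow> 0 \<le> pluecker j (upper_flag n k Z) I"
    and "\<exists>I\<in>ksets n j. pluecker j (upper_flag n k Z) I \<noteq> 0"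
proof -
  have "(\<forall>I\<in>ksets n j. 0 \<le> pluecker j (upper_flag n k Z) I) \<and>
    (\<exists>I\<in>ksets n j. pluecker j (upper_flag n k Z) I \<noteq> 0)"
  proof (cases "j \<le> k")
    case True
    have l: "if I \<subseteq> {..<n - k + j} then 0 < pluecker j Z I else pluecker j Z I = 0"
      if "I \<in> ksets n j" for I
      by (rule lower_flag_minors[OF \<open>k \<le> n\<close> _ _ True that]) (use pos bottom in auto)
    have e: "pluecker j (upper_flag n k Z) I = pluecker j Z I" if "I \<in> ksets n j" for I
      by (rule pluecker_cong[OF that]) (use True in \<open>auto simp: upper_flag_def\<close>)
    have J: "{..<j} \<in> ksets n j" using \<open>j \<le> n\<close> by (auto simp: ksets_def)
    have "0 < pluecker j Z {..<j}" using l[OF J] by auto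
    moreover have "0 \<le> pluecker j Z I" if "I \<in> ksets n j" for I
      using l[OF that] by (auto split: if_splits)
    ultimately show ?thesis using e J by (auto intro!: bexI[of _ "{..<j}"])
  next
    case False
    then obtain r where r: "j = k + r" by (metis le_add_diff_inverse nat_le_linear)
    have u: "if {n - r..<n} \<subseteq> I then 0 < pluecker (k + r) (upper_flag n k Z) I
        else pluecker (k + r) (upper_flag n k Z) I = 0" if "I \<in> ksets n (k + r)" for I
      by (rule upper_flag_minors[OF \<open>k \<le> n\<close> pos \<open>j \<le> n\<close>[unfolded r] that])
    have J: "{n - j..<n} \<in> ksets n j" by (rule bottom_in_ksets[OF \<open>j \<le> n\<close>])
    have "0 < pluecker j (upper_flag n k Z) {n - j..<n}"
      using u[OF J[unfolded r]] by (auto simp: r split: if_splits)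
    moreover have "0 \<le> pluecker j (upper_flag n k Z) I" if "I \<in> ksets n j" for I
      using u[of I] that by (auto simp: r split: if_splits)
    ultimately show ?thesis using J by (auto intro!: bexI[of _ "{n - j..<n}"])
  qed
  then show "\<And>I. I \<in> ksets n j \<Longrightarrow> 0 \<le> pluecker j (upper_flag n k Z) I"
    "\<exists>I\<in>ksets n j. pluecker j (upper_flag n k Z) I \<noteq> 0" by auto
qed

text \<open>Push the subspace backwards a little along the totally positive semigroup
  \<open>mat_exp n (path_mat n)\<close>, choose a nonnegative flag there, and push the flag forwards again.\<close>
theorem positive_subspace_extends_to_flag:
  assumes "k \<le> n" and pos: "\<And>I. I \<in> ksets n k \<Longrightarrow> 0 < c * pluecker k Y I"
  obtains g where "g \<in> unitary_pos n" "col_span n k Y (\<lambda>i b. g $$ (i, b))"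
proof -
  let ?A = "path_mat n"
  obtain Y1 where Y1: "col_span n k Y Y1" "\<And>I. I \<in> ksets n k \<Longrightarrow> 0 < pluecker k Y1 I"
      "\<And>i b. i < n \<Longrightarrow> b < k \<Longrightarrow> Y1 i b \<in> \<real>"
    using normalize_bottom[OF \<open>k \<le> n\<close> pos] by metis
  from positive_backwards[OF \<open>k \<le> n\<close> Y1(2,3)] obtain s where s: "0 < s" "\<And>I. I \<in> ksets n k \<Longrightarrow>
    0 < pluecker k (\<lambda>i b. \<Sum>l<n. mat_exp n (- ?A) s $$ (i, l) * Y1 l b) I" by blast
  define Y2 where "Y2 i b = (\<Sum>l<n. mat_exp n (- ?A) s $$ (i, l) * Y1 l b)" for i b
  have "Y2 = (\<lambda>i b. \<Sum>l<n. mat_exp n (- ?A) s $$ (i, l) * Y1 l b)" by (intro ext) (rule Y2_def)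
  then have "0 < 1 * pluecker k Y2 I" if "I \<in> ksets n k" for I
    using s(2)[OF that] by simp
  from normalize_bottom[OF \<open>k \<le> n\<close> this] obtain Z where Z: "col_span n k Y2 Z"
      "\<And>I. I \<in> ksets n k \<Longrightarrow> 0 < pluecker k Z I"
      "\<And>a b. a < k \<Longrightarrow> b < k \<Longrightarrow> Z (n - k + a) b = (if a = b then 1 else 0)" by metis
  define G where "G = mat n n (\<lambda>(i, b). upper_flag n k Z i b)"
  have G: "G \<in> carrier_mat n n" by (simp add: G_def)
  define F where "F = mat_exp n ?A s * G"
  have F: "F \<in> carrier_mat n n" unfolding F_def by (rule mult_carrier_mat[OF mat_exp_carrier(1) G])
  have Gp: "pluecker j (\<lambda>i b. G $$ (i, b)) I = pluecker j (upper_flag n k Z) I"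
    if "I \<in> ksets n j" "j \<le> n" for I j
    by (rule pluecker_cong[OF that(1)]) (use that in \<open>auto simp: G_def\<close>)
  have fl: "\<And>I. I \<in> ksets n j \<Longrightarrow> 0 \<le> pluecker j (upper_flag n k Z) I"
    "\<exists>I\<in>ksets n j. pluecker j (upper_flag n k Z) I \<noteq> 0" if "j \<le> n" for j
    using flag_minors_nonneg[where Z = Z, OF \<open>k \<le> n\<close> Z(2) _ that] Z(3) by blast+
  have Fpos: "0 < pluecker j (\<lambda>i b. F $$ (i, b)) I" if "I \<in> ksets n j" "j \<le> n" for I j
    using path_exp_positive[OF G, of j 1 I s] fl[OF \<open>j \<le> n\<close>] that s(1) Gp
    by (auto simp: F_def)
  have "{..<n} \<in> ksets n n" by (simp add: ksets_def)
  then have "0 < pluecker n (\<lambda>i b. F $$ (i, b)) {..<n}" by (rule Fpos) simp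
  moreover have "pluecker n (\<lambda>i b. F $$ (i, b)) {..<n} = det F"
    unfolding pluecker_def minor_def lessThan_atLeast0 sorted_list_of_set_range
    using F by (intro arg_cong[of _ _ det] eq_matI) auto
  ultimately have "det F \<noteq> 0" by auto
  from unitary_factorization[OF F this] obtain g U r where g: "g \<in> unitary_group n"
    "\<And>i b. i < n \<Longrightarrow> b < n \<Longrightarrow> g $$ (i, b) = (\<Sum>l<n. F $$ (i, l) * U l b)"
    "\<And>b l. b < n \<Longrightarrow> b < l \<Longrightarrow> U l b = 0"
    "\<And>b. b < n \<Longrightarrow> U b b = complex_of_real (r b) \<and> 0 < r b" by blast
  \<comment> \<open>Triangularity of \<open>U\<close>: the first j columns of \<open>g\<close>
    involve only the first j columns of \<open>F\<close>, so every left-justified minor of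
    \<open>F\<close> is kept up to a positive factor.\<close>
  have gk: "g $$ (i, b) = (\<Sum>l<j. F $$ (i, l) * U l b)" if "i < n" "b < j" "j \<le> n" for i b j
    unfolding g(2)[OF that(1) less_le_trans[OF that(2,3)]]
    by (rule sum.mono_neutral_right) (use that g(3) in auto)
  have "g \<in> unitary_pos n"
    unfolding unitary_pos_def
  proof (intro CollectI conjI allI impI g(1))
    fix I assume "I \<subseteq> {..<n}"
    define j where "j = card I"
    have I: "I \<in> ksets n j" using \<open>I \<subseteq> {..<n}\<close> by (simp add: j_def ksets_def)
    have j: "j \<le> n" using card_mono[OF _ \<open>I \<subseteq> {..<n}\<close>] by (simp add: j_def)
    have gc: "g \<in> carrier_mat n n" using g(1) by (simp add: unitary_group_def)
    have "det (submatrix g I {..<j}) = pluecker j (\<lambda>i b. F $$ (i, b)) I * det (mat j j (\<lambda>(l, b). U l b))"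
      unfolding det_submatrix_eq_pluecker[OF gc I] by (rule pluecker_mult[OF I]) (use gk j in auto)
    moreover have "0 < det (mat j j (\<lambda>(l, b). U l b))"
      by (rule det_of_real_upper_triangular[of _ _ r]) (use g j in auto)
    ultimately have "0 < det (submatrix g I {..<j})"
      using Fpos[OF I j] by (simp add: less_complex_def)
    then show "det (submatrix g I {..<card I}) \<in> \<real>" "0 < Re (det (submatrix g I {..<card I}))"
      by (auto simp: j_def less_complex_def complex_is_Real_iff)
  qed
  moreover have "col_span n k Y (\<lambda>i b. g $$ (i, b))"
  proof -
    let ?E = "\<lambda>i l. mat_exp n ?A s $$ (i, l)"
    have FZ: "F $$ (i, b) = (\<Sum>l<n. ?E i l * Z l b)" if "i < n" "b < k" for i b
      using that \<open>k \<le> n\<close>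
      by (simp add: F_def G_def scalar_prod_def atLeast0LessThan upper_flag_def)
    \<comment> \<open>Pushing forward for the same time \<open>s\<close> undoes the backward
      push.\<close>
    have Y21: "(\<Sum>l<n. ?E i l * Y2 l b) = Y1 i b" if "i < n" "b < k" for i b
    proof -
      have "mat_exp n ?A s * mat_exp n (- ?A) s = 1\<^sub>m n" by (rule mat_exp_uminus_mult) simp
      then have inv: "(\<Sum>l<n. ?E i l * mat_exp n (- ?A) s $$ (l, p)) = (if i = p then 1 else 0)"
        if "p < n" for p
      proof -
        have "(mat_exp n ?A s * mat_exp n (- ?A) s) $$ (i, p) = 1\<^sub>m n $$ (i, p)"
          by (simp only: \<open>mat_exp n ?A s * mat_exp n (- ?A) s = 1\<^sub>m n\<close>)
        then show ?thesis using that \<open>i < n\<close> by (simp add: scalar_prod_def atLeast0LessThan)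
      qed
      have "(\<Sum>l<n. ?E i l * Y2 l b) = (\<Sum>l<n. \<Sum>p<n. ?E i l * mat_exp n (- ?A) s $$ (l, p) * Y1 p b)"
        by (simp add: Y2_def sum_distrib_left mult.assoc)
      also have "\<dots> = (\<Sum>p<n. \<Sum>l<n. ?E i l * mat_exp n (- ?A) s $$ (l, p) * Y1 p b)"
        by (rule sum.swap)
      also have "\<dots> = (\<Sum>p<n. (if i = p then 1 else 0) * Y1 p b)"
        using inv by (simp add: sum_distrib_right[symmetric])
      also have "\<dots> = Y1 i b" using that by (simp add: if_distrib[of "\<lambda>x. x * _"] cong: if_cong)
      finally show ?thesis .
    qed
    have "col_span n k (\<lambda>i b. \<Sum>l<n. ?E i l * Y2 l b) (\<lambda>i b. \<Sum>l<n. ?E i l * Z l b)"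
      by (rule col_span_mult_left[OF Z(1)])
    then have "col_span n k Y1 (\<lambda>i b. F $$ (i, b))"
      unfolding col_span_def using Y21 FZ by auto
    moreover have "col_span n k (\<lambda>i b. F $$ (i, b)) (\<lambda>i b. g $$ (i, b))"
      unfolding col_span_def using gk \<open>k \<le> n\<close> by auto
    ultimately show ?thesis using Y1(1) col_span_trans by blast
  qed
  ultimately show thesis by (rule that)
qed

section \<open>Metrics and gradients on the orbit\<close>

lemma smult_smult_mat: "a \<cdot>\<^sub>m (b \<cdot>\<^sub>m A) = (a * b :: complex) \<cdot>\<^sub>m A"
  by (rule eq_matI) auto

lemma one_smult_mat: "(1 :: complex) \<cdot>\<^sub>m A = A"
  by (rule eq_matI) auto

lemma mat_adjoint_mult:
  assumes "A \<in> carrier_mat n n" "B \<in> carrier_mat n n"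
  shows "mat_adjoint (A * B :: complex mat) = mat_adjoint B * mat_adjoint A"
proof (rule eq_matI)
  fix i j assume "i < dim_row (mat_adjoint B * mat_adjoint A)" "j < dim_col (mat_adjoint B * mat_adjoint A)"
  then have ij: "i < n" "j < n" using assms by auto
  then have "mat_adjoint (A * B) $$ (i, j) = (\<Sum>l<n. cnj (B $$ (l, i)) * cnj (A $$ (j, l)))"
    using assms by (simp add: scalar_prod_def atLeast0LessThan mult.commute)
  also have "\<dots> = (mat_adjoint B * mat_adjoint A) $$ (i, j)"
    using ij assms mat_adjoint_carrier[OF assms(1)] mat_adjoint_carrier[OF assms(2)]
    by (simp add: scalar_prod_def atLeast0LessThan)
  finally show "mat_adjoint (A * B) $$ (i, j) = (mat_adjoint B * mat_adjoint A) $$ (i, j)" .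
qed (use assms in auto)

lemma mat_adjoint_add:
  assumes "A \<in> carrier_mat n n" "B \<in> carrier_mat n n"
  shows "mat_adjoint (A + B :: complex mat) = mat_adjoint A + mat_adjoint B"
  using assms by (intro eq_matI) auto

lemma mat_adjoint_minus:
  assumes "A \<in> carrier_mat n n" "B \<in> carrier_mat n n"
  shows "mat_adjoint (A - B :: complex mat) = mat_adjoint A - mat_adjoint B"
  using assms by (intro eq_matI) auto

lemma mat_adjoint_smult: "mat_adjoint (c \<cdot>\<^sub>m A) = cnj c \<cdot>\<^sub>m mat_adjoint A"
  by (intro eq_matI) auto

lemma mat_adjoint_uminus: "mat_adjoint (- A :: complex mat) = - mat_adjoint A"
  by (intro eq_matI) auto

lemma mat_adjoint_adjoint: "mat_adjoint (mat_adjoint A) = (A :: complex mat)"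
  by (intro eq_matI) auto

lemma mat_adjoint_one: "mat_adjoint (1\<^sub>m n) = (1\<^sub>m n :: complex mat)"
  by (intro eq_matI) auto

lemma sq_eqI:
  assumes "A \<in> carrier_mat n n" "B \<in> carrier_mat n n"
    "\<And>i j. i < n \<Longrightarrow> j < n \<Longrightarrow> A $$ (i, j) = B $$ (i, j)"
  shows "A = B"
  using assms by (intro eq_matI) auto

text \<open>Energy estimate: with bounded coefficients the sum of squared moduli satisfies the
  hypotheses of \<open>gronwall_zero\<close>. The coefficients may depend on time in an unknown way,
  as they do along a gradient flow.\<close>

lemma linear_ode_zero:
  fixes z :: "'a \<Rightarrow> real \<Rightarrow> complex"
  assumes "finite S"
    and d: "\<And>x t. x \<in> S \<Longrightarrow> 0 \<le> t \<Longrightarrow> (z x has_vector_derivative (\<Sum>y\<in>S. K t x y * z y t)) (at t)"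
    and K: "\<And>x y t. x \<in> S \<Longrightarrow> y \<in> S \<Longrightarrow> 0 \<le> t \<Longrightarrow> cmod (K t x y) \<le> c"
    and z0: "\<And>x. x \<in> S \<Longrightarrow> z x 0 = 0"
    and "x \<in> S" "0 \<le> t"
  shows "z x t = 0"
proof -
  define \<phi> where "\<phi> t = (\<Sum>x\<in>S. (cmod (z x t))\<^sup>2)" for t
  define D where "D x t = (\<Sum>y\<in>S. K t x y * z y t)" for x t
  have m2: "(cmod (z x t))\<^sup>2 \<le> \<phi> t" if "x \<in> S" for x t
    unfolding \<phi>_def by (rule member_le_sum[OF that]) (auto simp: \<open>finite S\<close>)
  have "0 \<le> c" using K[OF \<open>x \<in> S\<close> \<open>x \<in> S\<close> \<open>0 \<le> t\<close>] norm_ge_zero order_trans by blast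
  have "\<phi> t = 0"
  proof (rule gronwall_zero[OF _ _ _ _ \<open>0 \<le> t\<close>])
    fix t :: real assume t: "0 \<le> t"
    have dz: "((\<lambda>s. (cmod (z x s))\<^sup>2) has_real_derivative 2 * Re (cnj (z x t) * D x t)) (at t)" if x: "x \<in> S" for x
    proof -
      have v: "(z x has_vector_derivative D x t) (at t)" unfolding D_def by (rule d[OF x t])
      have "((\<lambda>s. Re (z x s)) has_real_derivative Re (D x t)) (at t)"
        "((\<lambda>s. Im (z x s)) has_real_derivative Im (D x t)) (at t)"
        using bounded_linear.has_vector_derivative[OF bounded_linear_Re v]
          bounded_linear.has_vector_derivative[OF bounded_linear_Im v]
        by (simp_all add: has_real_derivative_iff_has_vector_derivative)
      then have "((\<lambda>s. (Re (z x s))\<^sup>2 + (Im (z x s))\<^sup>2) has_real_derivative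
          2 * Re (z x t) * Re (D x t) + 2 * Im (z x t) * Im (D x t)) (at t)"
        by (intro DERIV_add) (auto dest: DERIV_power[where n = 2] simp: mult_ac)
      then show ?thesis unfolding cmod_power2 by (simp add: algebra_simps)
    qed
    show "(\<phi> has_real_derivative (\<Sum>x\<in>S. 2 * Re (cnj (z x t) * D x t))) (at t)"
      unfolding \<phi>_def by (intro DERIV_sum dz)
    have "2 * Re (cnj (z x t) * D x t) \<le> 2 * real (card S) * c * \<phi> t" if x: "x \<in> S" for x
    proof -
      have "Re (cnj (z x t) * D x t) = (\<Sum>y\<in>S. Re (cnj (z x t) * (K t x y * z y t)))"
        by (simp add: D_def sum_distrib_left del: mult.assoc)
      also have "\<dots> \<le> (\<Sum>y\<in>S. c * \<phi> t)"
      proof (rule sum_mono)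
        fix y assume y: "y \<in> S"
        have "Re (cnj (z x t) * (K t x y * z y t)) \<le> cmod (K t x y) * (cmod (z x t) * cmod (z y t))"
          using complex_Re_le_cmod[of "cnj (z x t) * (K t x y * z y t)"]
          by (simp add: norm_mult mult_ac)
        also have "\<dots> \<le> c * \<phi> t"
        proof (rule mult_mono[OF K[OF x y t]])
          show "cmod (z x t) * cmod (z y t) \<le> \<phi> t"
            using sum_squares_bound[of "cmod (z x t)" "cmod (z y t)"] m2[OF x, of t] m2[OF y, of t] by linarith
        qed (use \<open>0 \<le> c\<close> in auto)
        finally show "Re (cnj (z x t) * (K t x y * z y t)) \<le> c * \<phi> t" .
      qed
      finally show ?thesis by (simp add: mult_ac)
    qed
    then have "(\<Sum>x\<in>S. 2 * Re (cnj (z x t) * D x t)) \<le> (\<Sum>x\<in>S. 2 * real (card S) * c * \<phi> t)"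
      by (rule sum_mono)
    then show "(\<Sum>x\<in>S. 2 * Re (cnj (z x t) * D x t)) \<le> (real (card S) * (2 * real (card S) * c)) * \<phi> t"
      by (simp add: mult_ac)
  next
    show "0 \<le> \<phi> t" for t unfolding \<phi>_def by (simp add: sum_nonneg)
    show "\<phi> 0 = 0" unfolding \<phi>_def by (simp add: z0)
  qed
  then have "(cmod (z x t))\<^sup>2 \<le> 0" using m2[OF \<open>x \<in> S\<close>, of t] by simp
  then show ?thesis by simp
qed

lemma has_vector_derivative_unique_at:
  assumes "(f has_vector_derivative a) (at t)" "(f has_vector_derivative b) (at t)"
  shows "a = b"
  using has_derivative_unique[OF assms[unfolded has_vector_derivative_def]]
  by (metis scaleR_one)

lemma differentiable_iff_has_vector_derivative:
  "f differentiable (at (t :: real)) \<longleftrightarrow> (\<exists>d. (f has_vector_derivative d) (at t))"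
proof
  assume "f differentiable (at t)"
  then obtain D where D: "(f has_derivative D) (at t)" by (auto simp: differentiable_def)
  have "D h = h *\<^sub>R D 1" for h
    using linear_scale[OF has_derivative_linear[OF D], of h 1] by simp
  then have "D = (\<lambda>h. h *\<^sub>R D 1)" by (rule ext)
  with D have "(f has_vector_derivative D 1) (at t)" by (simp add: has_vector_derivative_def)
  then show "\<exists>d. (f has_vector_derivative d) (at t)" by blast
qed (auto simp: has_vector_derivative_def differentiable_def)

lemma det_differentiable:
  fixes A :: "real \<Rightarrow> complex mat"
  assumes A: "\<And>s. A s \<in> carrier_mat m m"
    and d: "\<And>i j. i < m \<Longrightarrow> j < m \<Longrightarrow> (\<lambda>s. A s $$ (i, j)) differentiable (at t)"
  shows "(\<lambda>s. det (A s)) differentiable (at t)"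
proof -
  have "(\<lambda>s. \<Prod>i = 0..<m. A s $$ (i, p i)) differentiable (at t)" if "p permutes {0..<m}" for p
  proof -
    have "\<exists>D. ((\<lambda>s. A s $$ (i, p i)) has_vector_derivative D) (at t)" if "i \<in> {0..<m}" for i
      using d[of i "p i"] that permutes_in_image[OF \<open>p permutes {0..<m}\<close>, of i]
      by (simp add: differentiable_iff_has_vector_derivative)
    then obtain D where "\<And>i. i \<in> {0..<m} \<Longrightarrow> ((\<lambda>s. A s $$ (i, p i)) has_vector_derivative D i) (at t)"
      by metis
    from has_vector_derivative_prod[of "{0..<m}", OF this] show ?thesis
      unfolding differentiable_iff_has_vector_derivative by (rule exI)
  qed
  then show ?thesis unfolding det_def'[OF A]
    by (intro differentiable_sum differentiable_mult differentiable_const finite_permutations) auto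
qed

lemma ksets_nth:
  assumes "I \<in> ksets n k"
  shows "length (sorted_list_of_set I) = k" "\<And>a. a < k \<Longrightarrow> sorted_list_of_set I ! a < n"
    "\<And>a. a < k \<Longrightarrow> sorted_list_of_set I ! a \<in> I" "finite I" "I \<subseteq> {..<n}"
proof -
  show I: "finite I" "I \<subseteq> {..<n}" using assms finite_subset unfolding ksets_def by auto
  show len: "length (sorted_list_of_set I) = k" using assms unfolding ksets_def by simp
  show mem: "sorted_list_of_set I ! a \<in> I" if "a < k" for a
    using that len I nth_mem[of a "sorted_list_of_set I"] by simp
  show "sorted_list_of_set I ! a < n" if "a < k" for a using mem[OF that] I by auto
qed

lemma minor_cnj: "minor k (\<lambda>i b. cnj (Y i b)) xs = cnj (minor k Y xs)"
proof -
  have "cnj (signof p :: complex) = signof p" for p :: "nat \<Rightarrow> nat" by (simp add: sign_def)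
  then show ?thesis by (simp add: minor_leibniz)
qed

lemma minor_tendsto:
  assumes "\<And>a b. a < k \<Longrightarrow> b < k \<Longrightarrow> ((\<lambda>m. Y m (xs ! a) b) \<longlongrightarrow> Z (xs ! a) b) F"
  shows "((\<lambda>m. minor k (Y m) xs) \<longlongrightarrow> minor k Z xs) F"
  unfolding minor_leibniz
proof (intro tendsto_sum tendsto_mult tendsto_prod tendsto_const)
  fix p a assume "p \<in> {p. p permutes {0..<k}}" "a \<in> {0..<k}"
  then have "p a < k" using permutes_in_image by fastforce
  then show "((\<lambda>m. Y m (xs ! a) (p a)) \<longlongrightarrow> Z (xs ! a) (p a)) F" using assms \<open>a \<in> {0..<k}\<close> by simp
qed

text \<open>In the Laplace expansion along the last column the cofactors are k-minors of the first k
  columns. Iterated up to n, this shows that an invertible matrix has a nonzero k-minor in its first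
  k columns.\<close>

lemma pluecker_zero_Suc:
  assumes z: "\<And>I. I \<in> ksets n k \<Longrightarrow> pluecker k Y I = 0" and I: "I \<in> ksets n (Suc k)"
  shows "pluecker (Suc k) Y I = 0"
proof -
  let ?xs = "sorted_list_of_set I"
  let ?A = "mat (Suc k) (Suc k) (\<lambda>(a, b). Y (?xs ! a) b)"
  note I' = ksets_nth[OF I]
  have "cofactor ?A a k = 0" if a: "a < Suc k" for a
  proof -
    define us vs x where "us = take a ?xs" and "vs = drop (Suc a) ?xs" and "x = ?xs ! a"
    have e: "?xs = us @ x # vs" unfolding us_def vs_def x_def using a I' by (simp add: id_take_nth_drop)
    have len: "length us = a" using a I' by (simp add: us_def)
    have len': "a + length vs = k" using arg_cong[OF e, of length] I' len by simp
    note sp = sorted_list_of_set_split[OF I'(4) e]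
    have "mat_delete ?A a k = mat k k (\<lambda>(a, b). Y ((us @ vs) ! a) b)"
      unfolding mat_delete_def e using len len'
      by (intro eq_matI) (auto simp: nth_append nth_Cons' Suc_diff_le)
    moreover have "I - {x} \<in> ksets n k" using I I' sp(3) by (auto simp: ksets_def)
    note z[OF this]
    ultimately show ?thesis by (simp add: cofactor_def pluecker_def minor_def sp(1))
  qed
  moreover have "det ?A = (\<Sum>a<Suc k. ?A $$ (a, k) * cofactor ?A a k)"
    by (rule laplace_expansion_column) auto
  ultimately show ?thesis unfolding pluecker_def minor_def by simp
qed

text \<open>Nonnegative complex numbers are real, so the imaginary part of \<open>D\<close> has to
  vanish too: the real case is applied to the real part and to both signs of the imaginary
  part.\<close>

lemma nonneg_derivative:
  fixes f :: "real \<Rightarrow> complex"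
  assumes d: "(f has_vector_derivative D) (at 0)" and "f 0 = 0" and pos: "\<And>t. 0 < t \<Longrightarrow> 0 \<le> f t"
  shows "0 \<le> D"
proof -
  have real: "0 \<le> a"
    if dh: "(h has_real_derivative a) (at 0)" and h0: "h 0 = 0" and h: "\<And>t. 0 < t \<Longrightarrow> 0 \<le> h t"
    for h :: "real \<Rightarrow> real" and a
  proof (rule ccontr)
    assume "\<not> 0 \<le> a"
    then obtain e where e: "0 < e" "\<forall>t>0. t < e \<longrightarrow> h (0 + t) < h 0"
      using DERIV_neg_dec_right[OF dh] by (metis not_le)
    then have "h (0 + e/2) < h 0" by simp
    then show False using h[of "e/2"] h0 e(1) by simp
  qed
  have Re: "((\<lambda>t. Re (f t)) has_real_derivative Re D) (at 0)"
    and Im: "((\<lambda>t. Im (f t)) has_real_derivative Im D) (at 0)"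
    using bounded_linear.has_vector_derivative[OF bounded_linear_Re d]
      bounded_linear.has_vector_derivative[OF bounded_linear_Im d]
    by (simp_all add: has_real_derivative_iff_has_vector_derivative)
  have "0 \<le> Re D" by (rule real[OF Re]) (use assms pos in \<open>auto simp: less_eq_complex_def\<close>)
  moreover have "0 \<le> Im D" by (rule real[OF Im]) (use assms pos in \<open>auto simp: less_eq_complex_def\<close>)
  moreover have "0 \<le> - Im D"
    by (rule real[OF DERIV_minus[OF Im]]) (use assms pos in \<open>auto simp: less_eq_complex_def\<close>)
  ultimately show ?thesis by (simp add: less_eq_complex_def)
qed

section \<open>Traces, commutators and skew-Hermitian matrices\<close>

context
  fixes n :: nat
begin

abbreviation "sq_mat \<equiv> (carrier_mat n n :: complex mat set)"

lemma sq_add_index: "A \<in> sq_mat \<Longrightarrow> B \<in> sq_mat \<Longrightarrow> i < n \<Longrightarrow> j < n \<Longrightarrow> (A + B) $$ (i, j) = A $$ (i, j) + B $$ (i, j)"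
  and sq_minus_index: "A \<in> sq_mat \<Longrightarrow> B \<in> sq_mat \<Longrightarrow> i < n \<Longrightarrow> j < n \<Longrightarrow> (A - B) $$ (i, j) = A $$ (i, j) - B $$ (i, j)"
  and sq_uminus_index: "A \<in> sq_mat \<Longrightarrow> i < n \<Longrightarrow> j < n \<Longrightarrow> (- A) $$ (i, j) = - (A $$ (i, j))"
  and sq_smult_index: "A \<in> sq_mat \<Longrightarrow> i < n \<Longrightarrow> j < n \<Longrightarrow> (c \<cdot>\<^sub>m A) $$ (i, j) = c * A $$ (i, j)"
  by auto

lemma sq_uminus_mult: "A \<in> sq_mat \<Longrightarrow> B \<in> sq_mat \<Longrightarrow> (- A) * B = - (A * B)"
  and sq_mult_uminus: "A \<in> sq_mat \<Longrightarrow> B \<in> sq_mat \<Longrightarrow> A * (- B) = - (A * B)"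
  by auto

lemma minus_carrier: "A \<in> sq_mat \<Longrightarrow> B \<in> sq_mat \<Longrightarrow> A - B \<in> sq_mat"
  by auto

lemmas sq_carrier = mult_carrier_mat[of _ n n _ n] add_carrier_mat[of _ n n] minus_carrier
  uminus_carrier_mat[of _ n n] smult_carrier_mat[of _ n n] mat_adjoint_carrier[of _ n n]
  one_carrier_mat[of n] zero_carrier_mat[of n n] mat_exp_carrier(1)[of n]

text \<open>With the dimensions fixed, identities between matrix polynomials follow one scheme:
  multiply out, pass to entries by \<open>sq_eqI\<close> and \<open>sq_index\<close>, and compare
  monomials as numbers.\<close>

lemmas sq_ring = assoc_mult_mat[of _ n n _ n _ n] add_mult_distrib_mat[of _ n n _ _ n]
  mult_add_distrib_mat[of _ n n _ n] minus_mult_distrib_mat[of _ n n _ _ n]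
  mult_minus_distrib_mat[of _ n n _ n] mult_smult_distrib[of _ n n _ n]
  mult_smult_assoc_mat[of _ n n _ n] sq_uminus_mult sq_mult_uminus
  left_mult_one_mat[of _ n n] right_mult_one_mat[of _ n n]
  left_mult_zero_mat[of _ n n] right_mult_zero_mat[of _ n n]

lemmas sq_index = sq_add_index sq_minus_index sq_uminus_index sq_smult_index

lemma sq_mult_index:
  assumes "A \<in> sq_mat" "B \<in> sq_mat" "i < n" "j < n"
  shows "(A * B) $$ (i, j) = (\<Sum>l<n. A $$ (i, l) * B $$ (l, j))"
  using assms by (simp add: scalar_prod_def atLeast0LessThan)

lemma mat_trace_sq: "A \<in> sq_mat \<Longrightarrow> mat_trace A = (\<Sum>i<n. A $$ (i, i))"
  by (auto simp: mat_trace_def)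

lemma mat_trace_add: "A \<in> sq_mat \<Longrightarrow> B \<in> sq_mat \<Longrightarrow> mat_trace (A + B) = mat_trace A + mat_trace B"
  and mat_trace_minus: "A \<in> sq_mat \<Longrightarrow> B \<in> sq_mat \<Longrightarrow> mat_trace (A - B) = mat_trace A - mat_trace B"
  and mat_trace_uminus: "A \<in> sq_mat \<Longrightarrow> mat_trace (- A) = - mat_trace A"
  and mat_trace_smult: "A \<in> sq_mat \<Longrightarrow> mat_trace (c \<cdot>\<^sub>m A) = c * mat_trace A"
  by (simp_all add: mat_trace_sq sq_carrier sq_index sum.distrib sum_subtractf sum_negf
      sum_distrib_left)

lemmas sq_trace = mat_trace_add mat_trace_minus mat_trace_uminus mat_trace_smult

lemma mat_trace_mult: "A \<in> sq_mat \<Longrightarrow> B \<in> sq_mat \<Longrightarrow> mat_trace (A * B) = (\<Sum>i<n. \<Sum>j<n. A $$ (i, j) * B $$ (j, i))"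
  by (simp add: mat_trace_sq sq_carrier sq_mult_index del: index_mult_mat(1))

lemma mat_trace_commute: "A \<in> sq_mat \<Longrightarrow> B \<in> sq_mat \<Longrightarrow> mat_trace (A * B) = mat_trace (B * A)"
  unfolding mat_trace_mult by (subst sum.swap) (simp add: mult.commute)

lemma ad_carrier: "L \<in> sq_mat \<Longrightarrow> X \<in> sq_mat \<Longrightarrow> ad L X \<in> sq_mat"
  by (simp add: ad_def sq_carrier)

lemma mat_trace_ad:
  assumes "L \<in> sq_mat" "A \<in> sq_mat" "B \<in> sq_mat"
  shows "mat_trace (ad L A * B) = - mat_trace (A * ad L B)"
proof -
  have "mat_trace (A * (B * L)) = mat_trace (L * (A * B))"
    using assms mat_trace_commute[of "A * B" L] by (simp add: sq_carrier sq_ring)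
  then show ?thesis using assms by (simp add: ad_def sq_carrier sq_ring sq_trace)
qed

lemma mat_trace_ad_zero: "L \<in> sq_mat \<Longrightarrow> X \<in> sq_mat \<Longrightarrow> mat_trace (ad L X) = 0"
  using mat_trace_commute[of L X] by (simp add: ad_def sq_carrier sq_trace)

lemma ad_add: "L \<in> sq_mat \<Longrightarrow> X \<in> sq_mat \<Longrightarrow> Y \<in> sq_mat \<Longrightarrow> ad L (X + Y) = ad L X + ad L Y"
  by (rule sq_eqI[of _ n];
      simp only: ad_def sq_carrier sq_ring sq_index; simp only: algebra_simps)

lemma ad_minus: "L \<in> sq_mat \<Longrightarrow> X \<in> sq_mat \<Longrightarrow> Y \<in> sq_mat \<Longrightarrow> ad L (X - Y) = ad L X - ad L Y"
  by (rule sq_eqI[of _ n];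
      simp only: ad_def sq_carrier sq_ring sq_index; simp only: algebra_simps)

lemma ad_uminus: "L \<in> sq_mat \<Longrightarrow> X \<in> sq_mat \<Longrightarrow> ad L (- X) = - ad L X"
  by (rule sq_eqI[of _ n];
      simp only: ad_def sq_carrier sq_ring sq_index; simp del: index_mult_mat(1))

lemma ad_smult: "L \<in> sq_mat \<Longrightarrow> X \<in> sq_mat \<Longrightarrow> ad L (c \<cdot>\<^sub>m X) = c \<cdot>\<^sub>m ad L X"
  by (rule sq_eqI[of _ n];
      simp only: ad_def sq_carrier sq_ring sq_index; simp only: algebra_simps)

lemma lie_u_carrier: "X \<in> lie_u n \<Longrightarrow> X \<in> sq_mat"
  by (simp add: lie_u_def)

lemma lie_u_add: "X \<in> lie_u n \<Longrightarrow> Y \<in> lie_u n \<Longrightarrow> X + Y \<in> lie_u n"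
  and lie_u_minus: "X \<in> lie_u n \<Longrightarrow> Y \<in> lie_u n \<Longrightarrow> X - Y \<in> lie_u n"
  and lie_u_uminus: "X \<in> lie_u n \<Longrightarrow> - X \<in> lie_u n"
  and lie_u_smult: "X \<in> lie_u n \<Longrightarrow> complex_of_real a \<cdot>\<^sub>m X \<in> lie_u n"
  unfolding lie_u_def
  by (auto simp: mat_adjoint_add[of _ n] mat_adjoint_minus[of _ n] mat_adjoint_uminus mat_adjoint_smult
      intro!: sq_eqI[of _ n] simp del: mat_adjoint_index)

lemma lie_u_ad:
  assumes "L \<in> lie_u n" "X \<in> lie_u n"
  shows "ad L X \<in> lie_u n"
proof -
  have c: "L \<in> sq_mat" "X \<in> sq_mat" and a: "mat_adjoint L = - L" "mat_adjoint X = - X"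
    using assms by (auto simp: lie_u_def)
  have "mat_adjoint (ad L X) = - ad L X"
    unfolding ad_def using c
    by (intro sq_eqI[of _ n])
      (simp_all add: mat_adjoint_minus[of _ n] mat_adjoint_mult[of _ n] a sq_carrier sq_ring sq_index
        del: index_mult_mat(1) mat_adjoint_index)
  then show ?thesis using c by (simp add: lie_u_def ad_carrier)
qed

lemma lie_u_trace_square:
  assumes "X \<in> lie_u n"
  shows "Re (mat_trace (X * X)) = - (\<Sum>i<n. \<Sum>j<n. (cmod (X $$ (i, j)))\<^sup>2)"
proof -
  have X: "X \<in> sq_mat" and a: "mat_adjoint X = - X" using assms by (auto simp: lie_u_def)
  have sk: "X $$ (j, i) = - cnj (X $$ (i, j))" if "i < n" "j < n" for i j
    using arg_cong[OF a, of "\<lambda>A. A $$ (j, i)"] that X by simp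
  have "mat_trace (X * X) = (\<Sum>i<n. \<Sum>j<n. - complex_of_real ((cmod (X $$ (i, j)))\<^sup>2))"
    unfolding mat_trace_mult[OF X X]
  proof (intro sum.cong refl)
    fix i j assume "i \<in> {..<n}" "j \<in> {..<n}"
    then have "X $$ (j, i) = - cnj (X $$ (i, j))" by (intro sk) auto
    then show "X $$ (i, j) * X $$ (j, i) = - complex_of_real ((cmod (X $$ (i, j)))\<^sup>2)"
      by (simp only: complex_norm_square mult_minus_right)
  qed
  then show ?thesis by (simp add: sum_negf of_real_sum[symmetric] del: of_real_sum of_real_power)
qed

lemma lie_u_trace_square_nonpos: "X \<in> lie_u n \<Longrightarrow> Re (mat_trace (X * X)) \<le> 0"
  by (simp add: lie_u_trace_square sum_nonneg)

text \<open>The trace of X X is minus the squared Frobenius norm. This one test later identifies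
  square roots, gradients and projections.\<close>

lemma lie_u_eq_zero:
  assumes "X \<in> lie_u n" "0 \<le> Re (mat_trace (X * X))"
  shows "X = 0\<^sub>m n n"
proof -
  have "(\<Sum>i<n. \<Sum>j<n. (cmod (X $$ (i, j)))\<^sup>2) = 0"
    using assms lie_u_trace_square[of X] by (intro antisym sum_nonneg) auto
  then have "\<forall>i<n. \<forall>j<n. X $$ (i, j) = 0"
    by (simp add: sum_nonneg_eq_0_iff sum_nonneg)
  then show ?thesis using lie_u_carrier[OF assms(1)] by (intro sq_eqI[of _ n]) auto
qed

section \<open>The metrics at one point of the orbit\<close>

context
  fixes L
  assumes L: "L \<in> lie_u n" and LL: "L * L = \<i> \<cdot>\<^sub>m L"
begin

lemma orbit_point_carrier: "L \<in> sq_mat" by (rule lie_u_carrier[OF L])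

lemma orbit_point_square_mult: "X \<in> sq_mat \<Longrightarrow> L * (L * X) = \<i> \<cdot>\<^sub>m (L * X)"
  using orbit_point_carrier LL assoc_mult_mat[of L n n L n X n] by (simp add: sq_ring)

text \<open>A point L = \<i> P has eigenvalues \<i> and 0, so those of \<open>ad L\<close> are among
  0, \<i>, -\<i>, the roots of z^3 = -z. Hence minus the square of \<open>ad L\<close> is a
  projection onto the tangent space.\<close>

lemma ad_cubed: "X \<in> sq_mat \<Longrightarrow> ad L (ad L (ad L X)) = - ad L X"
  using orbit_point_carrier
  by (intro sq_eqI[of _ n]; simp only: ad_def sq_carrier sq_ring sq_index LL orbit_point_square_mult smult_smult_mat;
      simp add: algebra_simps del: index_mult_mat(1) assoc_mult_mat)

lemma tangent_carrier: "V \<in> tangent_space n L \<Longrightarrow> V \<in> sq_mat"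
  and tangent_lie_u: "V \<in> tangent_space n L \<Longrightarrow> V \<in> lie_u n"
  using lie_u_ad[OF L] lie_u_carrier unfolding tangent_space_def by auto

lemma ad_ad_tangent: "V \<in> tangent_space n L \<Longrightarrow> ad L (ad L V) = - V"
  using ad_cubed lie_u_carrier unfolding tangent_space_def by auto

lemma tangent_minus:
  assumes "V \<in> tangent_space n L" "W \<in> tangent_space n L"
  shows "V - W \<in> tangent_space n L"
proof -
  obtain X Y where "X \<in> lie_u n" "Y \<in> lie_u n" "V = ad L X" "W = ad L Y"
    using assms unfolding tangent_space_def by auto
  then have "V - W = ad L (X - Y)" by (simp add: ad_minus orbit_point_carrier lie_u_carrier)
  then show ?thesis using lie_u_minus[OF \<open>X \<in> lie_u n\<close> \<open>Y \<in> lie_u n\<close>] by (auto simp: tangent_space_def)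
qed

text \<open>By \<open>ad_cubed\<close> the difference lies in the kernel of \<open>ad L\<close>. Any
  other decomposition yields the same component, because minus the square of \<open>ad L\<close>
  fixes its tangent part and kills its kernel part.\<close>

lemma im_part_eq:
  assumes X: "X \<in> lie_u n"
  shows "im_part n L X = - ad L (ad L X)"
  unfolding im_part_def
proof (rule the_equality)
  note c = orbit_point_carrier lie_u_carrier[OF X]
  have Z: "- ad L (ad L X) = ad L (- ad L X)" using c by (simp add: ad_uminus ad_carrier)
  have "ad L (X - - ad L (ad L X)) = 0\<^sub>m n n"
    using c by (intro sq_eqI[of _ n]) (simp_all add: ad_minus ad_uminus ad_carrier ad_cubed sq_carrier sq_index)
  then show "- ad L (ad L X) \<in> ad L ` lie_u n \<and> X - - ad L (ad L X) \<in> lie_u n \<and>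
      ad L (X - - ad L (ad L X)) = 0\<^sub>m n n"
    using X L Z by (auto intro!: lie_u_minus lie_u_uminus lie_u_ad)
next
  fix Z assume Z: "Z \<in> ad L ` lie_u n \<and> X - Z \<in> lie_u n \<and> ad L (X - Z) = 0\<^sub>m n n"
  then have t: "Z \<in> tangent_space n L" by (simp add: tangent_space_def)
  note c = orbit_point_carrier lie_u_carrier[OF X] tangent_carrier[OF t]
  have "ad L X - ad L Z = 0\<^sub>m n n" using Z c by (simp add: ad_minus)
  have "ad L X = ad L Z"
  proof (rule sq_eqI[of _ n])
    fix i j assume ij: "i < n" "j < n"
    have "(ad L X - ad L Z) $$ (i, j) = 0" using \<open>ad L X - ad L Z = 0\<^sub>m n n\<close> ij by simp
    then show "ad L X $$ (i, j) = ad L Z $$ (i, j)" using c ij by (simp add: sq_index ad_carrier)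
  qed (use c in \<open>auto intro: ad_carrier\<close>)
  then have "ad L (ad L X) = - Z" using ad_ad_tangent[OF t] by simp
  then show "Z = - ad L (ad L X)" using c by (simp add: uminus_uminus_mat)
qed

lemma normal_metric_eq:
  assumes V: "V \<in> tangent_space n L" and W: "W \<in> tangent_space n L"
  shows "normal_metric n L V W = - (2 * real n) * Re (mat_trace (V * W))"
proof -
  \<comment> \<open>The right-hand side mentions \<open>U\<close> only, so the choice made in
    \<open>lift\<close> has no influence.\<close>
  have lift: "im_part n L (lift n L U) = - ad L U" if U: "U \<in> tangent_space n L" for U
  proof -
    have "\<exists>X. X \<in> lie_u n \<and> U = ad L X" using U by (auto simp: tangent_space_def)
    then have "lift n L U \<in> lie_u n \<and> U = ad L (lift n L U)" unfolding lift_def by (rule someI_ex)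
    then show ?thesis using im_part_eq by metis
  qed
  note c = orbit_point_carrier tangent_carrier[OF V] tangent_carrier[OF W]
  have "kappa n (- ad L V) (- ad L W) = 2 * of_nat n * mat_trace (ad L V * ad L W)"
    using c by (simp add: kappa_def sq_ring sq_carrier ad_carrier sq_trace mat_trace_ad_zero uminus_uminus_mat)
  also have "mat_trace (ad L V * ad L W) = mat_trace (V * W)"
    using c by (simp add: mat_trace_ad ad_carrier ad_ad_tangent[OF W] sq_ring sq_trace sq_carrier)
  finally show ?thesis unfolding normal_metric_def lift[OF V] lift[OF W] by simp
qed

lemma induced_metric_eq:
  assumes V: "V \<in> tangent_space n L"
  shows "induced_metric n L V W = - (2 * real n) * Re (mat_trace (V * W))"
proof -
  have "mat_trace V = 0"
    using V mat_trace_ad_zero orbit_point_carrier lie_u_carrier by (auto simp: tangent_space_def)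
  then show ?thesis by (simp add: induced_metric_def kappa_def)
qed

text \<open>A self-adjoint projection is its own positive square root. Existence guarantees that the
  choice in \<open>pos_sqrt\<close> returns a genuine square root.\<close>

lemma is_pos_sqrt_exists: "is_pos_sqrt n (\<lambda>X. - ad L (ad L X)) (\<lambda>X. - ad L (ad L X))"
  unfolding is_pos_sqrt_def
proof (intro conjI ballI allI)
  fix X assume X: "X \<in> lie_u n"
  note c = orbit_point_carrier lie_u_carrier[OF X]
  show "- ad L (ad L X) \<in> lie_u n" using X L by (intro lie_u_uminus lie_u_ad)
  show "- ad L (ad L (complex_of_real a \<cdot>\<^sub>m X)) = complex_of_real a \<cdot>\<^sub>m - ad L (ad L X)" for a
    using c by (intro sq_eqI[of _ n]) (simp_all add: ad_smult ad_carrier sq_carrier sq_index)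
  have "mat_trace (- ad L (ad L X) * X) = mat_trace (ad L X * ad L X)"
    using c mat_trace_ad[of L "ad L X" X] by (simp add: sq_ring sq_carrier sq_trace ad_carrier)
  then show "0 \<le> Re (- mat_trace (- ad L (ad L X) * X))"
    using lie_u_trace_square_nonpos[OF lie_u_ad[OF L X]] by simp
  show "- ad L (ad L (- ad L (ad L X))) = - ad L (ad L X)"
    using c by (simp add: ad_uminus ad_carrier ad_cubed uminus_uminus_mat)
  fix Y assume Y: "Y \<in> lie_u n"
  note d = c lie_u_carrier[OF Y]
  show "- ad L (ad L (X + Y)) = - ad L (ad L X) + - ad L (ad L Y)"
    using d by (intro sq_eqI[of _ n]) (simp_all add: ad_add ad_carrier sq_carrier sq_index)
  have "mat_trace (ad L (ad L X) * Y) = mat_trace (X * ad L (ad L Y))"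
    using d by (simp add: mat_trace_ad ad_carrier)
  then show "Re (- mat_trace (- ad L (ad L X) * Y)) = Re (- mat_trace (X * - ad L (ad L Y)))"
    using d by (simp add: sq_ring sq_carrier sq_trace ad_carrier)
qed

text \<open>\<open>-ad\<^sub>L\<^sup>2\<close> is the identity on the tangent space, hence so is its square root \<open>S\<close>:
  \<open>W = S V - V\<close> satisfies \<open>S W = - W\<close>, which forces \<open>W = 0\<close> by positivity.\<close>
lemma pos_sqrt_tangent:
  assumes V: "V \<in> tangent_space n L"
  shows "pos_sqrt n (\<lambda>X. - ad L (ad L X)) V = V"
proof -
  define S where "S = pos_sqrt n (\<lambda>X. - ad L (ad L X))"
  have "is_pos_sqrt n (\<lambda>X. - ad L (ad L X)) S"
    unfolding S_def pos_sqrt_def by (rule someI[of "is_pos_sqrt n (\<lambda>X. - ad L (ad L X))", OF is_pos_sqrt_exists])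
  then have S: "\<And>X. X \<in> lie_u n \<Longrightarrow> S X \<in> lie_u n"
      "\<And>X Y. X \<in> lie_u n \<Longrightarrow> Y \<in> lie_u n \<Longrightarrow> S (X + Y) = S X + S Y"
      "\<And>X a. X \<in> lie_u n \<Longrightarrow> S (complex_of_real a \<cdot>\<^sub>m X) = complex_of_real a \<cdot>\<^sub>m S X"
      "\<And>X. X \<in> lie_u n \<Longrightarrow> 0 \<le> Re (- mat_trace (S X * X))"
      "\<And>X. X \<in> lie_u n \<Longrightarrow> S (S X) = - ad L (ad L X)"
    unfolding is_pos_sqrt_def by blast+
  have u: "V \<in> lie_u n" by (rule tangent_lie_u[OF V])
  note c = lie_u_carrier[OF u] lie_u_carrier[OF S(1)[OF u]]
  have SSV: "S (S V) = V" using S(5)[OF u] ad_ad_tangent[OF V] c by (simp add: uminus_uminus_mat)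
  \<comment> \<open>The difference is written as a sum with a real multiple, the two operations that
    \<open>is_pos_sqrt\<close> makes \<open>S\<close> respect.\<close>
  define W where "W = S V + complex_of_real (-1) \<cdot>\<^sub>m V"
  have W: "W \<in> lie_u n" unfolding W_def by (intro lie_u_add lie_u_smult S(1) u)
  have "S W = V + complex_of_real (-1) \<cdot>\<^sub>m S V"
    unfolding W_def by (simp only: S(2)[OF S(1)[OF u] lie_u_smult[OF u]] S(3)[OF u] SSV)
  also have "\<dots> = - W" unfolding W_def using c by (intro sq_eqI[of _ n]) (simp_all add: sq_carrier sq_index)
  finally have "Re (- mat_trace (S W * W)) = Re (mat_trace (W * W))"
    using lie_u_carrier[OF W] by (simp add: sq_ring sq_carrier sq_trace)
  then have "W = 0\<^sub>m n n" using S(4)[OF W] by (intro lie_u_eq_zero[OF W]) simp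
  have "S V = V"
  proof (rule sq_eqI[OF c(2,1)])
    fix i j assume ij: "i < n" "j < n"
    have "W $$ (i, j) = 0" using \<open>W = 0\<^sub>m n n\<close> ij by simp
    then show "S V $$ (i, j) = V $$ (i, j)" using ij c by (simp add: W_def sq_carrier sq_index)
  qed
  then show ?thesis by (simp add: S_def)
qed

lemma metric_eq:
  assumes "metric \<in> {kaehler_metric n, normal_metric n, induced_metric n}"
    and V: "V \<in> tangent_space n L" and W: "W \<in> tangent_space n L"
  shows "metric L V W = - (2 * real n) * Re (mat_trace (V * W))"
  using assms(1) normal_metric_eq[OF V W] induced_metric_eq[OF V] pos_sqrt_tangent[OF V]
  by (auto simp: kaehler_metric_def)

end

section \<open>Orbit points as projections of rank k\<close>

definition coord_proj :: "nat \<Rightarrow> complex mat" where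
  "coord_proj k = mat_diag n (\<lambda>i. if i < k then 1 else 0)"

definition flag_proj :: "nat \<Rightarrow> complex mat \<Rightarrow> complex mat" where
  "flag_proj k g = g * coord_proj k * mat_adjoint g"

lemma coord_proj_carrier [simp]: "coord_proj k \<in> sq_mat"
  by (simp add: coord_proj_def)

lemma coord_proj_mult: "coord_proj k * coord_proj k = coord_proj k"
  unfolding coord_proj_def by (simp add: if_distrib cong: if_cong)

lemma coord_proj_adjoint: "mat_adjoint (coord_proj k) = coord_proj k"
  by (rule eq_matI) (auto simp: coord_proj_def mat_diag_def)

lemma unitary_carrier: "g \<in> unitary_group n \<Longrightarrow> g \<in> sq_mat"
  and unitary_left: "g \<in> unitary_group n \<Longrightarrow> mat_adjoint g * g = 1\<^sub>m n"
  by (auto simp: unitary_group_def)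

lemma unitary_left_cancel: "g \<in> unitary_group n \<Longrightarrow> A \<in> sq_mat \<Longrightarrow> mat_adjoint g * (g * A) = A"
  using unitary_carrier[of g] unitary_left[of g] assoc_mult_mat[of "mat_adjoint g" n n g n A n]
  by simp

lemma unitaryI:
  assumes "g \<in> sq_mat" "mat_adjoint g * g = 1\<^sub>m n"
  shows "g \<in> unitary_group n"
  using assms mat_mult_left_right_inverse[OF mat_adjoint_carrier[OF assms(1)] assms(1)]
  by (simp add: unitary_group_def)

lemma unitary_mult:
  assumes g: "g \<in> unitary_group n" and h: "h \<in> unitary_group n"
  shows "g * h \<in> unitary_group n"
proof (rule unitaryI)
  note c = unitary_carrier[OF g] unitary_carrier[OF h]
  show "g * h \<in> sq_mat" using c by (simp add: sq_carrier)
  have "mat_adjoint (g * h) * (g * h) = mat_adjoint h * (mat_adjoint g * (g * h))"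
    using c by (simp only: mat_adjoint_mult[of _ n] sq_carrier sq_ring)
  then show "mat_adjoint (g * h) * (g * h) = 1\<^sub>m n"
    using unitary_left_cancel[OF g c(2)] unitary_left[OF h] by simp
qed

lemma flag_proj_carrier: "g \<in> sq_mat \<Longrightarrow> flag_proj k g \<in> sq_mat"
  by (simp add: flag_proj_def sq_carrier)

lemma flag_proj_idem:
  assumes g: "g \<in> unitary_group n"
  shows "flag_proj k g * flag_proj k g = flag_proj k g"
proof -
  note c = unitary_carrier[OF g] coord_proj_carrier
  have "flag_proj k g * flag_proj k g =
      g * (coord_proj k * (mat_adjoint g * (g * (coord_proj k * mat_adjoint g))))"
    unfolding flag_proj_def using c by (simp only: sq_carrier sq_ring)
  also have "\<dots> = g * ((coord_proj k * coord_proj k) * mat_adjoint g)"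
    using c unitary_left_cancel[OF g, of "coord_proj k * mat_adjoint g"]
    by (simp only: sq_carrier sq_ring)
  finally show ?thesis unfolding flag_proj_def coord_proj_mult using c by (simp only: sq_carrier sq_ring)
qed

lemma flag_proj_adjoint:
  assumes g: "g \<in> sq_mat"
  shows "mat_adjoint (flag_proj k g) = flag_proj k g"
  unfolding flag_proj_def using g coord_proj_carrier
  by (simp only: mat_adjoint_mult[of _ n] sq_carrier sq_ring coord_proj_adjoint mat_adjoint_adjoint)

lemma flag_proj_trace:
  assumes g: "g \<in> unitary_group n"
  shows "mat_trace (flag_proj k g) = mat_trace (coord_proj k)"
proof -
  note c = unitary_carrier[OF g] coord_proj_carrier
  have "mat_trace (flag_proj k g) = mat_trace (mat_adjoint g * (g * coord_proj k))"
    unfolding flag_proj_def using c by (subst mat_trace_commute) (auto simp: sq_carrier)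
  then show ?thesis using unitary_left_cancel[OF g] by simp
qed

lemma flag_proj_index:
  assumes g: "g \<in> sq_mat" and ij: "i < n" "j < n" and "k \<le> n"
  shows "flag_proj k g $$ (i, j) = (\<Sum>b<k. g $$ (i, b) * cnj (g $$ (j, b)))"
proof -
  have "flag_proj k g $$ (i, j) = (\<Sum>b<n. (g * coord_proj k) $$ (i, b) * mat_adjoint g $$ (b, j))"
    unfolding flag_proj_def using g ij by (intro sq_mult_index) (auto simp: sq_carrier)
  also have "g * coord_proj k = mat n n (\<lambda>(i, j). g $$ (i, j) * (if j < k then 1 else 0))"
    unfolding coord_proj_def using g by (rule mat_diag_mult_right)
  also have "(\<Sum>b<n. mat n n (\<lambda>(i, j). g $$ (i, j) * (if j < k then 1 else 0)) $$ (i, b) * mat_adjoint g $$ (b, j))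
      = (\<Sum>b<n. if b < k then g $$ (i, b) * cnj (g $$ (j, b)) else 0)"
    using g ij by (intro sum.cong) auto
  also have "\<dots> = (\<Sum>b<k. g $$ (i, b) * cnj (g $$ (j, b)))"
    using \<open>k \<le> n\<close> by (intro sum.mono_neutral_cong_right) auto
  finally show ?thesis .
qed

lemma conj_diag_omega: "g \<in> sq_mat \<Longrightarrow> conj_diag n (omega k) g = \<i> \<cdot>\<^sub>m flag_proj k g"
proof -
  assume g: "g \<in> sq_mat"
  have "mat_diag n (\<lambda>i. \<i> * complex_of_real (omega k i)) = \<i> \<cdot>\<^sub>m coord_proj k"
    by (rule eq_matI) (auto simp: coord_proj_def mat_diag_def omega_def)
  then show ?thesis
    unfolding conj_diag_def flag_proj_def using g coord_proj_carrier by (simp only: sq_carrier sq_ring)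
qed

lemma orbitE:
  assumes "L \<in> adj_orbit n (omega k)"
  obtains g where "g \<in> unitary_group n" "L = \<i> \<cdot>\<^sub>m flag_proj k g"
  using assms conj_diag_omega unitary_carrier unfolding adj_orbit_def by auto

lemma orbit_lie_u:
  assumes "L \<in> adj_orbit n (omega k)"
  shows "L \<in> lie_u n" "L * L = \<i> \<cdot>\<^sub>m L"
proof -
  obtain g where g: "g \<in> unitary_group n" and L: "L = \<i> \<cdot>\<^sub>m flag_proj k g" using orbitE[OF assms] .
  note c = flag_proj_carrier[OF unitary_carrier[OF g], of k]
  have "mat_adjoint L = - L"
    unfolding L mat_adjoint_smult flag_proj_adjoint[OF unitary_carrier[OF g]]
    using c by (intro sq_eqI[of _ n]) auto
  then show "L \<in> lie_u n" using c by (simp add: lie_u_def L)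
  show "L * L = \<i> \<cdot>\<^sub>m L" unfolding L using c
    by (simp only: sq_carrier sq_ring flag_proj_idem[OF g] smult_smult_mat)
qed

section \<open>Curves in the orbit and the gradient\<close>

lemma has_mat_derivative_adjoint:
  assumes X: "\<And>s. X s \<in> sq_mat" "X' \<in> sq_mat" and d: "has_mat_derivative n X X' t"
  shows "has_mat_derivative n (\<lambda>s. mat_adjoint (X s)) (mat_adjoint X') t"
  unfolding has_mat_derivative_def
proof (intro allI impI)
  fix i j assume ij: "i < n" "j < n"
  have "((\<lambda>s. cnj (X s $$ (j, i))) has_vector_derivative cnj (X' $$ (j, i))) (at t)"
    using d ij unfolding has_mat_derivative_def
    by (intro bounded_linear.has_vector_derivative[OF bounded_linear_cnj]) auto
  moreover have "dim_row (X s) = n" "dim_col (X s) = n" for s using X(1)[of s] by auto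
  ultimately show "((\<lambda>s. mat_adjoint (X s) $$ (i, j)) has_vector_derivative mat_adjoint X' $$ (i, j)) (at t)"
    using ij X(2) by simp
qed

lemma skew_exp_unitary:
  assumes X: "X \<in> lie_u n"
  shows "mat_exp n X s \<in> unitary_group n"
proof (rule unitaryI)
  let ?E = "mat_exp n X"
  have c: "X \<in> sq_mat" and a: "mat_adjoint X = - X" using X by (auto simp: lie_u_def)
  have "has_mat_derivative n (\<lambda>s. mat_adjoint (?E s) * ?E s)
      (mat_adjoint (X * ?E t) * ?E t + mat_adjoint (?E t) * (X * ?E t)) t" for t
    using c by (intro has_mat_derivative_mult has_mat_derivative_adjoint mat_exp_has_derivative)
      (auto simp: sq_carrier)
  moreover have "mat_adjoint (X * ?E t) * ?E t + mat_adjoint (?E t) * (X * ?E t) = 0\<^sub>m n n" for t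
  proof -
    have "mat_adjoint (X * ?E t) * ?E t = - (mat_adjoint (?E t) * (X * ?E t))"
      using c by (simp only: mat_adjoint_mult[of _ n] a sq_carrier sq_ring)
    then show ?thesis using c uminus_l_inv_mat[of "mat_adjoint (?E t) * (X * ?E t)" n n]
      by (simp only: sq_carrier)
  qed
  ultimately have "mat_adjoint (?E s) * ?E s = mat_adjoint (?E 0) * ?E 0"
    by (intro has_mat_derivative_zero_unique[of "\<lambda>s. mat_adjoint (?E s) * ?E s" n]) (auto simp: sq_carrier)
  then show "mat_adjoint (?E s) * ?E s = 1\<^sub>m n" using c by (simp add: mat_exp_zero mat_adjoint_one)
qed simp

text \<open>\<open>is_gradient\<close> tests along curves, so it constrains the direction W only if
  some curve has velocity W. Conjugating L by exp(-sX) provides one, with velocity -X L + L X =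
  [L, X].\<close>

lemma tangent_curve:
  assumes L: "L \<in> adj_orbit n (omega k)" and W: "W \<in> tangent_space n L"
  obtains c where "c 0 = L" "\<And>s. c s \<in> adj_orbit n (omega k)" "has_mat_derivative n c W 0"
proof -
  obtain X where X: "X \<in> lie_u n" and WX: "W = ad L X" using W by (auto simp: tangent_space_def)
  have X': "- X \<in> lie_u n" by (rule lie_u_uminus[OF X])
  obtain g where g: "g \<in> unitary_group n" and Lg: "L = \<i> \<cdot>\<^sub>m flag_proj k g" using orbitE[OF L] .
  let ?E = "mat_exp n (- X)"
  note c = unitary_carrier[OF g] lie_u_carrier[OF X] lie_u_carrier[OF X'] coord_proj_carrier[of k]
    lie_u_carrier[OF orbit_lie_u(1)[OF L]]
  have a: "mat_adjoint (- X) = X" using X c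
    by (simp add: lie_u_def mat_adjoint_uminus uminus_uminus_mat)
  define c where "c s = ?E s * L * mat_adjoint (?E s)" for s
  have cs: "c s = conj_diag n (omega k) (?E s * g)" for s
    unfolding c_def Lg using c
    by (simp only: conj_diag_omega flag_proj_def mat_adjoint_mult[of _ n] sq_carrier sq_ring)
  show thesis
  proof (rule that)
    show "c 0 = L" using c by (simp add: c_def mat_exp_zero mat_adjoint_one)
    show "c s \<in> adj_orbit n (omega k)" for s
      unfolding cs adj_orbit_def by (intro imageI unitary_mult skew_exp_unitary X' g)
    have "has_mat_derivative n c
        ((- X * ?E 0 * L + ?E 0 * 0\<^sub>m n n) * mat_adjoint (?E 0) + ?E 0 * L * mat_adjoint (- X * ?E 0)) 0"
      unfolding c_def using c
      by (intro has_mat_derivative_mult has_mat_derivative_adjoint mat_exp_has_derivative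
          has_mat_derivative_const) (auto simp: sq_carrier)
    also have "(- X * ?E 0 * L + ?E 0 * 0\<^sub>m n n) * mat_adjoint (?E 0) + ?E 0 * L * mat_adjoint (- X * ?E 0) = W"
      unfolding WX ad_def using c
      by (intro sq_eqI[of _ n]; simp only: mat_exp_zero mat_adjoint_one a sq_carrier sq_ring sq_index; simp)
    finally show "has_mat_derivative n c W 0" .
  qed
qed

text \<open>Tangent vectors pair with N only through its tangential part, which is minus the double
  bracket; dividing by the scale -2n of the metric leaves this expression.\<close>

definition grad_field :: "complex mat \<Rightarrow> complex mat \<Rightarrow> complex mat" where
  "grad_field N L = complex_of_real (1 / (2 * real n)) \<cdot>\<^sub>m ad L (ad L N)"

lemma trace_mult_has_derivative:
  assumes c: "\<And>s. c s \<in> sq_mat" and W: "W \<in> sq_mat" and N: "N \<in> sq_mat" and d: "has_mat_derivative n c W t"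
  shows "((\<lambda>s. Re (mat_trace (c s * N))) has_real_derivative Re (mat_trace (W * N))) (at t)"
proof -
  have "((\<lambda>s. \<Sum>i<n. \<Sum>j<n. c s $$ (i, j) * N $$ (j, i)) has_vector_derivative
      (\<Sum>i<n. \<Sum>j<n. W $$ (i, j) * N $$ (j, i))) (at t)"
    using d unfolding has_mat_derivative_def
    by (intro has_vector_derivative_sum has_vector_derivative_mult_left) auto
  from bounded_linear.has_vector_derivative[OF bounded_linear_Re this] show ?thesis
    using c W N by (simp add: mat_trace_mult has_real_derivative_iff_has_vector_derivative del: index_mult_mat(1))
qed

lemma grad_field_tangent:
  assumes L: "L \<in> adj_orbit n (omega k)" and N: "N \<in> lie_u n"
  shows "grad_field N L \<in> tangent_space n L"
proof -
  note l = orbit_lie_u[OF L]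
  have "grad_field N L = ad L (complex_of_real (1 / (2 * real n)) \<cdot>\<^sub>m ad L N)"
    unfolding grad_field_def using lie_u_carrier[OF l(1)] lie_u_carrier[OF N]
    by (simp add: ad_smult ad_carrier)
  moreover have "complex_of_real (1 / (2 * real n)) \<cdot>\<^sub>m ad L N \<in> lie_u n"
    by (intro lie_u_smult lie_u_ad l N)
  ultimately show ?thesis unfolding tangent_space_def by blast
qed

lemma grad_field_product:
  assumes L: "L \<in> adj_orbit n (omega k)" and N: "N \<in> lie_u n" and W: "W \<in> tangent_space n L" and "0 < n"
  shows "- (2 * real n) * Re (mat_trace (grad_field N L * W)) = Re (mat_trace (W * N))"
proof -
  note l = orbit_lie_u[OF L]
  note c = lie_u_carrier[OF l(1)] lie_u_carrier[OF N] tangent_carrier[OF l W]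
  have "mat_trace (grad_field N L * W) = complex_of_real (1 / (2 * real n)) * mat_trace (ad L (ad L N) * W)"
    unfolding grad_field_def using c by (simp add: sq_ring sq_carrier sq_trace ad_carrier)
  also have "mat_trace (ad L (ad L N) * W) = - mat_trace (N * W)"
    using c by (simp add: mat_trace_ad ad_carrier ad_ad_tangent[OF l W] sq_ring sq_carrier sq_trace)
  also have "mat_trace (N * W) = mat_trace (W * N)" using c by (intro mat_trace_commute)
  finally show ?thesis using \<open>0 < n\<close> by (simp add: Re_divide_of_nat)
qed

lemma is_gradient_iff:
  assumes metric: "metric \<in> {kaehler_metric n, normal_metric n, induced_metric n}"
    and L: "L \<in> adj_orbit n (omega k)" and N: "N \<in> lie_u n" and "0 < n"
  shows "is_gradient n (omega k) metric (\<lambda>L. Re (mat_trace (L * N))) L V \<longleftrightarrow> V = grad_field N L"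
proof
  note l = orbit_lie_u[OF L]
  note g = grad_field_tangent[OF L N]
  have H: "((\<lambda>s. Re (mat_trace (c s * N))) has_real_derivative Re (mat_trace (W * N))) (at 0)"
    if "\<And>s. c s \<in> adj_orbit n (omega k)" "W \<in> tangent_space n L" "has_mat_derivative n c W 0" for c W
    using that(3) by (intro trace_mult_has_derivative lie_u_carrier[OF N] tangent_carrier[OF l that(2)]
       lie_u_carrier[OF orbit_lie_u(1)[OF that(1)]])
  {
    assume "V = grad_field N L"
    then show "is_gradient n (omega k) metric (\<lambda>L. Re (mat_trace (L * N))) L V"
      unfolding is_gradient_def
      using g H metric_eq[OF l metric g] grad_field_product[OF L N _ \<open>0 < n\<close>] by auto
  next
    assume V: "is_gradient n (omega k) metric (\<lambda>L. Re (mat_trace (L * N))) L V"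
    then have Vt: "V \<in> tangent_space n L" by (simp add: is_gradient_def)
    \<comment> \<open>The two candidates are compared in the direction of their difference. Both
      give the same derivative along it, so W W has trace with real part 0 and W vanishes.\<close>
    define W where "W = V - grad_field N L"
    have W: "W \<in> tangent_space n L" unfolding W_def by (rule tangent_minus[OF l Vt g])
    obtain c where c: "c 0 = L" "\<And>s. c s \<in> adj_orbit n (omega k)" "has_mat_derivative n c W 0"
      using tangent_curve[OF L W] by metis
    then have "((\<lambda>s. Re (mat_trace (c s * N))) has_real_derivative metric L V W) (at 0)"
      using V W unfolding is_gradient_def by blast
    with H[OF c(2) W c(3)] have "metric L V W = Re (mat_trace (W * N))" by (rule DERIV_unique[symmetric])
    then have "- (2 * real n) * Re (mat_trace (V * W)) = - (2 * real n) * Re (mat_trace (grad_field N L * W))"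
      by (simp only: metric_eq[OF l metric Vt W] grad_field_product[OF L N W \<open>0 < n\<close>])
    then have "Re (mat_trace (V * W)) = Re (mat_trace (grad_field N L * W))" using \<open>0 < n\<close> by simp
    moreover note cc = tangent_carrier[OF l Vt] tangent_carrier[OF l g] tangent_carrier[OF l W]
    have "mat_trace (W * W) = mat_trace (V * W) - mat_trace (grad_field N L * W)"
    proof -
      have "W * W = V * W - grad_field N L * W"
        by (subst (1) W_def) (rule minus_mult_distrib_mat[OF cc])
      then show ?thesis
        using mat_trace_minus[OF mult_carrier_mat[OF cc(1,3)] mult_carrier_mat[OF cc(2,3)]] by argo
    qed
    ultimately have "0 \<le> Re (mat_trace (W * W))" by (metis minus_complex.sel(1) diff_self order_refl)
    then have "W = 0\<^sub>m n n" by (rule lie_u_eq_zero[OF tangent_lie_u[OF l W]])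
    show "V = grad_field N L"
    proof (rule sq_eqI[OF cc(1,2)])
      fix i j assume ij: "i < n" "j < n"
      have "W $$ (i, j) = 0" using \<open>W = 0\<^sub>m n n\<close> ij by simp
      then show "V $$ (i, j) = grad_field N L $$ (i, j)" using ij cc by (simp add: W_def sq_index)
    qed
  }
qed

lemma is_gradient_flow_iff:
  assumes metric: "metric \<in> {kaehler_metric n, normal_metric n, induced_metric n}"
    and N: "N \<in> lie_u n" and "0 < n"
  shows "is_gradient_flow n (omega k) metric (\<lambda>L. Re (mat_trace (L * N))) L \<longleftrightarrow>
    (\<forall>t. L t \<in> adj_orbit n (omega k) \<and> has_mat_derivative n L (grad_field N (L t)) t)"
proof -
  have "is_gradient n (omega k) metric (\<lambda>L. Re (mat_trace (L * N))) (L t) V \<longleftrightarrow> V = grad_field N (L t)"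
    if "L t \<in> adj_orbit n (omega k)" for t V
    by (rule is_gradient_iff[OF metric that N \<open>0 < n\<close>])
  then show ?thesis unfolding is_gradient_flow_def by (auto simp del: index_mult_mat)
qed

section \<open>Existence and span of the gradient flow\<close>

text \<open>Cramer's rule expresses the entries of the inverse by determinants, so they are
  differentiable. The product rule for \<open>R s * S s = 1\<^sub>m n\<close> then determines the
  derivative.\<close>

lemma inverse_has_derivative:
  assumes S: "\<And>s. S s \<in> sq_mat" and R: "\<And>s. R s \<in> sq_mat" and RS: "\<And>s. R s * S s = 1\<^sub>m n"
    and S': "S' \<in> sq_mat" and d: "has_mat_derivative n S S' t"
  shows "has_mat_derivative n R (- (R t * (S' * R t))) t"
proof -
  have SR: "S s * R s = 1\<^sub>m n" for s by (rule mat_mult_left_right_inverse[OF R S RS])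
  have dS: "det (S s) \<noteq> 0" for s
    using det_mult[OF R[of s] S[of s]] unfolding RS[of s] by auto
  have Sd: "(\<lambda>s. S s $$ (i, j)) differentiable (at t)" if "i < n" "j < n" for i j
    using d that unfolding has_mat_derivative_def differentiable_iff_has_vector_derivative by blast
  have dim: "dim_row (S s) = n" "dim_col (S s) = n" for s using S[of s] by auto
  have adj: "adj_mat (S s) \<in> sq_mat" "adj_mat (S s) * S s = det (S s) \<cdot>\<^sub>m 1\<^sub>m n" for s
    using adj_mat[OF S] by auto
  have Rs: "R s $$ (i, j) = inverse (det (S s)) * cofactor (S s) j i" if ij: "i < n" "j < n" for s i j
  proof -
    have "adj_mat (S s) = adj_mat (S s) * (S s * R s)" using adj(1)[of s] SR by simp
    also have "\<dots> = det (S s) \<cdot>\<^sub>m R s"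
      using adj[of s] S[of s] R[of s] assoc_mult_mat[of "adj_mat (S s)" n n "S s" n "R s" n, symmetric]
        mult_smult_assoc_mat[of "1\<^sub>m n" n n "R s" n "det (S s)"] by simp
    finally have "adj_mat (S s) $$ (i, j) = det (S s) * R s $$ (i, j)" using R[of s] ij by simp
    moreover have "adj_mat (S s) $$ (i, j) = cofactor (S s) j i"
      using ij dim by (simp add: adj_mat_def)
    ultimately show ?thesis using dS[of s] by (simp add: field_simps)
  qed
  have "(\<lambda>s. R s $$ (i, j)) differentiable (at t)" if ij: "i < n" "j < n" for i j
  proof -
    have "(\<lambda>s. det (mat_delete (S s) j i)) differentiable (at t)"
    proof (rule det_differentiable[where m = "n - 1"])
      show "mat_delete (S s) j i \<in> carrier_mat (n - 1) (n - 1)" for s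
        by (rule mat_delete_carrier[OF S])
      show "(\<lambda>s. mat_delete (S s) j i $$ (a, b)) differentiable (at t)" if "a < n - 1" "b < n - 1" for a b
      proof -
        have "(if a < j then a else Suc a) < n" "(if b < i then b else Suc b) < n" using that by auto
        from Sd[OF this] show ?thesis using that by (simp add: mat_delete_def dim)
      qed
    qed
    moreover have "(\<lambda>s. det (S s)) differentiable (at t)" by (rule det_differentiable[OF S Sd])
    ultimately show ?thesis unfolding Rs[OF ij] cofactor_def
      by (intro differentiable_mult differentiable_inverse differentiable_const dS)
  qed
  then have "\<forall>i j. \<exists>D. i < n \<longrightarrow> j < n \<longrightarrow> ((\<lambda>s. R s $$ (i, j)) has_vector_derivative D) (at t)"
    unfolding differentiable_iff_has_vector_derivative by blast
  then obtain D where D: "\<And>i j. i < n \<Longrightarrow> j < n \<Longrightarrow> ((\<lambda>s. R s $$ (i, j)) has_vector_derivative D i j) (at t)"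
    by metis
  define R' where "R' = mat n n (\<lambda>(i, j). D i j)"
  have R': "R' \<in> sq_mat" by (simp add: R'_def)
  have dR: "has_mat_derivative n R R' t" using D by (simp add: has_mat_derivative_def R'_def)
  have d1: "has_mat_derivative n (\<lambda>s. R s * S s) (R' * S t + R t * S') t"
    by (rule has_mat_derivative_mult[OF R R' dR S S' d])
  have d2: "has_mat_derivative n (\<lambda>s. R s * S s) (0\<^sub>m n n) t"
    unfolding RS by (rule has_mat_derivative_const)
  have eq: "R' * S t + R t * S' = 0\<^sub>m n n"
  proof (rule sq_eqI[of _ n])
    fix i j assume "i < n" "j < n"
    then show "(R' * S t + R t * S') $$ (i, j) = 0\<^sub>m n n $$ (i, j)"
      using d1 d2 has_vector_derivative_unique_at[of "\<lambda>s. (R s * S s) $$ (i, j)"]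
      unfolding has_mat_derivative_def by blast
  qed (use R' S[of t] R[of t] S' in \<open>auto simp: sq_carrier\<close>)
  note c = R' S[of t] R[of t] S'
  have "(R' * S t + R t * S') * R t = R' * (S t * R t) + R t * (S' * R t)"
    using c by (simp only: sq_carrier sq_ring)
  then have "R' + R t * (S' * R t) = 0\<^sub>m n n" using c by (simp add: eq SR)
  then have "(R' + R t * (S' * R t)) $$ (i, j) = 0" if "i < n" "j < n" for i j using that by simp
  then have "R' $$ (i, j) = (- (R t * (S' * R t))) $$ (i, j)" if "i < n" "j < n" for i j
    using c that by (simp add: sq_carrier sq_index add_eq_0_iff2 del: index_mult_mat(1))
  then have "R' = - (R t * (S' * R t))" using c by (intro sq_eqI[of _ n]) (auto simp: sq_carrier)
  then show ?thesis using dR by simp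
qed

text \<open>P - Q is a Hermitian projection of trace 0, so \<i> times it is skew-Hermitian with a
  square of trace 0, hence zero.\<close>

lemma projection_eqI:
  assumes P: "P \<in> sq_mat" "mat_adjoint P = P" "P * P = P" and Q: "Q \<in> sq_mat" "mat_adjoint Q = Q" "Q * Q = Q"
    and PQ: "P * Q = Q" and tr: "mat_trace P = mat_trace Q"
  shows "P = Q"
proof -
  have QP: "Q * P = Q" using mat_adjoint_mult[OF P(1) Q(1)] P Q PQ by simp
  have c: "P - Q \<in> sq_mat" using P Q by (simp add: sq_carrier)
  have DD: "(P - Q) * (P - Q) = P - Q"
    using P(1) Q(1) by (intro sq_eqI[of _ n]; simp only: sq_carrier sq_ring P(3) Q(3) PQ QP sq_index; simp)
  let ?X = "\<i> \<cdot>\<^sub>m (P - Q)"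
  have "?X \<in> lie_u n"
    using P Q c by (auto simp: lie_u_def mat_adjoint_smult mat_adjoint_minus[of _ n] intro!: sq_eqI[of _ n])
  moreover have "?X * ?X = (\<i> * \<i>) \<cdot>\<^sub>m (P - Q)"
    using c by (simp add: mult_smult_assoc_mat[of _ n n _ n] mult_smult_distrib[of _ n n _ n] DD smult_smult_mat)
  then have "mat_trace (?X * ?X) = 0"
    using c P(1) Q(1) tr by (simp add: sq_trace)
  ultimately have "?X = 0\<^sub>m n n" by (intro lie_u_eq_zero) auto
  then have "?X $$ (i, j) = 0" if "i < n" "j < n" for i j using that by simp
  then show ?thesis using P(1) Q(1) by (intro sq_eqI[of _ n]) (auto simp: sq_index)
qed

text \<open>The first k columns of g are combinations of columns fixed by P, so they lie in the
  range of P, and equal traces leave room for nothing else. This is how projections are recognized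
  from here on.\<close>

lemma projection_eq_flag_proj:
  assumes P: "P \<in> sq_mat" "mat_adjoint P = P" "P * P = P" "mat_trace P = mat_trace (coord_proj k)"
    and X: "X \<in> sq_mat" "\<And>i b. i < n \<Longrightarrow> b < k \<Longrightarrow> (P * X) $$ (i, b) = X $$ (i, b)"
    and g: "g \<in> unitary_group n" and span: "col_span n k (\<lambda>i b. X $$ (i, b)) (\<lambda>i b. g $$ (i, b))"
    and "k \<le> n"
  shows "P = flag_proj k g"
proof (rule projection_eqI[OF P(1-3)])
  note gc = unitary_carrier[OF g]
  obtain C where C: "\<And>i b. i < n \<Longrightarrow> b < k \<Longrightarrow> g $$ (i, b) = (\<Sum>a<k. X $$ (i, a) * C a b)"
    using span unfolding col_span_def by blast
  have Pg: "(\<Sum>l<n. P $$ (i, l) * g $$ (l, b)) = g $$ (i, b)" if "i < n" "b < k" for i b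
  proof -
    have "(\<Sum>l<n. P $$ (i, l) * g $$ (l, b)) = (\<Sum>l<n. \<Sum>a<k. P $$ (i, l) * X $$ (l, a) * C a b)"
      using that by (simp add: C sum_distrib_left mult.assoc)
    also have "\<dots> = (\<Sum>a<k. \<Sum>l<n. P $$ (i, l) * X $$ (l, a) * C a b)" by (rule sum.swap)
    also have "\<dots> = (\<Sum>a<k. (P * X) $$ (i, a) * C a b)"
      using that \<open>k \<le> n\<close> sq_mult_index[OF P(1) X(1)]
      by (intro sum.cong refl) (simp add: sum_distrib_right del: index_mult_mat(1))
    finally show ?thesis using that by (simp add: X(2) C del: index_mult_mat(1))
  qed
  show "P * flag_proj k g = flag_proj k g"
  proof (rule sq_eqI[of _ n])
    fix i j assume ij: "i < n" "j < n"
    have "(P * flag_proj k g) $$ (i, j) = (\<Sum>l<n. \<Sum>b<k. P $$ (i, l) * g $$ (l, b) * cnj (g $$ (j, b)))"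
      using sq_mult_index[OF P(1) flag_proj_carrier[OF gc] ij] gc ij \<open>k \<le> n\<close>
      by (simp add: flag_proj_index sum_distrib_left mult.assoc del: index_mult_mat(1))
    also have "\<dots> = (\<Sum>b<k. \<Sum>l<n. P $$ (i, l) * g $$ (l, b) * cnj (g $$ (j, b)))" by (rule sum.swap)
    also have "\<dots> = (\<Sum>b<k. g $$ (i, b) * cnj (g $$ (j, b)))"
      using ij by (simp add: sum_distrib_right[symmetric] Pg)
    also have "\<dots> = flag_proj k g $$ (i, j)" using gc ij \<open>k \<le> n\<close> by (simp add: flag_proj_index)
    finally show "(P * flag_proj k g) $$ (i, j) = flag_proj k g $$ (i, j)" .
  qed (use P gc in \<open>auto simp: sq_carrier flag_proj_carrier\<close>)
qed (use g P unitary_carrier[OF g] in \<open>simp_all add: flag_proj_carrier flag_proj_adjoint flag_proj_idem flag_proj_trace\<close>)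

definition flow_gen :: "complex mat \<Rightarrow> complex mat" where
  "flow_gen N = (\<i> / (2 * complex_of_nat n)) \<cdot>\<^sub>m N"

lemma flow_gen_carrier: "N \<in> sq_mat \<Longrightarrow> flow_gen N \<in> sq_mat"
  by (simp add: flow_gen_def)

lemma flow_gen_adjoint: "N \<in> lie_u n \<Longrightarrow> mat_adjoint (flow_gen N) = flow_gen N"
  unfolding lie_u_def flow_gen_def mat_adjoint_smult
  by (auto intro!: sq_eqI[of _ n])

text \<open>Written as (1 - P) B P + P B (1 - P), this is, for Hermitian B, the velocity of the
  orthogonal projection onto a subspace moved by exp(tB).\<close>

definition riccati :: "complex mat \<Rightarrow> complex mat \<Rightarrow> complex mat" where
  "riccati B P = B * P + P * B - complex_of_real 2 \<cdot>\<^sub>m (P * (B * P))"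

text \<open>For L = \<i> P the double bracket with N is minus (P N + N P - 2 P N P), because P P =
  P.\<close>

lemma grad_field_riccati:
  assumes P: "P \<in> sq_mat" "P * P = P" and N: "N \<in> sq_mat"
  shows "grad_field N (\<i> \<cdot>\<^sub>m P) = \<i> \<cdot>\<^sub>m riccati (flow_gen N) P"
proof -
  have PP: "P * (P * X) = P * X" if "X \<in> sq_mat" for X
    using P that assoc_mult_mat[of P n n P n X n] by simp
  show ?thesis
    unfolding grad_field_def riccati_def flow_gen_def ad_def using P(1) N
    by (intro sq_eqI[of _ n]; simp only: sq_carrier sq_ring smult_smult_mat P(2) PP sq_index;
        simp add: field_simps del: index_mult_mat(1))
qed

lemma flow_projections:
  assumes L: "\<And>t. L t \<in> adj_orbit n (omega k)" "\<And>t. has_mat_derivative n L (grad_field N (L t)) t"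
    and N: "N \<in> sq_mat"
  obtains P g where "\<And>t. L t = \<i> \<cdot>\<^sub>m P t" "\<And>t. g t \<in> unitary_group n" "\<And>t. P t = flag_proj k (g t)"
    "\<And>t. has_mat_derivative n P (riccati (flow_gen N) (P t)) t"
proof -
  have "\<forall>t. \<exists>g. g \<in> unitary_group n \<and> L t = \<i> \<cdot>\<^sub>m flag_proj k g" using orbitE L(1) by metis
  then obtain g where g: "\<And>t. g t \<in> unitary_group n" "\<And>t. L t = \<i> \<cdot>\<^sub>m flag_proj k (g t)" by metis
  define P where "P t = flag_proj k (g t)" for t
  have P: "P t \<in> sq_mat" "P t * P t = P t" for t
    using g(1) unfolding P_def by (simp_all add: flag_proj_carrier unitary_carrier flag_proj_idem)
  have LP: "L t = \<i> \<cdot>\<^sub>m P t" for t using g(2) by (simp add: P_def)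
  have "P = (\<lambda>t. (-\<i>) \<cdot>\<^sub>m L t)" by (rule ext) (simp add: LP smult_smult_mat one_smult_mat)
  moreover have rc: "riccati (flow_gen N) (P t) \<in> sq_mat" for t
    using P N by (simp add: riccati_def sq_carrier flow_gen_carrier)
  have "has_mat_derivative n (\<lambda>t. (-\<i>) \<cdot>\<^sub>m L t) ((-\<i>) \<cdot>\<^sub>m (\<i> \<cdot>\<^sub>m riccati (flow_gen N) (P t))) t" for t
  proof (intro has_mat_derivative_smult)
    have "grad_field N (L t) = \<i> \<cdot>\<^sub>m riccati (flow_gen N) (P t)"
      unfolding LP by (rule grad_field_riccati[OF P N])
    then show "has_mat_derivative n L (\<i> \<cdot>\<^sub>m riccati (flow_gen N) (P t)) t" using L(2)[of t] by simp
  qed (use P rc LP in auto)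
  ultimately have "has_mat_derivative n P (riccati (flow_gen N) (P t)) t" for t
    by (simp add: smult_smult_mat one_smult_mat)
  then show thesis by (rule that[of P g, OF LP g(1) P_def])
qed

text \<open>The diagonal entry r of P P = P is the squared norm of row i, so its square is at most
  r, and r \<le> 1. This bounds the coefficients of the flow uniformly in time.\<close>

lemma projection_entry_bound:
  assumes P: "P \<in> sq_mat" "mat_adjoint P = P" "P * P = P" and ij: "i < n" "j < n"
  shows "cmod (P $$ (i, j)) \<le> 1"
proof -
  have sym: "P $$ (l, i) = cnj (P $$ (i, l))" if "l < n" for l
    using arg_cong[OF P(2), of "\<lambda>A. A $$ (l, i)"] that ij P(1) by simp
  have "P $$ (i, i) = (\<Sum>l<n. P $$ (i, l) * P $$ (l, i))"
    using sq_mult_index[OF P(1) P(1) ij(1) ij(1)] P(3) by simp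
  also have "\<dots> = (\<Sum>l<n. complex_of_real ((cmod (P $$ (i, l)))\<^sup>2))"
    by (intro sum.cong refl) (metis complex_norm_square lessThan_iff sym)
  finally have e: "P $$ (i, i) = complex_of_real (\<Sum>l<n. (cmod (P $$ (i, l)))\<^sup>2)" by simp
  define r where "r = (\<Sum>l<n. (cmod (P $$ (i, l)))\<^sup>2)"
  have le: "(cmod (P $$ (i, l)))\<^sup>2 \<le> r" if "l < n" for l
    unfolding r_def using that by (intro member_le_sum) auto
  have r0: "0 \<le> r" unfolding r_def by (intro sum_nonneg) auto
  have "cmod (P $$ (i, i)) = r" unfolding e r_def[symmetric] using r0 by simp
  then have "r * r \<le> r" using le[OF ij(1)] by (simp add: power2_eq_square)
  then have "r \<le> 1" using r0 by (metis mult_le_cancel_left_pos mult.right_neutral less_eq_real_def zero_le_one)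
  then have "(cmod (P $$ (i, j)))\<^sup>2 \<le> 1\<^sup>2" using le[OF ij(2)] by simp
  then show ?thesis by (rule power2_le_imp_le) simp
qed

text \<open>\<open>Z = (1 - P(t)) exp(tB) P(0)\<close> satisfies the linear equation \<open>Z' = (1 - 2P) B Z\<close>, so it vanishes.\<close>
lemma flow_span:
  assumes g: "\<And>t. g t \<in> unitary_group n" and Pg: "\<And>t. P t = flag_proj k (g t)"
    and d: "\<And>t. has_mat_derivative n P (riccati B (P t)) t" and B: "B \<in> sq_mat" and "0 \<le> t"
  shows "P t * (mat_exp n B t * P 0) = mat_exp n B t * P 0"
proof -
  let ?E = "mat_exp n B"
  note gc = unitary_carrier[OF g]
  have P: "P t \<in> sq_mat" "mat_adjoint (P t) = P t" "P t * P t = P t" for t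
    unfolding Pg using gc g by (simp_all add: flag_proj_carrier flag_proj_adjoint flag_proj_idem)
  define Z where "Z s = (1\<^sub>m n + (-1) \<cdot>\<^sub>m P s) * (?E s * P 0)" for s
  have Z: "Z s \<in> sq_mat" for s unfolding Z_def using P by (simp add: sq_carrier)
  define C where "C s = (1\<^sub>m n - complex_of_real 2 \<cdot>\<^sub>m P s) * B" for s
  have C: "C s \<in> sq_mat" for s unfolding C_def using P B by (simp add: sq_carrier)
  have rc: "riccati B (P s) \<in> sq_mat" for s using P B by (simp add: riccati_def sq_carrier)
  have "has_mat_derivative n Z ((0\<^sub>m n n + (-1) \<cdot>\<^sub>m riccati B (P s)) * (?E s * P 0) +
      (1\<^sub>m n + (-1) \<cdot>\<^sub>m P s) * (B * ?E s * P 0 + ?E s * 0\<^sub>m n n)) s" for s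
    unfolding Z_def using P B rc d
    by (intro has_mat_derivative_mult has_mat_derivative_add has_mat_derivative_smult
        has_mat_derivative_const mat_exp_has_derivative) (auto simp: sq_carrier)
  also have "(0\<^sub>m n n + (-1) \<cdot>\<^sub>m riccati B (P s)) * (?E s * P 0) +
      (1\<^sub>m n + (-1) \<cdot>\<^sub>m P s) * (B * ?E s * P 0 + ?E s * 0\<^sub>m n n) = C s * Z s" for s
  proof -
    have "?E s \<in> sq_mat" by simp
    then show ?thesis
      unfolding Z_def C_def riccati_def using P(1)[of s] P(1)[of 0] B
      by (intro sq_eqI[of _ n]; simp only: sq_carrier sq_ring smult_smult_mat sq_index;
        simp add: field_simps del: index_mult_mat(1) assoc_mult_mat)
  qed
  finally have dZ: "has_mat_derivative n Z (C s * Z s) s" for s .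
  define b where "b = (\<Sum>i<n. \<Sum>j<n. cmod (B $$ (i, j)))"
  have bB: "cmod (B $$ (i, j)) \<le> b" if "i < n" "j < n" for i j
  proof -
    have "cmod (B $$ (i, j)) \<le> (\<Sum>j<n. cmod (B $$ (i, j)))"
      using that by (intro member_le_sum) auto
    also have "\<dots> \<le> b" unfolding b_def
      using that by (intro member_le_sum[of i _ "\<lambda>i. \<Sum>j<n. cmod (B $$ (i, j))"]) (auto intro: sum_nonneg)
    finally show ?thesis .
  qed
  \<comment> \<open>Entries of 1 - 2P have modulus at most 1 + 2 = 3 for every projection, so the
    bound does not depend on the unknown P(s).\<close>
  have Cb: "cmod (C s $$ (i, l)) \<le> real n * (3 * b)" if "i < n" "l < n" for s i l
  proof -
    have "C s $$ (i, l) = (\<Sum>m<n. (1\<^sub>m n - complex_of_real 2 \<cdot>\<^sub>m P s) $$ (i, m) * B $$ (m, l))"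
      unfolding C_def using P B that by (intro sq_mult_index) (auto simp: sq_carrier)
    also have "cmod \<dots> \<le> (\<Sum>m<n. 3 * b)"
    proof (rule sum_norm_le)
      fix m assume "m \<in> {..<n}"
      then have m: "m < n" by simp
      have "cmod ((1\<^sub>m n - complex_of_real 2 \<cdot>\<^sub>m P s) $$ (i, m)) \<le> cmod (if i = m then 1 else 0) + cmod (2 * P s $$ (i, m))"
      proof -
        have "(1\<^sub>m n - complex_of_real 2 \<cdot>\<^sub>m P s) $$ (i, m) = (if i = m then 1 else 0) - 2 * P s $$ (i, m)"
          using that m P(1)[of s] by (simp add: sq_index sq_carrier)
        then show ?thesis by (simp only: norm_triangle_ineq4)
      qed
      also have "\<dots> \<le> 1 + 2 * 1"
        using projection_entry_bound[OF P that(1) m, of s] by (intro add_mono) (auto simp: norm_mult)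
      finally have "cmod ((1\<^sub>m n - complex_of_real 2 \<cdot>\<^sub>m P s) $$ (i, m)) \<le> 3" by simp
      then show "cmod ((1\<^sub>m n - complex_of_real 2 \<cdot>\<^sub>m P s) $$ (i, m) * B $$ (m, l)) \<le> 3 * b"
        unfolding norm_mult using bB[OF m that(2)] by (intro mult_mono) auto
    qed
    finally show ?thesis by simp
  qed
  have Z0: "Z t $$ (i, j) = 0" if ij: "i < n" "j < n" for i j
  proof (rule linear_ode_zero[where z = "\<lambda>i t. Z t $$ (i, j)" and S = "{..<n}" and K = "\<lambda>t i l. C t $$ (i, l)"
        and c = "real n * (3 * b)"])
    show "((\<lambda>t. Z t $$ (i, j)) has_vector_derivative (\<Sum>l<n. C t $$ (i, l) * Z t $$ (l, j))) (at t)"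
      if "i \<in> {..<n}" for i t
      using dZ[of t] that ij unfolding has_mat_derivative_def
      by (simp add: sq_mult_index[OF C Z, symmetric] del: index_mult_mat(1))
    have "Z 0 = 0\<^sub>m n n"
      unfolding Z_def using P(1)[of 0]
      by (intro sq_eqI[of _ n]; simp only: mat_exp_zero[OF B] sq_carrier sq_ring P(3) sq_index; simp)
    then show "Z 0 $$ (i, j) = 0" if "i \<in> {..<n}" for i using that ij by simp
  qed (use Cb ij \<open>0 \<le> t\<close> in auto)
  have "Z t = ?E t * P 0 + (-1) \<cdot>\<^sub>m (P t * (?E t * P 0))"
    unfolding Z_def using P(1)[of t] P(1)[of 0] by (simp only: mat_exp_carrier sq_carrier sq_ring)
  then have "(?E t * P 0 + (-1) \<cdot>\<^sub>m (P t * (?E t * P 0))) $$ (i, j) = 0" if "i < n" "j < n" for i j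
    using Z0[OF that] by simp
  then show ?thesis using P(1)[of t] P(1)[of 0]
    by (intro sq_eqI[of _ n]) (simp_all add: sq_carrier sq_index del: index_mult_mat(1))
qed

lemma mult_coord_proj_index:
  assumes "A \<in> sq_mat" "i < n" "b < n"
  shows "(A * coord_proj k) $$ (i, b) = (if b < k then A $$ (i, b) else 0)"
  unfolding coord_proj_def mat_diag_mult_right[OF assms(1)] using assms by simp

lemma flag_proj_mult_frame:
  assumes g: "g \<in> unitary_group n"
  shows "flag_proj k g * g = g * coord_proj k"
proof -
  note c = unitary_carrier[OF g]
  have "flag_proj k g * g = g * (coord_proj k * (mat_adjoint g * g))"
    unfolding flag_proj_def using c by (simp only: sq_carrier sq_ring coord_proj_carrier)
  then show ?thesis using unitary_left[OF g] right_mult_one_mat[OF coord_proj_carrier[of k]] by simp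
qed

text \<open>The diagonal of a Gram matrix consists of squared column norms, so a vanishing sum
  forces both matrices to vanish.\<close>

lemma gram_sum_zero:
  assumes A: "A \<in> sq_mat" and C: "C \<in> sq_mat" and z: "mat_adjoint A * A + mat_adjoint C * C = 0\<^sub>m n n"
  shows "A = 0\<^sub>m n n" "C = 0\<^sub>m n n"
proof -
  have gram: "(mat_adjoint X * X) $$ (j, j) = complex_of_real (\<Sum>i<n. (cmod (X $$ (i, j)))\<^sup>2)"
    if X: "X \<in> sq_mat" and j: "j < n" for X j
  proof -
    have "(mat_adjoint X * X) $$ (j, j) = (\<Sum>i<n. cnj (X $$ (i, j)) * X $$ (i, j))"
      using sq_mult_index[OF mat_adjoint_carrier[OF X] X j j] X j by simp
    also have "\<dots> = (\<Sum>i<n. complex_of_real ((cmod (X $$ (i, j)))\<^sup>2))"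
      by (intro sum.cong refl) (simp only: complex_norm_square mult.commute)
    finally show ?thesis by simp
  qed
  have "A $$ (i, j) = 0 \<and> C $$ (i, j) = 0" if ij: "i < n" "j < n" for i j
  proof -
    have "(mat_adjoint A * A + mat_adjoint C * C) $$ (j, j) = 0" using z ij by simp
    then have "complex_of_real ((\<Sum>i<n. (cmod (A $$ (i, j)))\<^sup>2) + (\<Sum>i<n. (cmod (C $$ (i, j)))\<^sup>2)) = 0"
      using A C ij gram by (simp add: sq_carrier sq_index del: index_mult_mat(1))
    then have "(\<Sum>i<n. (cmod (A $$ (i, j)))\<^sup>2) + (\<Sum>i<n. (cmod (C $$ (i, j)))\<^sup>2) = 0"
      by (simp only: of_real_eq_0_iff)
    then have "(\<Sum>i<n. (cmod (A $$ (i, j)))\<^sup>2) = 0" "(\<Sum>i<n. (cmod (C $$ (i, j)))\<^sup>2) = 0"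
      by (simp_all add: add_nonneg_eq_0_iff sum_nonneg)
    then show ?thesis using ij by (simp add: sum_nonneg_eq_0_iff)
  qed
  then show "A = 0\<^sub>m n n" "C = 0\<^sub>m n n" using A C by (auto intro!: sq_eqI[of _ n])
qed

text \<open>The projection onto \<open>exp(tB) V\<close> is \<open>A R A\<^sup>*\<close>, where \<open>A = exp(tB) P\<^sub>0\<close> and \<open>R\<close> is the inverse of
  \<open>A\<^sup>* A + (1 - P\<^sub>0)\<close>.\<close>
theorem flow_exists:
  assumes N: "N \<in> lie_u n" and g0: "g0 \<in> unitary_group n" and "k \<le> n"
  obtains L where "L 0 = \<i> \<cdot>\<^sub>m flag_proj k g0" "\<And>t. L t \<in> adj_orbit n (omega k)"
    "\<And>t. has_mat_derivative n L (grad_field N (L t)) t"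
proof -
  define B where "B = flow_gen N"
  have Nc: "N \<in> sq_mat" by (rule lie_u_carrier[OF N])
  have B: "B \<in> sq_mat" unfolding B_def by (rule flow_gen_carrier[OF Nc])
  have Ba: "mat_adjoint B = B" unfolding B_def by (rule flow_gen_adjoint[OF N])
  define P0 where "P0 = flag_proj k g0"
  note g0c = unitary_carrier[OF g0]
  have P0: "P0 \<in> sq_mat" "mat_adjoint P0 = P0" "P0 * P0 = P0"
    unfolding P0_def using g0 g0c by (simp_all add: flag_proj_carrier flag_proj_adjoint flag_proj_idem)
  have P0P0: "P0 * (P0 * X) = P0 * X" if "X \<in> sq_mat" for X
    using P0 that assoc_mult_mat[of P0 n n P0 n X n] by simp
  let ?E = "mat_exp n B" and ?F = "mat_exp n (- B)"
  define A where "A t = ?E t * P0" for t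
  define As where "As t = mat_adjoint (A t)" for t
  define Q0 where "Q0 = 1\<^sub>m n + (-1) \<cdot>\<^sub>m P0"
  define S where "S t = As t * A t + Q0" for t
  have c: "A t \<in> sq_mat" "As t \<in> sq_mat" "S t \<in> sq_mat" for t
    using P0 by (simp_all add: A_def As_def S_def Q0_def sq_carrier)
  have Q0: "Q0 \<in> sq_mat" using P0 by (simp add: Q0_def sq_carrier)
  have Q0': "mat_adjoint Q0 = Q0" "Q0 * Q0 = Q0" "P0 * Q0 = 0\<^sub>m n n" "Q0 * P0 = 0\<^sub>m n n"
    unfolding Q0_def using P0(1)
    by (intro sq_eqI[of _ n]; simp only: sq_carrier sq_ring P0 mat_adjoint_add[of _ n] mat_adjoint_smult
        mat_adjoint_one sq_index smult_smult_mat; simp add: P0)+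
  have AP0: "A t * P0 = A t" for t unfolding A_def using P0(1) by (simp only: sq_carrier sq_ring P0)
  have P0As: "P0 * As t = As t" for t
    using arg_cong[OF AP0[of t], of mat_adjoint] mat_adjoint_mult[OF c(1) P0(1)] P0 by (simp add: As_def)
  have Sa: "mat_adjoint (S t) = S t" for t
    unfolding S_def using c Q0 by (simp add: mat_adjoint_add[of _ n] mat_adjoint_mult[of _ n] As_def
        mat_adjoint_adjoint Q0' sq_carrier)
  have "det (S t) \<noteq> 0" for t
  proof
    assume "det (S t) = 0"
    then obtain v where v: "v \<in> carrier_vec n" "v \<noteq> 0\<^sub>v n" "S t *\<^sub>v v = 0\<^sub>v n"
      using det_0_iff_vec_prod_zero_field[OF c(3)] by blast
    \<comment> \<open>The kernel vector is repeated in every column of X, so that matrix identities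
      apply to it. Sandwiching S between X and its adjoint gives the Gram matrices of A X and Q0
      X.\<close>
    define X where "X = mat n n (\<lambda>(i, j). v $ i)"
    have X: "X \<in> sq_mat" by (simp add: X_def)
    have "S t * X = 0\<^sub>m n n"
    proof (rule sq_eqI[of _ n])
      fix i j assume ij: "i < n" "j < n"
      have "(S t *\<^sub>v v) $ i = 0" using v ij by simp
      then show "(S t * X) $$ (i, j) = 0\<^sub>m n n $$ (i, j)"
        using ij v(1) c(3)[of t] by (simp add: X_def scalar_prod_def)
    qed (use c X in \<open>auto simp: sq_carrier\<close>)
    moreover have "mat_adjoint (A t * X) * (A t * X) + mat_adjoint (Q0 * X) * (Q0 * X) =
        mat_adjoint X * (S t * X)"
    proof -
      have q: "Q0 * (Q0 * X) = Q0 * X" using Q0 X Q0'(2) assoc_mult_mat[of Q0 n n Q0 n X n] by simp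
      show ?thesis
        unfolding S_def using c(1,2)[of t] X Q0
        by (simp only: mat_adjoint_mult[of _ n] As_def[symmetric] Q0' sq_carrier sq_ring q)
    qed
    ultimately have "mat_adjoint (A t * X) * (A t * X) + mat_adjoint (Q0 * X) * (Q0 * X) = 0\<^sub>m n n"
      using X by simp
    from gram_sum_zero[OF _ _ this] have 0: "A t * X = 0\<^sub>m n n" "Q0 * X = 0\<^sub>m n n"
      using c X Q0 by (simp_all add: sq_carrier)
    have "P0 * X = (?F t * ?E t) * (P0 * X)" using mat_exp_uminus_mult(1)[OF B] P0 X by simp
    also have "\<dots> = ?F t * (A t * X)" unfolding A_def using P0(1) X by (simp only: sq_carrier sq_ring)
    also have "\<dots> = 0\<^sub>m n n" unfolding 0 by (simp add: right_mult_zero_mat[of _ n n])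
    finally have P0X: "P0 * X = 0\<^sub>m n n" .
    have "Q0 * X = X + (-1) \<cdot>\<^sub>m (P0 * X)"
      unfolding Q0_def using P0(1) X by (simp only: sq_carrier sq_ring)
    then have "X = 0\<^sub>m n n" using X unfolding 0 P0X by (metis right_add_zero_mat smult_zero_mat)
    have "v $ i = 0" if "i < n" for i
    proof -
      have "X $$ (i, i) = 0" using \<open>X = 0\<^sub>m n n\<close> that by simp
      then show ?thesis using that by (simp add: X_def)
    qed
    then have "v = 0\<^sub>v n" using v(1) by (intro eq_vecI) auto
    with v(2) show False by simp
  qed
  then have "\<forall>t. \<exists>R. R \<in> sq_mat \<and> R * S t = 1\<^sub>m n \<and> S t * R = 1\<^sub>m n"
    using obtain_inverse[OF c(3)] by metis
  then obtain R where R: "\<And>t. R t \<in> sq_mat" "\<And>t. R t * S t = 1\<^sub>m n" "\<And>t. S t * R t = 1\<^sub>m n" by metis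
  \<comment> \<open>Since A P0 = A and Q0 P0 = 0, the summand Q0 that makes S invertible drops out.
    Multiplied by R this is \<open>RAsA\<close>, the source of the idempotence and of the trace of
    P.\<close>
  have AsA: "As t * A t = S t * P0" for t
  proof -
    have "S t * P0 = As t * (A t * P0) + Q0 * P0"
      unfolding S_def using c(1,2)[of t] Q0 P0(1) by (simp only: sq_carrier sq_ring)
    then show ?thesis using c(1,2)[of t] by (simp add: AP0 Q0' right_add_zero_mat[of _ n n] sq_carrier)
  qed
  have RSX: "R t * (S t * X) = X" if "X \<in> sq_mat" for t X
    using assoc_mult_mat[OF R(1)[of t] c(3)[of t] that] R(2)[of t] that by simp
  have RAsA: "R t * (As t * A t) = P0" for t unfolding AsA by (rule RSX[OF P0(1)])
  have Ra: "mat_adjoint (R t) = R t" for t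
  proof -
    have "mat_adjoint (R t * S t) = S t * mat_adjoint (R t)"
      by (subst mat_adjoint_mult[OF R(1) c(3)]) (simp only: Sa)
    then have "S t * mat_adjoint (R t) = 1\<^sub>m n" using R(2) by (simp add: mat_adjoint_one)
    then have "R t * 1\<^sub>m n = mat_adjoint (R t)" using RSX[of "mat_adjoint (R t)" t] R(1)[of t] by simp
    then show ?thesis using R(1)[of t] by simp
  qed
  define P where "P t = A t * (R t * As t)" for t
  have P: "P t \<in> sq_mat" for t unfolding P_def using c R by (simp add: sq_carrier)
  have PA: "P t * A t = A t" for t
  proof -
    have "P t * A t = A t * (R t * (As t * A t))"
      unfolding P_def using c(1,2)[of t] R(1)[of t] by (simp only: sq_carrier sq_ring)
    then show ?thesis by (simp add: RAsA AP0)
  qed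
  have PP: "P t * P t = P t" for t
  proof -
    have "P t * P t = (P t * A t) * (R t * As t)"
      using c(1,2)[of t] R(1)[of t] P[of t] by (subst (2) P_def) (simp only: sq_carrier sq_ring)
    also have "\<dots> = P t" unfolding PA by (rule P_def[symmetric])
    finally show ?thesis .
  qed
  have Pa: "mat_adjoint (P t) = P t" for t
    unfolding P_def using c(1,2)[of t] R(1)[of t]
    by (simp only: mat_adjoint_mult[of _ n] Ra As_def mat_adjoint_adjoint sq_carrier sq_ring)
  have Ptr: "mat_trace (P t) = mat_trace (coord_proj k)" for t
  proof -
    have "mat_trace (P t) = mat_trace ((R t * As t) * A t)"
      unfolding P_def using c(1,2)[of t] R(1)[of t] by (intro mat_trace_commute) (simp_all add: sq_carrier)
    also have "(R t * As t) * A t = P0" using c(1,2)[of t] R(1)[of t] by (simp only: sq_carrier sq_ring RAsA)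
    finally show ?thesis unfolding P0_def by (simp add: flag_proj_trace[OF g0])
  qed
  have orbit: "\<i> \<cdot>\<^sub>m P t \<in> adj_orbit n (omega k)" for t
  proof -
    \<comment> \<open>An orthonormal frame of the moved subspace comes from factoring exp(tB) g0;
      its first k columns are combinations of those of A g0.\<close>
    define G where "G = ?E t * g0"
    have G: "G \<in> sq_mat" unfolding G_def using g0c by (simp add: sq_carrier)
    have "det (?F t) * det (?E t) = 1"
      using det_mult[of "?F t" n "?E t"] mat_exp_uminus_mult(1)[OF B, of t] by simp
    moreover have "det (mat_adjoint g0) * det g0 = 1"
      using det_mult[of "mat_adjoint g0" n g0] unitary_left[OF g0] g0c by simp
    ultimately have "det (?E t) \<noteq> 0" "det g0 \<noteq> 0" by (metis mult_zero_right zero_neq_one)+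
    then have "det G \<noteq> 0" unfolding G_def det_mult[OF mat_exp_carrier(1) g0c] by simp
    obtain g U r where g: "g \<in> unitary_group n"
      "\<And>i b. i < n \<Longrightarrow> b < n \<Longrightarrow> g $$ (i, b) = (\<Sum>l<n. G $$ (i, l) * U l b)"
      "\<And>b l. b < n \<Longrightarrow> b < l \<Longrightarrow> U l b = 0"
      "\<And>b. b < n \<Longrightarrow> U b b = complex_of_real (r b) \<and> 0 < r b"
      by (rule unitary_factorization[OF G \<open>det G \<noteq> 0\<close>]) (rule that)
    have Ag: "A t * g0 = G * coord_proj k"
    proof -
      have "A t * g0 = ?E t * (P0 * g0)" unfolding A_def using P0(1) g0c by (simp only: sq_carrier sq_ring)
      also have "P0 * g0 = g0 * coord_proj k" unfolding P0_def by (rule flag_proj_mult_frame[OF g0])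
      also have "?E t * (g0 * coord_proj k) = G * coord_proj k"
        unfolding G_def using g0c coord_proj_carrier[of k] by (simp only: sq_carrier sq_ring)
      finally show ?thesis .
    qed
    have "P t = flag_proj k g"
    proof (rule projection_eq_flag_proj[OF P Pa PP Ptr, where X = "A t * g0"])
      show "A t * g0 \<in> sq_mat" using c g0c by (simp add: sq_carrier)
      have "P t * (A t * g0) = (P t * A t) * g0"
        using P[of t] c(1)[of t] g0c by (simp only: sq_carrier sq_ring)
      then show "(P t * (A t * g0)) $$ (i, b) = (A t * g0) $$ (i, b)" for i b by (simp only: PA)
      have "g $$ (i, b) = (\<Sum>a<k. (A t * g0) $$ (i, a) * U a b)" if "i < n" "b < k" for i b
      proof -
        have "g $$ (i, b) = (\<Sum>l<n. G $$ (i, l) * U l b)" using g(2) that \<open>k \<le> n\<close> by simp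
        also have "\<dots> = (\<Sum>a<k. G $$ (i, a) * U a b)"
          using \<open>k \<le> n\<close> that g(3) by (intro sum.mono_neutral_right) auto
        also have "\<dots> = (\<Sum>a<k. (A t * g0) $$ (i, a) * U a b)"
          unfolding Ag using that \<open>k \<le> n\<close> G by (intro sum.cong refl) (simp add: mult_coord_proj_index del: index_mult_mat(1))
        finally show ?thesis .
      qed
      then show "col_span n k (\<lambda>i b. (A t * g0) $$ (i, b)) (\<lambda>i b. g $$ (i, b))"
        unfolding col_span_def by blast
    qed (use g \<open>k \<le> n\<close> in auto)
    then show ?thesis
      unfolding adj_orbit_def using conj_diag_omega[OF unitary_carrier[OF g(1)], of k] g(1) by (metis imageI)
  qed
  have dP: "has_mat_derivative n P (riccati B (P t)) t" for t
  proof -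
    have dA: "has_mat_derivative n A (B * A t) t"
    proof -
      have "has_mat_derivative n (\<lambda>s. ?E s * P0) (B * ?E t * P0 + ?E t * 0\<^sub>m n n) t"
        using B P0 by (intro has_mat_derivative_mult mat_exp_has_derivative has_mat_derivative_const)
          (auto simp: sq_carrier)
      moreover have "B * ?E t * P0 + ?E t * 0\<^sub>m n n = B * A t"
        unfolding A_def using B P0(1)
        by (simp add: sq_carrier sq_ring right_add_zero_mat[of _ n n] del: assoc_mult_mat)
      moreover have "A = (\<lambda>s. ?E s * P0)" by (rule ext) (rule A_def)
      ultimately show ?thesis by simp
    qed
    have BA: "B * A t \<in> sq_mat" using B c by (simp add: sq_carrier)
    have dAs: "has_mat_derivative n As (As t * B) t"
    proof -
      have "As = (\<lambda>s. mat_adjoint (A s))" by (rule ext) (rule As_def)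
      then show ?thesis
        using has_mat_derivative_adjoint[OF c(1) BA dA] mat_adjoint_mult[OF B c(1)] Ba by simp
    qed
    define S' where "S' = As t * B * A t + As t * (B * A t) + 0\<^sub>m n n"
    have S': "S' \<in> sq_mat" unfolding S'_def using B c by (simp add: sq_carrier)
    have "S = (\<lambda>s. As s * A s + Q0)" by (rule ext) (rule S_def)
    then have dS: "has_mat_derivative n S S' t"
      unfolding S'_def using B c Q0 dA dAs
      by (simp, intro has_mat_derivative_add has_mat_derivative_mult has_mat_derivative_const)
        (auto simp: sq_carrier)
    have dR: "has_mat_derivative n R (- (R t * (S' * R t))) t"
      by (rule inverse_has_derivative[OF c(3) R(1,2) S' dS])
    have "P = (\<lambda>s. A s * (R s * As s))" by (rule ext) (rule P_def)
    then have "has_mat_derivative n P (B * A t * (R t * As t) +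
        A t * (- (R t * (S' * R t)) * As t + R t * (As t * B))) t"
      using B c R S' dA dAs dR
      by (simp, intro has_mat_derivative_mult) (auto simp: sq_carrier)
    \<comment> \<open>Differentiating R brings in -R S' R, and the two equal halves of S' produce
      the term -2 P B P.\<close>
    also have "B * A t * (R t * As t) + A t * (- (R t * (S' * R t)) * As t + R t * (As t * B)) = riccati B (P t)"
      unfolding riccati_def P_def S'_def using c(1,2)[of t] R(1)[of t] B
      by (intro sq_eqI[of _ n]; simp only: sq_carrier sq_ring sq_index;
        simp add: sq_index sq_carrier del: index_mult_mat(1) assoc_mult_mat)
    finally show ?thesis .
  qed
  have P_0: "P 0 = P0"
  proof -
    have A0: "A 0 = P0" "As 0 = P0" using P0 B by (simp_all add: A_def As_def mat_exp_zero)
    have "S 0 = 1\<^sub>m n"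
      unfolding S_def A0 P0 Q0_def using P0(1) by (intro sq_eqI[of _ n]) (auto simp: sq_carrier sq_index)
    then have "R 0 = 1\<^sub>m n" using R(1,2)[of 0] by simp
    then show ?thesis unfolding P_def A0 using P0 by simp
  qed
  show thesis
  proof (rule that[of "\<lambda>t. \<i> \<cdot>\<^sub>m P t"])
    show "\<i> \<cdot>\<^sub>m P 0 = \<i> \<cdot>\<^sub>m flag_proj k g0" by (simp add: P_0 P0_def)
    show "\<i> \<cdot>\<^sub>m P t \<in> adj_orbit n (omega k)" for t by (rule orbit)
    show "has_mat_derivative n (\<lambda>t. \<i> \<cdot>\<^sub>m P t) (grad_field N (\<i> \<cdot>\<^sub>m P t)) t" for t
      unfolding grad_field_riccati[OF P PP Nc] B_def[symmetric]
      using dP P B by (intro has_mat_derivative_smult) (auto simp: riccati_def sq_carrier)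
  qed
qed

section \<open>Positivity of the flow\<close>

abbreviation "frame_minor k g \<equiv> pluecker k (\<lambda>i b. g $$ (i, b) :: complex)"

lemma unitary_pos_minor:
  assumes "g \<in> unitary_pos n" "I \<in> ksets n k"
  shows "0 < frame_minor k g I"
proof -
  have g: "g \<in> sq_mat" using assms(1) by (simp add: unitary_pos_def unitary_group_def)
  have "I \<subseteq> {..<n}" "card I = k" using assms(2) by (auto simp: ksets_def)
  then have "det (submatrix g I {..<card I}) \<in> \<real> \<and> 0 < Re (det (submatrix g I {..<card I}))"
    using assms(1) unfolding unitary_pos_def by blast
  then show ?thesis
    unfolding \<open>card I = k\<close> det_submatrix_eq_pluecker[OF g assms(2)] less_complex_def
    by (simp add: complex_is_Real_iff)
qed

lemma unitary_minor_nonzero: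
  assumes g: "g \<in> unitary_group n" and "k \<le> n"
  shows "\<exists>I\<in>ksets n k. frame_minor k g I \<noteq> 0"
proof (rule ccontr)
  assume "\<not> ?thesis"
  then have z: "\<forall>I\<in>ksets n k. frame_minor k g I = 0" by blast
  have "\<forall>I\<in>ksets n m. frame_minor m g I = 0" if "k \<le> m" for m
    using that
  proof (induction rule: dec_induct)
    case (step m)
    show ?case
    proof
      fix I assume I: "I \<in> ksets n (Suc m)"
      show "frame_minor (Suc m) g I = 0" by (rule pluecker_zero_Suc[OF _ I]) (rule step.IH[rule_format])
    qed
  qed (rule z)
  from this[OF \<open>k \<le> n\<close>] have "\<forall>I\<in>ksets n n. frame_minor n g I = 0" .
  moreover have "{..<n} \<in> ksets n n" by (simp add: ksets_def)
  moreover have "frame_minor n g {..<n} = det g"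
    unfolding pluecker_def minor_def lessThan_atLeast0 sorted_list_of_set_range
    using unitary_carrier[OF g] by (intro arg_cong[of _ _ det] eq_matI) auto
  moreover have "det (mat_adjoint g) * det g = 1"
    using det_mult[OF mat_adjoint_carrier unitary_carrier[OF g], OF unitary_carrier[OF g]] unitary_left[OF g]
    by simp
  ultimately show False by (metis mult_zero_right zero_neq_one)
qed

text \<open>The rank k case of Cauchy-Binet. The left side is built from the projection alone, so
  these products do not depend on the frame and pass to limits, unlike single minors.\<close>

lemma flag_proj_minor:
  assumes g: "g \<in> sq_mat" and "k \<le> n" and I: "I \<in> ksets n k" and J: "J \<in> ksets n k"
  shows "pluecker k (\<lambda>i b. flag_proj k g $$ (i, sorted_list_of_set J ! b)) I =
    frame_minor k g I * cnj (frame_minor k g J)"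
proof -
  let ?xs = "sorted_list_of_set J"
  have "pluecker k (\<lambda>i b. flag_proj k g $$ (i, ?xs ! b)) I =
      frame_minor k g I * det (mat k k (\<lambda>(c, b). cnj (g $$ (?xs ! b, c))))"
    by (rule pluecker_mult[OF I]) (use ksets_nth(2)[OF J] g \<open>k \<le> n\<close> in \<open>simp add: flag_proj_index\<close>)
  also have "mat k k (\<lambda>(c, b). cnj (g $$ (?xs ! b, c))) = transpose_mat (mat k k (\<lambda>(b, c). cnj (g $$ (?xs ! b, c))))"
    by (rule eq_matI) auto
  also have "det \<dots> = minor k (\<lambda>i b. cnj (g $$ (i, b))) ?xs"
    unfolding minor_def by (rule det_transpose[of _ k]) simp
  finally show ?thesis unfolding minor_cnj by (simp add: pluecker_def)
qed

lemma smult_i_cancel: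
  assumes "A \<in> sq_mat" "C \<in> sq_mat" "\<i> \<cdot>\<^sub>m A = \<i> \<cdot>\<^sub>m C"
  shows "A = C"
  using arg_cong[OF assms(3), of "\<lambda>X. (-\<i>) \<cdot>\<^sub>m X"] by (simp add: smult_smult_mat one_smult_mat)

lemma orbit_pos_iff: "L \<in> orbit_pos n (omega k) \<longleftrightarrow> (\<exists>g\<in>unitary_pos n. L = \<i> \<cdot>\<^sub>m flag_proj k g)"
proof -
  have "conj_diag n (omega k) g = \<i> \<cdot>\<^sub>m flag_proj k g" if "g \<in> unitary_pos n" for g
    using that by (intro conj_diag_omega) (simp add: unitary_pos_def unitary_group_def)
  then show ?thesis unfolding orbit_pos_def by auto
qed

lemma unitary_pos_unitary: "g \<in> unitary_pos n \<Longrightarrow> g \<in> unitary_group n"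
  by (simp add: unitary_pos_def)

text \<open>Convergence in the orbit does not provide convergent frames. The limit is therefore
  taken in the products of \<open>flag_proj_minor\<close>, which are positive along the
  sequence.\<close>

lemma orbit_nonneg_minors:
  assumes L: "\<i> \<cdot>\<^sub>m flag_proj k g0 \<in> orbit_nonneg n (omega k)" and g0: "g0 \<in> unitary_group n"
    and "k \<le> n" and I: "I \<in> ksets n k" and J: "J \<in> ksets n k"
  shows "0 \<le> frame_minor k g0 I * cnj (frame_minor k g0 J)"
proof -
  obtain s where s: "\<And>m::nat. s m \<in> orbit_pos n (omega k)"
    "\<And>i j. i < n \<Longrightarrow> j < n \<Longrightarrow> (\<lambda>m. s m $$ (i, j)) \<longlonglongrightarrow> (\<i> \<cdot>\<^sub>m flag_proj k g0) $$ (i, j)"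
    using L unfolding orbit_nonneg_def mat_closure_def by blast
  then have "\<forall>m. \<exists>g. g \<in> unitary_pos n \<and> s m = \<i> \<cdot>\<^sub>m flag_proj k g" using orbit_pos_iff by blast
  then obtain g where g: "\<And>m. g m \<in> unitary_pos n" "\<And>m. s m = \<i> \<cdot>\<^sub>m flag_proj k (g m)" by metis
  have gc: "g m \<in> sq_mat" for m by (rule unitary_carrier[OF unitary_pos_unitary[OF g(1)]])
  note c = flag_proj_carrier[OF gc] flag_proj_carrier[OF unitary_carrier[OF g0]]
  have lim: "(\<lambda>m. flag_proj k (g m) $$ (i, j)) \<longlonglongrightarrow> flag_proj k g0 $$ (i, j)" if ij: "i < n" "j < n" for i j
  proof -
    have "(\<lambda>m. - \<i> * s m $$ (i, j)) \<longlonglongrightarrow> - \<i> * (\<i> \<cdot>\<^sub>m flag_proj k g0) $$ (i, j)"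
      by (intro tendsto_mult tendsto_const s(2) ij)
    then show ?thesis using ij c unfolding g(2) by (simp add: sq_index mult.assoc[symmetric])
  qed
  have "(\<lambda>m. pluecker k (\<lambda>i b. flag_proj k (g m) $$ (i, sorted_list_of_set J ! b)) I)
      \<longlonglongrightarrow> pluecker k (\<lambda>i b. flag_proj k g0 $$ (i, sorted_list_of_set J ! b)) I"
    unfolding pluecker_def
    by (rule minor_tendsto) (use lim ksets_nth(2)[OF I] ksets_nth(2)[OF J] in auto)
  then have tends: "(\<lambda>m. frame_minor k (g m) I * cnj (frame_minor k (g m) J))
      \<longlonglongrightarrow> frame_minor k g0 I * cnj (frame_minor k g0 J)"
    by (simp add: flag_proj_minor[OF gc \<open>k \<le> n\<close> I J] flag_proj_minor[OF unitary_carrier[OF g0] \<open>k \<le> n\<close> I J])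
  have pos: "0 \<le> Re (frame_minor k (g m) I * cnj (frame_minor k (g m) J))"
    "Im (frame_minor k (g m) I * cnj (frame_minor k (g m) J)) = 0" for m
    using unitary_pos_minor[OF g(1) I, of m] unitary_pos_minor[OF g(1) J, of m]
    by (auto simp: less_complex_def)
  have "0 \<le> Re (frame_minor k g0 I * cnj (frame_minor k g0 J))"
    by (rule LIMSEQ_le_const[OF tendsto_Re[OF tends]]) (use pos in blast)
  moreover have "Im (frame_minor k g0 I * cnj (frame_minor k g0 J)) = 0"
    using tendsto_Im[OF tends] unfolding pos by (simp add: LIMSEQ_const_iff)
  ultimately show ?thesis by (simp add: less_eq_complex_def)
qed

text \<open>\<open>flag_proj k g\<close> fixes the first k columns of g. This passes between the
  form in which \<open>flow_span\<close> is stated and the plain frame exp(tB) g0.\<close>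

lemma exp_frame:
  assumes E: "E \<in> sq_mat" and g: "g \<in> unitary_group n" and "i < n" "b < k" "k \<le> n"
  shows "(E * flag_proj k g * g) $$ (i, b) = (E * g) $$ (i, b)"
proof -
  note gc = unitary_carrier[OF g]
  have "E * flag_proj k g * g = E * (flag_proj k g * g)"
    using E gc flag_proj_carrier[OF gc] by (simp only: sq_ring)
  also have "\<dots> = E * g * coord_proj k"
    unfolding flag_proj_mult_frame[OF g] using E gc coord_proj_carrier by (simp only: sq_ring sq_carrier)
  finally show ?thesis using assms gc by (simp add: mult_coord_proj_index sq_carrier del: index_mult_mat(1))
qed

lemma flow_span_frame:
  assumes L: "\<And>t. L t \<in> adj_orbit n (omega k)" "\<And>t. has_mat_derivative n L (grad_field N (L t)) t"
    and N: "N \<in> sq_mat" and L0: "L 0 = \<i> \<cdot>\<^sub>m flag_proj k g0" and g0: "g0 \<in> unitary_group n" and "0 \<le> t"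
  obtains P g where "L t = \<i> \<cdot>\<^sub>m P" "g \<in> unitary_group n" "P = flag_proj k g"
    "P * (mat_exp n (flow_gen N) t * flag_proj k g0 * g0) = mat_exp n (flow_gen N) t * flag_proj k g0 * g0"
proof -
  obtain P g where P: "\<And>t. L t = \<i> \<cdot>\<^sub>m P t" "\<And>t. g t \<in> unitary_group n" "\<And>t. P t = flag_proj k (g t)"
    "\<And>t. has_mat_derivative n P (riccati (flow_gen N) (P t)) t"
    by (rule flow_projections[OF L N]) (rule that)
  let ?E = "mat_exp n (flow_gen N) t"
  have c: "P s \<in> sq_mat" for s unfolding P(3) by (rule flag_proj_carrier[OF unitary_carrier[OF P(2)]])
  have g0c: "g0 \<in> sq_mat" by (rule unitary_carrier[OF g0])
  have P0: "P 0 = flag_proj k g0"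
    using L0 unfolding P(1) by (rule smult_i_cancel[OF c flag_proj_carrier[OF g0c]])
  have "P t * (?E * P 0) = ?E * P 0"
    by (rule flow_span[OF P(2,3,4) flow_gen_carrier[OF N] \<open>0 \<le> t\<close>])
  then have "P t * (?E * P 0) * g0 = ?E * P 0 * g0" by simp
  then have "P t * (?E * P 0 * g0) = ?E * P 0 * g0"
    using c[of t] c[of 0] g0c by (simp only: sq_carrier sq_ring)
  with that[OF P(1,2,3)] show thesis unfolding P0 by blast
qed

theorem flow_positive:
  assumes L: "\<And>t. L t \<in> adj_orbit n (omega k)" "\<And>t. has_mat_derivative n L (grad_field N (L t)) t"
    and N: "N \<in> sq_mat" and L0: "L 0 = \<i> \<cdot>\<^sub>m flag_proj k g0" and g0: "g0 \<in> unitary_group n"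
    and "k \<le> n"
    and b: "\<And>i j. i < n \<Longrightarrow> j < n \<Longrightarrow> flow_gen N $$ (i, j) = complex_of_real (b i j)"
    and sign: "\<And>I x y. I \<in> ksets n k \<Longrightarrow> x \<in> I \<Longrightarrow> y < n \<Longrightarrow> y \<notin> I \<Longrightarrow>
      0 \<le> (-1) ^ exchange_inv I x y * b x y"
    and \<sigma>: "bij_betw \<sigma> {..<n} {..<n}"
    and path: "\<And>p. Suc p < n \<Longrightarrow> b (\<sigma> p) (\<sigma> (Suc p)) \<noteq> 0 \<and> b (\<sigma> (Suc p)) (\<sigma> p) \<noteq> 0"
    and init: "\<And>I J. I \<in> ksets n k \<Longrightarrow> J \<in> ksets n k \<Longrightarrow> 0 \<le> frame_minor k g0 I * cnj (frame_minor k g0 J)"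
    and "0 < t"
  shows "L t \<in> orbit_pos n (omega k)"
proof -
  let ?B = "flow_gen N"
  let ?E = "mat_exp n ?B"
  have B: "?B \<in> sq_mat" by (rule flow_gen_carrier[OF N])
  have g0c: "g0 \<in> sq_mat" by (rule unitary_carrier[OF g0])
  obtain J where J: "J \<in> ksets n k" "frame_minor k g0 J \<noteq> 0"
    using unitary_minor_nonzero[OF g0 \<open>k \<le> n\<close>] by blast
  \<comment> \<open>Multiplying by the conjugate of one nonzero initial coordinate removes the
    common phase: all initial coordinates become nonnegative.\<close>
  let ?c = "cnj (frame_minor k g0 J)"
  have E0: "?E 0 * g0 = g0" using g0c by (simp add: mat_exp_zero[OF B])
  have pos: "0 < ?c * frame_minor k (?E t * g0) I" if I: "I \<in> ksets n k" for I
  proof (rule pluecker_positive[where Y = "\<lambda>t i j. (?E t * g0) $$ (i, j)" and b = b and n = n, OF _ sign \<sigma> path])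
    show "((\<lambda>s. (?E s * g0) $$ (i, j)) has_vector_derivative
        (\<Sum>l<n. complex_of_real (b i l) * (?E t * g0) $$ (l, j))) (at t)" if "i < n" "j < k" for i j t
      using mat_exp_column_derivative[OF B g0c, of i j t] that \<open>k \<le> n\<close> b by simp
    show "\<exists>I\<in>ksets n k. ?c * frame_minor k (?E 0 * g0) I \<noteq> 0" unfolding E0 using J by (intro bexI[of _ J]) auto
    show "0 \<le> ?c * frame_minor k (?E 0 * g0) I" if "I \<in> ksets n k" for I
      unfolding E0 using init[OF that J(1)] by (simp only: mult.commute)
  qed (use I \<open>0 < t\<close> in auto)
  obtain g where g: "g \<in> unitary_pos n" "col_span n k (\<lambda>i b. (?E t * g0) $$ (i, b)) (\<lambda>i b. g $$ (i, b))"
    by (rule positive_subspace_extends_to_flag[OF \<open>k \<le> n\<close> pos]) (assumption | rule that)+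
  obtain P h where P: "L t = \<i> \<cdot>\<^sub>m P" "h \<in> unitary_group n" "P = flag_proj k h"
    "P * (?E t * flag_proj k g0 * g0) = ?E t * flag_proj k g0 * g0"
    by (rule flow_span_frame[OF L N L0 g0 less_imp_le[OF \<open>0 < t\<close>]]) (rule that)
  note hc = unitary_carrier[OF P(2)]
  have "P = flag_proj k g"
  proof (rule projection_eq_flag_proj[where X = "?E t * flag_proj k g0 * g0"])
    show "col_span n k (\<lambda>i b. (?E t * flag_proj k g0 * g0) $$ (i, b)) (\<lambda>i b. g $$ (i, b))"
      using g(2) \<open>k \<le> n\<close> unfolding col_span_def by (simp add: exp_frame[OF _ g0] del: index_mult_mat(1))
    show "?E t * flag_proj k g0 * g0 \<in> sq_mat" using flag_proj_carrier[OF g0c] g0c by (simp add: sq_carrier)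
  qed (use P g \<open>k \<le> n\<close> hc in \<open>simp_all add: flag_proj_carrier flag_proj_adjoint flag_proj_idem flag_proj_trace
        unitary_pos_unitary del: index_mult_mat(1)\<close>)
  then show ?thesis using P(1) g(1) orbit_pos_iff by blast
qed

text \<open>On their first k columns, the moved frame exp(tB) g0 is a positive frame g of the same
  point times a k x k matrix. Its determinant is the common factor \<delta>, and the minors of g are
  the positive ratios.\<close>

lemma flow_minor_ratio:
  assumes L: "\<And>t. L t \<in> adj_orbit n (omega k)" "\<And>t. has_mat_derivative n L (grad_field N (L t)) t"
    and N: "N \<in> sq_mat" and L0: "L 0 = \<i> \<cdot>\<^sub>m flag_proj k g0" and g0: "g0 \<in> unitary_group n"
    and "k \<le> n" and "0 \<le> t" and pos: "L t \<in> orbit_pos n (omega k)"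
  obtains \<delta> r where "\<And>I. I \<in> ksets n k \<Longrightarrow> 0 < r I \<and>
    frame_minor k (mat_exp n (flow_gen N) t * g0) I = complex_of_real (r I) * \<delta>"
proof -
  let ?E = "mat_exp n (flow_gen N) t"
  let ?X = "?E * flag_proj k g0 * g0"
  have g0c: "g0 \<in> sq_mat" by (rule unitary_carrier[OF g0])
  have X: "?X \<in> sq_mat" using flag_proj_carrier[OF g0c] g0c by (simp add: sq_carrier)
  obtain P h where P: "L t = \<i> \<cdot>\<^sub>m P" "h \<in> unitary_group n" "P = flag_proj k h" "P * ?X = ?X"
    by (rule flow_span_frame[OF L N L0 g0 \<open>0 \<le> t\<close>]) (rule that)
  obtain g where g: "g \<in> unitary_pos n" "L t = \<i> \<cdot>\<^sub>m flag_proj k g" using pos orbit_pos_iff by blast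
  note gc = unitary_carrier[OF unitary_pos_unitary[OF g(1)]]
  have Pc: "P \<in> sq_mat" unfolding P(3) by (rule flag_proj_carrier[OF unitary_carrier[OF P(2)]])
  have Pg: "P = flag_proj k g"
    using P(1) g(2) by (intro smult_i_cancel[OF Pc flag_proj_carrier[OF gc]]) simp
  \<comment> \<open>P fixes \<open>?X\<close> and projects onto the first k columns of g, so the
    coefficients of \<open>?X\<close> are its inner products with these columns.\<close>
  define C where "C c b = (\<Sum>l<n. cnj (g $$ (l, c)) * ?X $$ (l, b))" for c b
  have Y: "(?E * g0) $$ (i, b) = (\<Sum>c<k. g $$ (i, c) * C c b)" if ib: "i < n" "b < k" for i b
  proof -
    have "(?E * g0) $$ (i, b) = (P * ?X) $$ (i, b)"
      unfolding P(4) using ib exp_frame[OF _ g0, of ?E] \<open>k \<le> n\<close> by simp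
    also have "\<dots> = (\<Sum>l<n. \<Sum>c<k. g $$ (i, c) * cnj (g $$ (l, c)) * ?X $$ (l, b))"
      using sq_mult_index[OF Pc X, of i b] ib \<open>k \<le> n\<close> gc
      by (simp add: Pg flag_proj_index sum_distrib_right del: index_mult_mat(1))
    also have "\<dots> = (\<Sum>c<k. \<Sum>l<n. g $$ (i, c) * cnj (g $$ (l, c)) * ?X $$ (l, b))" by (rule sum.swap)
    also have "\<dots> = (\<Sum>c<k. g $$ (i, c) * C c b)"
      by (simp add: C_def sum_distrib_left mult.assoc del: index_mult_mat(1))
    finally show ?thesis .
  qed
  have m: "frame_minor k (?E * g0) I = frame_minor k g I * det (mat k k (\<lambda>(c, b). C c b))"
    if "I \<in> ksets n k" for I by (rule pluecker_mult[OF that]) (rule Y)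
  show thesis
  proof (rule that)
    fix I assume I: "I \<in> ksets n k"
    have "0 < frame_minor k g I" by (rule unitary_pos_minor[OF g(1) I])
    then show "0 < Re (frame_minor k g I) \<and>
        frame_minor k (?E * g0) I = complex_of_real (Re (frame_minor k g I)) * det (mat k k (\<lambda>(c, b). C c b))"
      unfolding m[OF I] by (auto simp: less_complex_def complex_eq_iff)
  qed
qed

text \<open>The permutation matrix that lists the indices of \<open>I\<close> first. Its first card
  I columns span a coordinate subspace; the others complete them to a unitary matrix.\<close>

definition coord_frame :: "nat set \<Rightarrow> complex mat" where
  "coord_frame I = mat n n (\<lambda>(i, b).
     if i = (sorted_list_of_set I @ sorted_list_of_set ({..<n} - I)) ! b then 1 else 0)"

lemma coord_frame_unitary:
  assumes I: "I \<in> ksets n k"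
  shows "coord_frame I \<in> unitary_group n"
proof (rule unitaryI)
  let ?zs = "sorted_list_of_set I @ sorted_list_of_set ({..<n} - I)"
  note I' = ksets_nth[OF I]
  show c: "coord_frame I \<in> sq_mat" by (simp add: coord_frame_def)
  have "card I \<le> n" using card_mono[OF _ I'(5)] by simp
  then have len: "length ?zs = n" and dist: "distinct ?zs" and set: "set ?zs = {..<n}"
    using I' by (auto simp: card_Diff_subset)
  show "mat_adjoint (coord_frame I) * coord_frame I = 1\<^sub>m n"
  proof (rule sq_eqI[of _ n])
    fix a b assume ab: "a < n" "b < n"
    have za: "?zs ! a < n" using set len ab by (metis lessThan_iff nth_mem)
    have "(mat_adjoint (coord_frame I) * coord_frame I) $$ (a, b) =
        (\<Sum>i<n. mat_adjoint (coord_frame I) $$ (a, i) * coord_frame I $$ (i, b))"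
      using c ab by (intro sq_mult_index) auto
    also have "\<dots> = (\<Sum>i<n. if i = ?zs ! a then (if ?zs ! a = ?zs ! b then 1 else 0) else 0)"
      using ab c by (intro sum.cong refl) (auto simp: coord_frame_def)
    also have "\<dots> = (if a = b then 1 else 0)"
      using za dist len ab by (simp add: nth_eq_iff_index_eq)
    finally show "(mat_adjoint (coord_frame I) * coord_frame I) $$ (a, b) = 1\<^sub>m n $$ (a, b)"
      using ab by simp
  qed (use c in \<open>auto simp: sq_carrier\<close>)
qed

lemma coord_frame_minor:
  assumes I: "I \<in> ksets n k" and J: "J \<in> ksets n k" and "k \<le> n"
  shows "frame_minor k (coord_frame I) J = (if I = J then 1 else 0)"
proof -
  note I' = ksets_nth[OF I] and J' = ksets_nth[OF J]
  have e: "coord_frame I $$ (i, b) = (if i = sorted_list_of_set I ! b then 1 else 0)" if "i < n" "b < k" for i b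
    using that I'(1) \<open>k \<le> n\<close> by (simp add: coord_frame_def nth_append)
  show ?thesis
  proof (cases "I = J")
    case True
    have "mat k k (\<lambda>(a, b). coord_frame I $$ (sorted_list_of_set I ! a, b)) = 1\<^sub>m k"
      using I' by (intro eq_matI) (auto simp: e nth_eq_iff_index_eq)
    then show ?thesis using True by (simp add: pluecker_def minor_def)
  next
    case False
    have "\<not> J \<subseteq> I" using False card_subset_eq[OF I'(4), of J] I J by (auto simp: ksets_def)
    then obtain x where x: "x \<in> J" "x \<notin> I" by blast
    then obtain a where a: "a < k" "sorted_list_of_set J ! a = x"
      using J' by (metis in_set_conv_nth set_sorted_list_of_set)
    have "x \<noteq> sorted_list_of_set I ! b" if "b < k" for b using I'(3)[OF that] x by auto
    then have "frame_minor k (coord_frame I) J = 0"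
      unfolding pluecker_def using a J'(2)[OF a(1)] by (intro minor_zero_row[of a]) (auto simp: e)
    then show ?thesis using False by simp
  qed
qed

text \<open>The gradient flow of the path matrix moves every coordinate subspace into the positive part at once,
  so coordinate subspaces lie in its closure.\<close>
lemma coord_frame_nonneg:
  assumes I: "I \<in> ksets n k" and "k \<le> n" and "0 < n"
  shows "\<i> \<cdot>\<^sub>m flag_proj k (coord_frame I) \<in> orbit_nonneg n (omega k)"
proof -
  \<comment> \<open>The factor -\<i> makes \<open>flow_gen\<close> a positive multiple of the path
    matrix.\<close>
  let ?N = "(- \<i>) \<cdot>\<^sub>m path_mat n"
  have "path_mat n \<in> sq_mat" by simp
  have N: "?N \<in> lie_u n"
    unfolding lie_u_def mat_adjoint_smult by (auto intro!: sq_eqI[of _ n] simp: path_mat_def path_adj_def)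
  note g0 = coord_frame_unitary[OF I]
  obtain L where L: "L 0 = \<i> \<cdot>\<^sub>m flag_proj k (coord_frame I)" "\<And>t. L t \<in> adj_orbit n (omega k)"
    "\<And>t. has_mat_derivative n L (grad_field ?N (L t)) t"
    by (rule flow_exists[OF N g0 \<open>k \<le> n\<close>]) (rule that)
  have pos: "L t \<in> orbit_pos n (omega k)" if "0 < t" for t
  proof (rule flow_positive[OF L(2,3) lie_u_carrier[OF N] L(1) g0 \<open>k \<le> n\<close>, where \<sigma> = id
        and b = "\<lambda>i j. path_adj i j / (2 * real n)"])
    show "flow_gen ?N $$ (i, j) = complex_of_real (path_adj i j / (2 * real n))" if "i < n" "j < n" for i j
      using that by (simp add: flow_gen_def path_mat_def)
    show "0 \<le> (-1) ^ exchange_inv I x y * (path_adj x y / (2 * real n))" if "x \<in> I" "y \<notin> I" for I x y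
      using exchange_inv_adjacent[OF that] by (auto simp: path_adj_def)
  qed (use that \<open>0 < n\<close> in \<open>auto simp: path_adj_def coord_frame_minor[OF I _ \<open>k \<le> n\<close>] less_eq_complex_def\<close>)
  have "L 0 \<in> sq_mat" unfolding L(1) using flag_proj_carrier[OF unitary_carrier[OF g0]] by (simp add: sq_carrier)
  moreover have "(\<lambda>m. L (1 / real (Suc m)) $$ (i, j)) \<longlonglongrightarrow> L 0 $$ (i, j)" if "i < n" "j < n" for i j
  proof -
    have "((\<lambda>t. L t $$ (i, j)) has_vector_derivative grad_field ?N (L 0) $$ (i, j)) (at 0)"
      using L(3)[of 0] that by (simp add: has_mat_derivative_def)
    then have "isCont (\<lambda>t. L t $$ (i, j)) 0" by (rule has_vector_derivative_continuous)
    moreover have "(\<lambda>m. 1 / real (Suc m)) \<longlonglongrightarrow> 0"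
      using LIMSEQ_inverse_real_of_nat by (simp add: inverse_eq_divide)
    ultimately show ?thesis by (rule isCont_tendsto_compose)
  qed
  moreover have "L (1 / real (Suc m)) \<in> orbit_pos n (omega k)" for m by (rule pos) simp
  ultimately have "L 0 \<in> orbit_nonneg n (omega k)"
    unfolding orbit_nonneg_def mat_closure_def by (intro CollectI conjI exI[of _ "\<lambda>m. L (1 / real (Suc m))"]) auto
  then show ?thesis by (simp only: L(1))
qed

end

section \<open>Cyclic neighbours and the coefficients of the flow\<close>

lemma dvd_small_cases:
  assumes "int n dvd d" "\<bar>d\<bar> < 2 * int n"
  shows "d = 0 \<or> d = int n \<or> d = - int n"
proof -
  obtain q where q: "d = int n * q" using assms(1) by (auto simp: dvd_def)
  have "int n * \<bar>q\<bar> < int n * 2" using assms(2) q by (simp add: abs_mult)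
  then have "\<bar>q\<bar> < 2" using mult_less_cancel_left_pos by (metis linorder_not_less mult_left_mono of_nat_0_le_iff)
  then have "q = 0 \<or> q = 1 \<or> q = -1" by linarith
  then show ?thesis using q by auto
qed

lemma not_cyclically_adjacent_iff:
  assumes "2 \<le> n" "i < n" "j < n"
  shows "\<not> [int i - int j = - 1] (mod int n) \<and> \<not> [int i - int j = 0] (mod int n) \<and>
      \<not> [int i - int j = 1] (mod int n) \<longleftrightarrow>
    i \<noteq> j \<and> i \<noteq> Suc j \<and> j \<noteq> Suc i \<and> {i, j} \<noteq> {0, n - 1}" (is "?l \<longleftrightarrow> ?r")
proof
  assume l: ?l
  show ?r
  proof (intro conjI notI)
    assume "i = j" then show False using l by simp
  next
    assume "i = Suc j" then show False using l by simp
  next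
    assume "j = Suc i" then show False using l by simp
  next
    assume "{i, j} = {0, n - 1}"
    then consider "i = 0" "j = n - 1" | "i = n - 1" "j = 0" by (auto simp: doubleton_eq_iff)
    then show False
    proof cases
      case 1
      then have "int i - int j - 1 = - int n" using assms by simp
      then have "[int i - int j = 1] (mod int n)" by (simp add: cong_iff_dvd_diff)
      then show False using l by simp
    next
      case 2
      then have "int i - int j - (- 1) = int n" using assms by simp
      then have "[int i - int j = - 1] (mod int n)" by (simp only: cong_iff_dvd_diff dvd_refl)
      then show False using l by simp
    qed
  qed
next
  assume r: ?r
  have ne: "\<not> (i = 0 \<and> j = n - 1)" "\<not> (i = n - 1 \<and> j = 0)" using r by auto
  show ?l
  proof (intro conjI notI)
    assume "[int i - int j = - 1] (mod int n)"
    then have "int n dvd int i - int j + 1" by (simp add: cong_iff_dvd_diff)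
    then have "int i - int j + 1 = 0 \<or> int i - int j + 1 = int n \<or> int i - int j + 1 = - int n"
      by (rule dvd_small_cases) (use assms in linarith)
    then show False using r ne assms by (elim disjE) auto
  next
    assume "[int i - int j = 0] (mod int n)"
    then have "int n dvd int i - int j" by (simp add: cong_iff_dvd_diff)
    then have "int i - int j = 0 \<or> int i - int j = int n \<or> int i - int j = - int n"
      by (rule dvd_small_cases) (use assms in linarith)
    then show False using r assms by (elim disjE) auto
  next
    assume "[int i - int j = 1] (mod int n)"
    then have "int n dvd int i - int j - 1" by (simp add: cong_iff_dvd_diff)
    then have "int i - int j - 1 = 0 \<or> int i - int j - 1 = int n \<or> int i - int j - 1 = - int n"
      by (rule dvd_small_cases) (use assms in linarith)
    then show False using r ne assms by (elim disjE) auto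
  qed
qed

lemma skew_entry:
  assumes "N \<in> lie_u n" "i < n" "j < n"
  shows "\<i> * N $$ (j, i) = cnj (\<i> * N $$ (i, j))"
proof -
  have N: "N \<in> carrier_mat n n" "mat_adjoint N = - N" using assms(1) by (auto simp: lie_u_def)
  have "cnj (N $$ (i, j)) = - (N $$ (j, i))"
    using arg_cong[OF N(2), of "\<lambda>A. A $$ (j, i)"] N(1) assms by simp
  then show ?thesis by simp
qed

text \<open>Taking the real part makes the coefficient available before \<i> N is known to be real;
  \<open>flow_gen_real\<close> identifies the two afterwards.\<close>

definition flow_coeff :: "nat \<Rightarrow> complex mat \<Rightarrow> nat \<Rightarrow> nat \<Rightarrow> real" where
  "flow_coeff n N i j = Re (\<i> * N $$ (i, j)) / (2 * real n)"

lemma flow_coeff_sym: "N \<in> lie_u n \<Longrightarrow> i < n \<Longrightarrow> j < n \<Longrightarrow> flow_coeff n N j i = flow_coeff n N i j"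
  unfolding flow_coeff_def by (subst skew_entry) auto

lemma flow_gen_entry:
  assumes "N \<in> carrier_mat n n" "i < n" "j < n"
  shows "flow_gen n N $$ (i, j) = \<i> * N $$ (i, j) / (2 * complex_of_nat n)"
  using assms by (simp add: flow_gen_def)

lemma flow_gen_real:
  assumes "N \<in> carrier_mat n n" "i < n" "j < n" "\<i> * N $$ (i, j) \<in> \<real>"
  shows "flow_gen n N $$ (i, j) = complex_of_real (flow_coeff n N i j)"
proof -
  have "\<i> * N $$ (i, j) = complex_of_real (Re (\<i> * N $$ (i, j)))" using assms(4) by (simp add: complex_is_Real_iff complex_eq_iff)
  then show ?thesis unfolding flow_gen_entry[OF assms(1-3)] flow_coeff_def by (metis of_real_divide of_real_mult of_real_numeral of_real_of_nat_eq)
qed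

lemma cyclic_entry_flow_coeff:
  assumes "0 < n"
  shows "j < n - 1 \<Longrightarrow> cyclic_entry n k N j = 2 * real n * flow_coeff n N j (Suc j)"
    and "\<not> j < n - 1 \<Longrightarrow> cyclic_entry n k N j = 2 * real n * ((-1) ^ (k - 1) * flow_coeff n N (n - 1) 0)"
  using assms by (simp_all add: cyclic_entry_def flow_coeff_def)

text \<open>Removing the edge from z to its successor opens the cycle into a path. It starts just
  after z, so z comes last and no step leaves from it.\<close>

lemma cycle_path:
  assumes "z < n"
  defines "\<sigma> \<equiv> \<lambda>p. (Suc z + p) mod n"
  shows "bij_betw \<sigma> {..<n} {..<n}" and "\<And>p. Suc p < n \<Longrightarrow> \<sigma> p \<noteq> z"
    and "\<And>p. \<sigma> (Suc p) = (if \<sigma> p = n - 1 then 0 else Suc (\<sigma> p))"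
proof -
  have n: "0 < n" using assms(1) by simp
  have \<sigma>: "\<sigma> p = (if Suc z + p < n then Suc z + p else Suc z + p - n)" if "p < n" for p
    using that assms(1) by (auto simp: \<sigma>_def mod_if)
  have "inj_on \<sigma> {..<n}"
  proof (rule inj_onI)
    fix p q assume "p \<in> {..<n}" "q \<in> {..<n}" "\<sigma> p = \<sigma> q"
    then show "p = q" using assms(1) by (auto simp: \<sigma> split: if_splits)
  qed
  moreover have "\<sigma> ` {..<n} \<subseteq> {..<n}" using n by (auto simp: \<sigma>_def)
  ultimately show "bij_betw \<sigma> {..<n} {..<n}"
    by (simp add: bij_betw_def endo_inj_surj)
  show "\<sigma> p \<noteq> z" if "Suc p < n" for p using that assms(1) by (auto simp: \<sigma>)
  show "\<sigma> (Suc p) = (if \<sigma> p = n - 1 then 0 else Suc (\<sigma> p))" for p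
    using n mod_Suc[of "Suc z + p" n] by (auto simp: \<sigma>_def)
qed

section \<open>Sufficiency of the conditions\<close>

context
  fixes n k :: nat and N :: "complex mat"
  assumes k: "2 \<le> k" "k + 2 \<le> n" and N: "N \<in> lie_u n"
begin

lemma N_carrier: "N \<in> sq_mat n" by (rule lie_u_carrier[OF N])

abbreviation "coord_flow I t \<equiv> mat_exp n (flow_gen n N) t * coord_frame n I"

abbreviation "\<beta> \<equiv> flow_coeff n N"

text \<open>Neighbours give an even exchange, the pair {0, n - 1} gives the parity of k - 1 built
  into \<open>cyclic_entry\<close>, and every other pair has coefficient 0.\<close>

lemma sign_of_cyclic:
  assumes zero: "\<And>i j. i < n \<Longrightarrow> j < n \<Longrightarrow> i \<noteq> j \<Longrightarrow> i \<noteq> Suc j \<Longrightarrow> j \<noteq> Suc i \<Longrightarrow> {i, j} \<noteq> {0, n - 1} \<Longrightarrow> \<beta> i j = 0"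
    and cyc: "\<And>j. j < n \<Longrightarrow> 0 \<le> cyclic_entry n k N j"
    and I: "I \<in> ksets n k" "x \<in> I" "y < n" "y \<notin> I"
  shows "0 \<le> (-1) ^ exchange_inv I x y * \<beta> x y"
proof -
  have n: "0 < n" using k by simp
  have x: "x < n" using I by (auto simp: ksets_def)
  have step: "0 \<le> \<beta> j (Suc j)" if "Suc j < n" for j
    using cyc[of j] cyclic_entry_flow_coeff(1)[OF n, of j k N] that n by (simp add: zero_le_mult_iff)
  have wrap: "0 \<le> (-1) ^ (k - 1) * \<beta> (n - 1) 0"
    using cyc[of "n - 1"] cyclic_entry_flow_coeff(2)[OF n, of "n - 1" k N] n by (simp add: zero_le_mult_iff)
  have "x \<noteq> y" using I by auto
  then consider "y = Suc x" | "x = Suc y" | "{x, y} = {0, n - 1}"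
    | "x \<noteq> y" "x \<noteq> Suc y" "y \<noteq> Suc x" "{x, y} \<noteq> {0, n - 1}" by argo
  then show ?thesis
  proof cases
    case 1
    then show ?thesis using exchange_inv_adjacent[OF I(2,4)] step I(3) by simp
  next
    case 2
    then show ?thesis using exchange_inv_adjacent[OF I(2,4)] step[of y] x flow_coeff_sym[OF N x I(3)] by simp
  next
    case 3
    then have "\<beta> x y = \<beta> (n - 1) 0"
      using flow_coeff_sym[OF N, of 0 "n - 1"] n by (auto simp: doubleton_eq_iff)
    then show ?thesis using exchange_inv_wrap[OF I(1,2,4) 3] wrap by simp
  next
    case 4
    then show ?thesis using zero[OF x I(3)] by simp
  qed
qed

lemma conditions_imp_positive:
  assumes real: "\<forall>i<n. \<forall>j<n. \<i> * N $$ (i, j) \<in> \<real>"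
    and zero: "\<forall>i<n. \<forall>j<n. \<not> [int i - int j = - 1] (mod int n) \<and>
                \<not> [int i - int j = 0] (mod int n) \<and> \<not> [int i - int j = 1] (mod int n)
                \<longrightarrow> N $$ (i, j) = 0"
    and cyc: "\<forall>j<n. 0 \<le> cyclic_entry n k N j"
    and card: "n - 1 \<le> card {j. j < n \<and> 0 < cyclic_entry n k N j}"
    and L: "\<And>t. L t \<in> adj_orbit n (omega k)" "\<And>t. has_mat_derivative n L (grad_field n N (L t)) t"
    and L0: "L 0 \<in> orbit_nonneg n (omega k)" and "0 < t"
  shows "L t \<in> orbit_pos n (omega k)"
proof -
  have n: "0 < n" "2 \<le> n" "k \<le> n" using k by auto
  have zero': "\<beta> i j = 0"
    if "i < n" "j < n" "i \<noteq> j" "i \<noteq> Suc j" "j \<noteq> Suc i" "{i, j} \<noteq> {0, n - 1}" for i j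
    using zero not_cyclically_adjacent_iff[OF n(2) that(1,2)] that by (simp add: flow_coeff_def)
  \<comment> \<open>At most one cyclic entry fails to be positive. The cycle is cut at that edge, or
    at an arbitrary one if there is none.\<close>
  have "\<exists>z<n. \<forall>j<n. j \<noteq> z \<longrightarrow> 0 < cyclic_entry n k N j"
  proof -
    let ?A = "{j. j < n \<and> 0 < cyclic_entry n k N j}"
    have "card ({..<n} - ?A) = n - card ?A" by (subst card_Diff_subset) auto
    then have "card ({..<n} - ?A) \<le> 1" using card by linarith
    then have eq: "\<And>x y. x \<in> {..<n} - ?A \<Longrightarrow> y \<in> {..<n} - ?A \<Longrightarrow> x = y"
      by (simp add: card_le_Suc0_iff_eq)
    have "\<exists>z. {..<n} - ?A \<subseteq> {z}"
    proof (cases "{..<n} - ?A = {}")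
      case False
      then obtain z where "z \<in> {..<n} - ?A" by blast
      then have "{..<n} - ?A \<subseteq> {z}" using eq by blast
      then show ?thesis ..
    qed auto
    then obtain z where z: "{..<n} - ?A \<subseteq> {z}" by blast
    show ?thesis
    proof (cases "z < n")
      case True
      then show ?thesis using z by (intro exI[of _ z]) auto
    next
      case False
      then show ?thesis using z n by (intro exI[of _ 0]) auto
    qed
  qed
  then obtain z where z: "z < n" "\<And>j. j < n \<Longrightarrow> j \<noteq> z \<Longrightarrow> 0 < cyclic_entry n k N j" by blast
  obtain g0 where g0: "g0 \<in> unitary_group n" "L 0 = \<i> \<cdot>\<^sub>m flag_proj n k g0" using orbitE[OF L(1)] .
  show ?thesis
  proof (rule flow_positive[OF L N_carrier g0(2,1) \<open>k \<le> n\<close> _ _ cycle_path(1)[OF z(1)] _ _ \<open>0 < t\<close>])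
    show "flow_gen n N $$ (i, j) = complex_of_real (\<beta> i j)" if "i < n" "j < n" for i j
      using flow_gen_real[OF N_carrier that] real that by simp
    show "0 \<le> (-1) ^ exchange_inv I x y * \<beta> x y"
      if "I \<in> ksets n k" "x \<in> I" "y < n" "y \<notin> I" for I x y
      by (rule sign_of_cyclic[OF zero' _ that]) (use cyc in auto)
    show "0 \<le> frame_minor k g0 I * cnj (frame_minor k g0 J)" if "I \<in> ksets n k" "J \<in> ksets n k" for I J
      using orbit_nonneg_minors[OF _ g0(1) \<open>k \<le> n\<close> that] L0 g0(2) by simp
    fix p assume p: "Suc p < n"
    let ?s = "\<lambda>p. (Suc z + p) mod n"
    have sn: "?s p < n" "?s (Suc p) < n" using n by auto
    have pos: "0 < cyclic_entry n k N (?s p)"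
      using cycle_path(2)[OF z(1) p] sn by (intro z(2)) auto
    have "\<beta> (?s p) (?s (Suc p)) \<noteq> 0"
    proof (cases "?s p = n - 1")
      case True
      then show ?thesis
        using pos cyclic_entry_flow_coeff(2)[OF n(1), of "?s p" k N] cycle_path(3)[OF z(1), of p] by auto
    next
      case False
      then have "?s p < n - 1" using sn(1) by linarith
      then show ?thesis
        using pos cyclic_entry_flow_coeff(1)[OF n(1), of "?s p" k N] cycle_path(3)[OF z(1), of p] False by auto
    qed
    then show "\<beta> (?s p) (?s (Suc p)) \<noteq> 0 \<and> \<beta> (?s (Suc p)) (?s p) \<noteq> 0"
      using flow_coeff_sym[OF N sn] by simp
  qed
qed

section \<open>Necessity of the conditions\<close>

context
  assumes pos: "\<And>L t. (\<And>t. L t \<in> adj_orbit n (omega k)) \<Longrightarrow>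
    (\<And>t. has_mat_derivative n L (grad_field n N (L t)) t) \<Longrightarrow>
    L 0 \<in> orbit_nonneg n (omega k) \<Longrightarrow> 0 < t \<Longrightarrow> L t \<in> orbit_pos n (omega k)"
begin

text \<open>\<open>flow_exists\<close> supplies a solution that starts at the coordinate subspace,
  and \<open>coord_frame_nonneg\<close> places its starting point in the closure, so
  \<open>pos\<close> applies to it.\<close>

lemma coord_flow_ratio:
  assumes I: "I \<in> ksets n k" and "0 < t"
  obtains \<delta> r where "\<And>J. J \<in> ksets n k \<Longrightarrow> 0 < r J \<and>
    frame_minor k (coord_flow I t) J = complex_of_real (r J) * \<delta>"
proof -
  have n: "k \<le> n" "0 < n" using k by auto
  note g0 = coord_frame_unitary[OF I]
  obtain L where L: "L 0 = \<i> \<cdot>\<^sub>m flag_proj n k (coord_frame n I)" "\<And>t. L t \<in> adj_orbit n (omega k)"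
    "\<And>t. has_mat_derivative n L (grad_field n N (L t)) t"
    by (rule flow_exists[OF N g0 n(1)]) (rule that)
  have "L t \<in> orbit_pos n (omega k)"
    by (rule pos[OF L(2,3) _ \<open>0 < t\<close>]) (simp only: L(1) coord_frame_nonneg[OF I n])
  from flow_minor_ratio[OF L(2,3) N_carrier L(1) g0 n(1) less_imp_le[OF \<open>0 < t\<close>] this] that
  show thesis by metis
qed

lemma coord_flow_derivative:
  assumes I: "I \<in> ksets n k" and ij: "i < n" "j < k"
  shows "((\<lambda>s. (coord_flow I s) $$ (i, j)) has_vector_derivative
    (\<Sum>l<n. flow_gen n N $$ (i, l) * (coord_flow I t) $$ (l, j))) (at t)"
  using k ij by (intro mat_exp_column_derivative flow_gen_carrier N_carrier
      unitary_carrier[OF coord_frame_unitary[OF I]]) auto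

lemma coord_flow_minor_derivative:
  assumes I: "I \<in> ksets n k" and J: "J \<in> ksets n k"
  defines "p \<equiv> \<lambda>J t. frame_minor k (coord_flow I t) J"
  shows "(p J has_vector_derivative (\<Sum>x\<in>J. flow_gen n N $$ (x, x)) * p J t +
    (\<Sum>(u, v)\<in>J \<times> ({..<n} - J).
       (-1) ^ exchange_inv J u v * flow_gen n N $$ (u, v) * p (insert v (J - {u})) t)) (at t)"
  unfolding p_def
  by (rule pluecker_has_vector_derivative[OF _ J]) (rule coord_flow_derivative[OF I])

lemma coord_flow_zero:
  assumes I: "I \<in> ksets n k" and J: "J \<in> ksets n k"
  shows "frame_minor k (coord_flow I 0) J = (if I = J then 1 else 0)"
proof -
  have "coord_flow I 0 = coord_frame n I"
    using unitary_carrier[OF coord_frame_unitary[OF I]] by (simp add: mat_exp_zero flow_gen_carrier N_carrier)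
  then show ?thesis using coord_frame_minor[OF I J] k by simp
qed

text \<open>The flow starts at the coordinate subspace of J with x replaced by y. There the
  coordinate of J is 0 and its derivative is the signed coefficient of this exchange; positivity
  afterwards makes it nonnegative.\<close>

lemma exchange_nonneg:
  assumes J: "J \<in> ksets n k" and x: "x \<in> J" and y: "y < n" "y \<notin> J"
  shows "0 \<le> (-1) ^ exchange_inv J x y * flow_gen n N $$ (x, y)"
proof -
  let ?I = "insert y (J - {x})"
  let ?Y = "\<lambda>t i b. (coord_flow ?I t) $$ (i, b)"
  let ?p = "\<lambda>J t. pluecker k (?Y t) J"
  have I: "?I \<in> ksets n k" by (rule ksets_exchange[OF J x y])
  have "?I \<noteq> J" using y by auto
  have fin: "finite J" using ksets_nth(4)[OF J] .
  note zero = coord_flow_zero[OF I]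
  define D1 where "D1 = (\<Sum>x\<in>J. flow_gen n N $$ (x, x)) * ?p J 0 +
    (\<Sum>(u, v)\<in>J \<times> ({..<n} - J).
       (-1) ^ exchange_inv J u v * flow_gen n N $$ (u, v) * ?p (insert v (J - {u})) 0)"
  have d1: "(?p J has_vector_derivative D1) (at 0)" unfolding D1_def by (rule coord_flow_minor_derivative[OF I J])
  \<comment> \<open>At time 0 only the coordinate of \<open>?I\<close> is nonzero, and (x, y) is the
    only exchange that leads from J to \<open>?I\<close>.\<close>
  have "(\<Sum>(u, v)\<in>J \<times> ({..<n} - J).
       (-1) ^ exchange_inv J u v * flow_gen n N $$ (u, v) * ?p (insert v (J - {u})) 0) =
    (\<Sum>e\<in>J \<times> ({..<n} - J). if e = (x, y) then (-1) ^ exchange_inv J x y * flow_gen n N $$ (x, y) else 0)"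
  proof (rule sum.cong[OF refl])
    fix e assume e: "e \<in> J \<times> ({..<n} - J)"
    obtain u v where uv: "e = (u, v)" "u \<in> J" "v < n" "v \<notin> J" using e by auto
    have "?I = insert v (J - {u}) \<longleftrightarrow> u = x \<and> v = y"
    proof
      assume eq: "?I = insert v (J - {u})"
      then have "v \<in> ?I" by simp
      then have "v = y" using uv(4) by simp
      moreover have "u \<notin> ?I" unfolding eq using uv by auto
      then have "u = x" using uv(2) by simp
      ultimately show "u = x \<and> v = y" by simp
    qed auto
    then show "(case e of (u, v) \<Rightarrow> (-1) ^ exchange_inv J u v * flow_gen n N $$ (u, v) * ?p (insert v (J - {u})) 0) =
        (if e = (x, y) then (-1) ^ exchange_inv J x y * flow_gen n N $$ (x, y) else 0)"
      using zero[OF ksets_exchange[OF J uv(2,3,4)]] uv(1) by simp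
  qed
  also have "\<dots> = (-1) ^ exchange_inv J x y * flow_gen n N $$ (x, y)"
    using fin x y by simp
  finally have D1: "D1 = (-1) ^ exchange_inv J x y * flow_gen n N $$ (x, y)"
    unfolding D1_def zero[OF J] using \<open>?I \<noteq> J\<close> by simp
  obtain D2 where d2: "(?p ?I has_vector_derivative D2) (at 0)"
    by (rule that) (rule coord_flow_minor_derivative[OF I I])
  \<comment> \<open>The common factor \<delta> is unknown and varies with t. Multiplying by the
    conjugate of the coordinate of \<open>?I\<close>, which is 1 at time 0, replaces it by its
    squared modulus.\<close>
  have "((\<lambda>t. ?p J t * cnj (?p ?I t)) has_vector_derivative ?p J 0 * cnj D2 + D1 * cnj (?p ?I 0)) (at 0)"
    by (intro has_vector_derivative_mult d1 bounded_linear.has_vector_derivative[OF bounded_linear_cnj] d2)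
  then have "((\<lambda>t. ?p J t * cnj (?p ?I t)) has_vector_derivative D1) (at 0)"
    using zero[OF J] zero[OF I] \<open>?I \<noteq> J\<close> by simp
  then have "0 \<le> D1"
  proof (rule nonneg_derivative)
    show "?p J 0 * cnj (?p ?I 0) = 0" using zero[OF J] \<open>?I \<noteq> J\<close> by simp
    fix t :: real assume "0 < t"
    obtain \<delta> r where r: "\<And>J. J \<in> ksets n k \<Longrightarrow> 0 < r J \<and> ?p J t = complex_of_real (r J) * \<delta>"
      by (rule coord_flow_ratio[OF I \<open>0 < t\<close>]) (rule that)
    have "?p J t * cnj (?p ?I t) = complex_of_real (r J * r ?I) * (\<delta> * cnj \<delta>)"
      using r[OF J] r[OF I] by simp
    also have "\<dots> = complex_of_real (r J * r ?I * (cmod \<delta>)\<^sup>2)"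
      by (simp only: of_real_mult complex_norm_square)
    finally show "0 \<le> ?p J t * cnj (?p ?I t)"
      using r[OF J] r[OF I] by (simp add: less_eq_complex_def del: of_real_mult)
  qed
  then show ?thesis by (simp only: D1)
qed

lemma ksets_containing:
  assumes S: "S \<subseteq> {..<n}" "card S \<le> k" and T: "T \<subseteq> {..<n}" "S \<inter> T = {}" "card T \<le> n - k"
  obtains J where "J \<in> ksets n k" "S \<subseteq> J" "J \<inter> T = {}"
proof -
  have fin: "finite S" "finite T" using S T finite_subset by blast+
  have "card ({..<n} - T - S) = n - card T - card S"
    using fin S T by (subst card_Diff_subset; (subst card_Diff_subset)?) auto
  then have "k - card S \<le> card ({..<n} - T - S)" using T S k by linarith
  then obtain U where U: "U \<subseteq> {..<n} - T - S" "card U = k - card S" "finite U"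
    by (metis obtain_subset_with_card_n finite_Diff finite_lessThan finite_subset)
  have "card (S \<union> U) = k" using U fin S by (subst card_Un_disjoint) auto
  then show thesis using that[of "S \<union> U"] U S T by (auto simp: ksets_def)
qed

lemma ksets_separating:
  assumes "x < n" "y < n" "x \<noteq> y"
  obtains J where "J \<in> ksets n k" "x \<in> J" "y \<notin> J"
proof -
  obtain J where "J \<in> ksets n k" "{x} \<subseteq> J" "J \<inter> {y} = {}"
    by (rule ksets_containing[of "{x}" "{y}"]) (use assms k in auto)
  then show thesis by (intro that[of J]) auto
qed

text \<open>Nonnegativity of complex numbers includes reality; off the diagonal it is applied to an
  exchange that separates i from j. On the diagonal N is skew-Hermitian.\<close>

lemma N_real:
  assumes ij: "i < n" "j < n"
  shows "\<i> * N $$ (i, j) \<in> \<real>"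
proof (cases "i = j")
  case True
  then show ?thesis using skew_entry[OF N ij(1) ij(1)] by (metis Reals_cnj_iff)
next
  case False
  obtain J where J: "J \<in> ksets n k" "i \<in> J" "j \<notin> J" by (rule ksets_separating[OF ij False]) (rule that)
  define m where "m = exchange_inv J i j"
  have "0 \<le> (-1) ^ m * flow_gen n N $$ (i, j)"
    unfolding m_def by (rule exchange_nonneg[OF J(1,2) ij(2) J(3)])
  then have "(-1) ^ m * flow_gen n N $$ (i, j) \<in> \<real>" by (simp add: less_eq_complex_def complex_is_Real_iff)
  moreover have "\<i> * N $$ (i, j) = (-1) ^ m * (2 * complex_of_nat n) * ((-1) ^ m * flow_gen n N $$ (i, j))"
    using k by (simp add: flow_gen_entry[OF N_carrier ij] mult.assoc[symmetric] power_mult_distrib[symmetric])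
  ultimately show ?thesis by (metis Reals_mult Reals_power Reals_minus Reals_1 Reals_numeral Reals_of_nat)
qed

lemma exchange_coeff_nonneg:
  assumes J: "J \<in> ksets n k" "x \<in> J" "y < n" "y \<notin> J"
  shows "0 \<le> (-1) ^ exchange_inv J x y * \<beta> x y"
proof -
  have x: "x < n" using J ksets_nth(5) by auto
  have "0 \<le> complex_of_real ((-1) ^ exchange_inv J x y * \<beta> x y)"
    using exchange_nonneg[OF J] flow_gen_real[OF N_carrier x J(3) N_real[OF x J(3)]] by simp
  then show ?thesis unfolding less_eq_complex_def by (simp del: of_real_mult)
qed

lemma step_coeff_nonneg:
  assumes "Suc j < n"
  shows "0 \<le> \<beta> j (Suc j)"
proof -
  obtain J where J: "J \<in> ksets n k" "j \<in> J" "Suc j \<notin> J"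
    by (rule ksets_separating[of j "Suc j"]) (use assms in auto)
  then show ?thesis using exchange_coeff_nonneg[OF J(1,2) assms J(3)] exchange_inv_adjacent[OF J(2,3)] by simp
qed

lemma wrap_coeff_nonneg: "0 \<le> (-1) ^ (k - 1) * \<beta> (n - 1) 0"
proof -
  have n: "n - 1 < n" "0 < n" "n - 1 \<noteq> 0" using k by auto
  obtain J where J: "J \<in> ksets n k" "n - 1 \<in> J" "0 \<notin> J"
    by (rule ksets_separating[of "n - 1" 0]) (use n in auto)
  have "exchange_inv J (n - 1) 0 = k - 1" by (rule exchange_inv_wrap[OF J]) auto
  then show ?thesis using exchange_coeff_nonneg[OF J(1,2) n(2) J(3)] by simp
qed

lemma cyclic_entry_nonneg: "j < n \<Longrightarrow> 0 \<le> cyclic_entry n k N j"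
  using step_coeff_nonneg[of j] wrap_coeff_nonneg k cyclic_entry_flow_coeff[of n j k N]
  by (cases "j < n - 1") auto

text \<open>For \<open>x < c < y\<close> and \<open>d\<close> outside \<open>[x, y]\<close>, replacing \<open>c\<close> by \<open>d\<close> in \<open>J\<close> changes the sign of the
  exchange of \<open>x\<close> and \<open>y\<close>; this is where both bounds \<open>2 \<le> k \<le> n - 2\<close> are needed.\<close>
lemma coeff_zero_aux:
  assumes xy: "x < y" "y < n" "y \<noteq> Suc x" "\<not> (x = 0 \<and> y = n - 1)"
  shows "\<beta> x y = 0"
proof -
  define c where "c = Suc x"
  \<comment> \<open>Since [x, y] is not the whole range, one of the ends 0 and n - 1 lies outside
    it.\<close>
  define d where "d = (if x = 0 then n - 1 else 0)"
  have cd: "x < c" "c < y" "d < n" "d < x \<or> y < d" using xy by (auto simp: c_def d_def)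
  have neq: "x \<noteq> c" "x \<noteq> d" "x \<noteq> y" "c \<noteq> d" "c \<noteq> y" "d \<noteq> y" "c < n" "x < n" using cd xy by auto
  obtain J where J: "J \<in> ksets n k" "{x, c} \<subseteq> J" "J \<inter> {y, d} = {}"
    by (rule ksets_containing[of "{x, c}" "{y, d}"]) (use neq cd xy k in auto)
  let ?J = "insert d (J - {c})"
  have J': "?J \<in> ksets n k" by (rule ksets_exchange) (use J cd in auto)
  have fin: "finite J" using ksets_nth(4)[OF J(1)] .
  let ?K = "J - {x} - {c}"
  have "finite ?K" using fin by simp
  have c1: "card {s \<in> J - {x}. s < w} = card {s \<in> ?K. s < w} + (if c < w then 1 else 0)" for w
  proof -
    have "{s \<in> J - {x}. s < w} = (if c < w then insert c {s \<in> ?K. s < w} else {s \<in> ?K. s < w})"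
      using J neq by auto
    then show ?thesis using fin by simp
  qed
  have c2: "card {s \<in> ?J - {x}. s < w} = card {s \<in> ?K. s < w} + (if d < w then 1 else 0)" for w
  proof -
    have "{s \<in> ?J - {x}. s < w} = (if d < w then insert d {s \<in> ?K. s < w} else {s \<in> ?K. s < w})"
      using J neq by auto
    then show ?thesis using fin J by simp
  qed
  define m where "m = card {s \<in> ?K. s < x} + card {s \<in> ?K. s < y}"
  \<comment> \<open>c lies between x and y and is counted once; d lies below both or above both and
    is counted twice or not at all. The two parities differ.\<close>
  have e1: "exchange_inv J x y = m + 1" unfolding exchange_inv_def c1 m_def using cd by simp
  have e2: "exchange_inv ?J x y = m \<or> exchange_inv ?J x y = m + 2"
    unfolding exchange_inv_def c2 m_def using cd xy by auto
  have "0 \<le> (-1) ^ exchange_inv J x y * \<beta> x y" by (rule exchange_coeff_nonneg) (use J xy in auto)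
  moreover have "0 \<le> (-1) ^ exchange_inv ?J x y * \<beta> x y"
    by (rule exchange_coeff_nonneg[OF J']) (use J xy neq in auto)
  ultimately have "0 \<le> - ((-1) ^ m * \<beta> x y)" "0 \<le> (-1) ^ m * \<beta> x y" using e1 e2 by auto
  then show ?thesis by auto
qed

lemma coeff_zero:
  assumes ij: "i < n" "j < n" "i \<noteq> j" "i \<noteq> Suc j" "j \<noteq> Suc i" "{i, j} \<noteq> {0, n - 1}"
  shows "\<beta> i j = 0"
proof (cases "i < j")
  case True
  then show ?thesis using coeff_zero_aux[of i j] ij by auto
next
  case False
  have "\<not> (j = 0 \<and> i = n - 1)" using ij(6) by (auto simp: insert_commute)
  then have "\<beta> j i = 0" using coeff_zero_aux[of j i] ij False by simp
  then show ?thesis using flow_coeff_sym[OF N ij(1,2)] by simp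
qed

lemma N_zero:
  assumes "i < n" "j < n" "i \<noteq> j" "i \<noteq> Suc j" "j \<noteq> Suc i" "{i, j} \<noteq> {0, n - 1}"
  shows "N $$ (i, j) = 0"
proof -
  have "flow_gen n N $$ (i, j) = 0"
    using coeff_zero[OF assms] flow_gen_real[OF N_carrier assms(1,2) N_real[OF assms(1,2)]] by simp
  then show ?thesis using k by (simp add: flow_gen_entry[OF N_carrier assms(1,2)])
qed

text \<open>If the edges after \<open>z1\<close> and after \<open>z2\<close> both vanish, the arc \<open>{z1<..z2}\<close> is decoupled from its
  complement, and the number of elements of \<open>J\<close> in the arc is conserved.\<close>
lemma two_zero_edges:
  assumes z: "z1 < z2" "z2 < n" and zero: "cyclic_entry n k N z1 = 0" "cyclic_entry n k N z2 = 0"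
  shows False
proof -
  have n: "0 < n" using k by simp
  let ?A = "{z1<..z2}"
  have b1: "\<beta> z1 (Suc z1) = 0" using zero(1) cyclic_entry_flow_coeff(1)[OF n, of z1 k N] z n by simp
  have b2: "\<beta> z2 (if z2 = n - 1 then 0 else Suc z2) = 0"
  proof (cases "z2 = n - 1")
    case True
    then show ?thesis using zero(2) cyclic_entry_flow_coeff(2)[OF n, of z2 k N] n by simp
  next
    case False
    then show ?thesis using zero(2) cyclic_entry_flow_coeff(1)[OF n, of z2 k N] z n by simp
  qed
  \<comment> \<open>By \<open>coeff_zero\<close> only cyclic neighbours are coupled, so the arc can
    be left only across its two end edges, and both of their coefficients vanish.\<close>
  have cross1: "\<beta> x y = 0" if x: "x < n" "x \<in> ?A" and y: "y < n" "y \<notin> ?A" for x y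
  proof -
    have "x \<noteq> y" using x y by auto
    then consider "y = Suc x" | "x = Suc y" | "{x, y} = {0, n - 1}"
      | "x \<noteq> y" "x \<noteq> Suc y" "y \<noteq> Suc x" "{x, y} \<noteq> {0, n - 1}" by argo
    then show ?thesis
    proof cases
      case 1
      then have "x = z2" "x \<noteq> n - 1" using x y by auto
      then show ?thesis using b2 1 by simp
    next
      case 2
      then have "y = z1" using x y by auto
      then show ?thesis using b1 2 flow_coeff_sym[OF N x(1) y(1)] by simp
    next
      case 3
      then have "x = n - 1" "y = 0" "z2 = n - 1" using x y z by (auto simp: doubleton_eq_iff)
      then show ?thesis using b2 by simp
    next
      case 4
      then show ?thesis using coeff_zero[OF x(1) y(1)] by simp
    qed
  qed
  have cross: "(x \<in> ?A) = (y \<in> ?A)" if "x < n" "y < n" "\<beta> x y \<noteq> 0" for x y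
    using cross1[of x y] cross1[of y x] flow_coeff_sym[OF N that(1,2)] that by metis
  \<comment> \<open>Moving z2 to z1 takes one element out of the arc, so I and \<open>?J\<close>
    have different counts although both belong to \<open>ksets n k\<close>.\<close>
  obtain I where I: "I \<in> ksets n k" "z2 \<in> I" "z1 \<notin> I"
    by (rule ksets_separating[of z2 z1]) (use z in auto)
  let ?J = "insert z1 (I - {z2})"
  have "z1 < n" using z by simp
  have J: "?J \<in> ksets n k" by (rule ksets_exchange[OF I(1,2) \<open>z1 < n\<close> I(3)])
  have finI: "finite I" using ksets_nth(4)[OF I(1)] .
  define S where "S = {J \<in> ksets n k. card (J \<inter> ?A) \<noteq> card (I \<inter> ?A)}"
  have "?J \<inter> ?A = I \<inter> ?A - {z2}" using z by auto
  then have "card (?J \<inter> ?A) < card (I \<inter> ?A)"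
    using finI I z by (metis IntI card_Diff1_less finite_Int greaterThanAtMost_iff order_refl)
  then have JS: "?J \<in> S" using J by (simp add: S_def)
  have vanish: "frame_minor k (coord_flow I t) ?J = 0" if "0 \<le> t" for t
  proof (rule pluecker_vanishes_on[where Y = "\<lambda>t i b. (coord_flow I t) $$ (i, b)"
        and b = \<beta> and S = S and n = n, OF _ _ _ _ _ JS that])
    show "((\<lambda>s. (coord_flow I s) $$ (i, j)) has_vector_derivative
        (\<Sum>l<n. complex_of_real (\<beta> i l) * (coord_flow I t) $$ (l, j))) (at t)"
      if "i < n" "j < k" for i j t
      using coord_flow_derivative[OF I(1) that, of t] flow_gen_real[OF N_carrier that(1) _ N_real[OF that(1)]]
      by simp
    show "S \<subseteq> ksets n k" by (auto simp: S_def)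
    show "0 \<le> (-1) ^ exchange_inv J x y * \<beta> x y" if "J \<in> S" "x \<in> J" "y < n" "y \<notin> J" for J x y
      using exchange_coeff_nonneg that by (auto simp: S_def)
    show "insert y (J - {x}) \<in> S" if J: "J \<in> S" "x \<in> J" "y < n" "y \<notin> J" "\<beta> x y \<noteq> 0" for J x y
    proof -
      have JK: "J \<in> ksets n k" using J by (simp add: S_def)
      have "x < n" using ksets_nth(5)[OF JK] J by auto
      then have xy: "(x \<in> ?A) = (y \<in> ?A)" using cross J by blast
      have finJ: "finite (J \<inter> ?A)" by simp
      have "card (insert y (J - {x}) \<inter> ?A) = card (J \<inter> ?A)"
      proof (cases "x \<in> ?A")
        case True
        then have "insert y (J - {x}) \<inter> ?A = insert y (J \<inter> ?A - {x})" using xy by auto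
        then show ?thesis using card_Suc_Diff1[OF finJ, of x] True J by simp
      next
        case False
        then have "insert y (J - {x}) \<inter> ?A = J \<inter> ?A" using xy by auto
        then show ?thesis by simp
      qed
      then show ?thesis using J ksets_exchange[OF JK J(2-4)] by (simp add: S_def)
    qed
    show "frame_minor k (coord_flow I 0) J = 0" if "J \<in> S" for J
      using coord_flow_zero[OF I(1), of J] that by (auto simp: S_def)
  qed
  let ?f = "\<lambda>t. frame_minor k (coord_flow I t) I"
  \<comment> \<open>The coordinate of \<open>?J\<close> vanishes and is a positive multiple of
    \<delta>, so \<delta> = 0. Then the coordinate of I vanishes as well, although it is continuous
    and equals 1 at time 0.\<close>
  have "?f t = 0" if t: "0 < t" for t
  proof -
    obtain \<delta> r where r: "\<And>J. J \<in> ksets n k \<Longrightarrow> 0 < r J \<and>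
        frame_minor k (coord_flow I t) J = complex_of_real (r J) * \<delta>"
      by (rule coord_flow_ratio[OF I(1) t]) (rule that)
    from r[OF J] vanish[of t] t have "\<delta> = 0" by auto
    then show ?thesis using r[OF I(1)] by simp
  qed
  then have "\<forall>\<^sub>F t in at_right 0. ?f t = 0" by (intro eventually_at_rightI[of 0 1]) auto
  then have "(?f \<longlongrightarrow> 0) (at_right 0)" by (rule tendsto_eventually)
  moreover have "isCont ?f 0"
    by (rule has_vector_derivative_continuous) (rule coord_flow_minor_derivative[OF I(1) I(1)])
  then have "(?f \<longlongrightarrow> ?f 0) (at_right 0)" unfolding isCont_def filterlim_at_split by blast
  ultimately have "?f 0 = 0" using tendsto_unique[OF trivial_limit_at_right_real] by blast
  then show False using coord_flow_zero[OF I(1) I(1)] by simp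
qed

lemma positive_imp_conditions:
  "(\<forall>i<n. \<forall>j<n. \<i> * N $$ (i, j) \<in> \<real>) \<and>
   (\<forall>i<n. \<forall>j<n. \<not> [int i - int j = - 1] (mod int n) \<and>
      \<not> [int i - int j = 0] (mod int n) \<and> \<not> [int i - int j = 1] (mod int n) \<longrightarrow> N $$ (i, j) = 0) \<and>
   (\<forall>j<n. 0 \<le> cyclic_entry n k N j) \<and> n - 1 \<le> card {j. j < n \<and> 0 < cyclic_entry n k N j}"
proof (intro conjI allI impI)
  fix i j assume ij: "i < n" "j < n"
  show "\<i> * N $$ (i, j) \<in> \<real>" by (rule N_real[OF ij])
  assume "\<not> [int i - int j = - 1] (mod int n) \<and>
      \<not> [int i - int j = 0] (mod int n) \<and> \<not> [int i - int j = 1] (mod int n)"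
  then have "i \<noteq> j \<and> i \<noteq> Suc j \<and> j \<noteq> Suc i \<and> {i, j} \<noteq> {0, n - 1}"
    using not_cyclically_adjacent_iff[OF _ ij] k by auto
  then show "N $$ (i, j) = 0" by (intro N_zero ij) auto
next
  show "0 \<le> cyclic_entry n k N j" if "j < n" for j by (rule cyclic_entry_nonneg[OF that])
  let ?A = "{j. j < n \<and> 0 < cyclic_entry n k N j}"
  have zero: "cyclic_entry n k N j = 0" if "j \<in> {..<n} - ?A" for j
    using cyclic_entry_nonneg[of j] that by auto
  have "x = y" if "x \<in> {..<n} - ?A" "y \<in> {..<n} - ?A" for x y
  proof (rule ccontr)
    assume "x \<noteq> y"
    then have "x < y \<or> y < x" by auto
    then show False using two_zero_edges[of x y] two_zero_edges[of y x] zero[OF that(1)] zero[OF that(2)] that by auto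
  qed
  then have "card ({..<n} - ?A) \<le> 1" by (simp add: card_le_Suc0_iff_eq)
  moreover have "card ({..<n} - ?A) = n - card ?A" by (subst card_Diff_subset) auto
  ultimately show "n - 1 \<le> card ?A" by linarith
qed

end

end

theorem theorem1p3:
  fixes n k :: nat and N :: "complex mat"
  assumes "2 \<le> k" and "k + 2 \<le> n"
    and "N \<in> lie_u n"
  shows "(\<forall>metric1 \<in> {kaehler_metric n, normal_metric n, induced_metric n}.
          \<forall>metric2 \<in> {kaehler_metric n, normal_metric n, induced_metric n}.
            \<exists>C>0. \<forall>L \<in> adj_orbit n (omega k). \<forall>V \<in> tangent_space n L. \<forall>W \<in> tangent_space n L.
              metric1 L V W = C * metric2 L V W) \<and>
         (\<forall>metric \<in> {kaehler_metric n, normal_metric n, induced_metric n}.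
            gradient_flow_strictly_preserves_positivity n (omega k) metric
              (\<lambda>L. Re (mat_trace (L * N)))
            \<longleftrightarrow>
            (\<forall>i<n. \<forall>j<n. \<i> * N $$ (i, j) \<in> \<real>) \<and>
            (\<forall>i<n. \<forall>j<n. \<not> [int i - int j = - 1] (mod int n) \<and>
                \<not> [int i - int j = 0] (mod int n) \<and> \<not> [int i - int j = 1] (mod int n)
                \<longrightarrow> N $$ (i, j) = 0) \<and>
            (\<forall>j<n. 0 \<le> cyclic_entry n k N j) \<and>
            n - 1 \<le> card {j. j < n \<and> 0 < cyclic_entry n k N j})"
proof (intro conjI ballI)
  fix metric1 metric2
  assume m: "metric1 \<in> {kaehler_metric n, normal_metric n, induced_metric n}"
    "metric2 \<in> {kaehler_metric n, normal_metric n, induced_metric n}"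
  have "metric1 L V W = 1 * metric2 L V W"
    if "L \<in> adj_orbit n (omega k)" "V \<in> tangent_space n L" "W \<in> tangent_space n L" for L V W
    using metric_eq[OF orbit_lie_u[OF that(1)] m(1) that(2,3)]
      metric_eq[OF orbit_lie_u[OF that(1)] m(2) that(2,3)] by simp
  then show "\<exists>C>0. \<forall>L \<in> adj_orbit n (omega k). \<forall>V \<in> tangent_space n L. \<forall>W \<in> tangent_space n L.
      metric1 L V W = C * metric2 L V W"
    by (intro exI[of _ 1]) auto
next
  fix metric
  assume m: "metric \<in> {kaehler_metric n, normal_metric n, induced_metric n}"
  have "0 < n" using assms by simp
  \<comment> \<open>The metric disappears here: for each of the three, the claim concerns the
    solutions of one and the same differential equation.\<close>
  have "gradient_flow_strictly_preserves_positivity n (omega k) metric (\<lambda>L. Re (mat_trace (L * N))) \<longleftrightarrow>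
    (\<forall>L. (\<forall>t. L t \<in> adj_orbit n (omega k)) \<and> (\<forall>t. has_mat_derivative n L (grad_field n N (L t)) t) \<and>
       L 0 \<in> orbit_nonneg n (omega k) \<longrightarrow> (\<forall>t>0. L t \<in> orbit_pos n (omega k)))"
    unfolding gradient_flow_strictly_preserves_positivity_def is_gradient_flow_iff[OF m assms(3) \<open>0 < n\<close>]
    by blast
  then show "gradient_flow_strictly_preserves_positivity n (omega k) metric
              (\<lambda>L. Re (mat_trace (L * N)))
            \<longleftrightarrow>
            (\<forall>i<n. \<forall>j<n. \<i> * N $$ (i, j) \<in> \<real>) \<and>
            (\<forall>i<n. \<forall>j<n. \<not> [int i - int j = - 1] (mod int n) \<and>
                \<not> [int i - int j = 0] (mod int n) \<and> \<not> [int i - int j = 1] (mod int n)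
                \<longrightarrow> N $$ (i, j) = 0) \<and>
            (\<forall>j<n. 0 \<le> cyclic_entry n k N j) \<and>
            n - 1 \<le> card {j. j < n \<and> 0 < cyclic_entry n k N j}" (is "?P \<longleftrightarrow> ?R")
  proof (elim ssubst, intro iffI)
    assume "\<forall>L. (\<forall>t. L t \<in> adj_orbit n (omega k)) \<and> (\<forall>t. has_mat_derivative n L (grad_field n N (L t)) t) \<and>
       L 0 \<in> orbit_nonneg n (omega k) \<longrightarrow> (\<forall>t>0. L t \<in> orbit_pos n (omega k))"
    then show ?R by (intro positive_imp_conditions[OF assms]) blast
  next
    assume R: ?R
    show "\<forall>L. (\<forall>t. L t \<in> adj_orbit n (omega k)) \<and> (\<forall>t. has_mat_derivative n L (grad_field n N (L t)) t) \<and>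
       L 0 \<in> orbit_nonneg n (omega k) \<longrightarrow> (\<forall>t>0. L t \<in> orbit_pos n (omega k))"
      using conditions_imp_positive[OF assms] R by blast
  qed
qed

end
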